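(* Let $R:=\mathbb F_p[X_1,\dots,X_m]$ with its standard grading and let $I\subseteq R$ be a graded ideal. Write $q=p^n$. Then: (i) $f_{gHK}^{R/I}(n)=e_{gHK}(R/I)\,q^m$ for all $n$; (ii) $e_{gHK}(R/I)$ is the length of some finite length $R$-module; in particular, $e_{gHK}(R/I)\in\mathbb N_0$; (iii) $e_{gHK}(R/I)>0$ if and only if the projective dimension of $R/I$ over $R$ equals $\dim R$.
   Context: Let $\mathfrak m=(X_1,\dots,X_m)$. $I^{[q]}=(x^q:x\in I)$; $H^0_{\mathfrak m}(M)$ is the submodule of elements of $M$ annihilated by some power of $\mathfrak m$; $f_{gHK}^{R/I}(n)$ is the length of $H^0_{\mathfrak m}(R/I^{[p^n]})$; $e_{gHK}(R/I)=\lim_{n\to\infty} f_{gHK}^{R/I}(n)/p^{n\dim R}$ if the limit exists, and $\infty$ otherwise. $\mathbb N_0=\{0,1,2,\dots\}$. *)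

theory Defs
  imports
    "Berlekamp_Zassenhaus.Finite_Field"
    "HOL-Library.Poly_Mapping"
    "HOL-Library.Extended_Real"
    "HOL-Algebra.Algebra"
begin

section \<open>Polynomial rings and graded ideals\<close>

text \<open>Polynomials in variables indexed by \<open>nat\<close>; a monomial is its exponent vector
  \<open>nat \<Rightarrow>\<^sub>0 nat\<close>. The variables \<open>X\<^sub>1, \<dots>, X\<^sub>m\<close> are indexed by \<open>0, \<dots>, m - 1\<close>.\<close>

type_synonym 'a mpol = "(nat \<Rightarrow>\<^sub>0 nat) \<Rightarrow>\<^sub>0 'a"

definition mpol_ring :: "nat \<Rightarrow> ('a::comm_ring_1) mpol ring" where
  "mpol_ring m = \<lparr>carrier = {f. \<forall>t \<in> Poly_Mapping.keys f. Poly_Mapping.keys t \<subseteq> {..<m}},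
     monoid.mult = (*), one = 1, ring.zero = 0, add = (+)\<rparr>"

definition mpol_var :: "nat \<Rightarrow> ('a::comm_ring_1) mpol" where
  "mpol_var i = Poly_Mapping.single (Poly_Mapping.single i 1) 1"

definition total_deg :: "(nat \<Rightarrow>\<^sub>0 nat) \<Rightarrow> nat" where
  "total_deg t = (\<Sum>i \<in> Poly_Mapping.keys t. Poly_Mapping.lookup t i)"

definition hom_component :: "nat \<Rightarrow> ('a::comm_ring_1) mpol \<Rightarrow> 'a mpol" where
  "hom_component d f =
     (\<Sum>t \<in> {t \<in> Poly_Mapping.keys f. total_deg t = d}.
        Poly_Mapping.single t (Poly_Mapping.lookup f t))"

definition graded_ideal :: "nat \<Rightarrow> ('a::comm_ring_1) mpol set \<Rightarrow> bool" where
  "graded_ideal m I \<longleftrightarrow> ideal I (mpol_ring m) \<and> (\<forall>f \<in> I. \<forall>d. hom_component d f \<in> I)"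

definition irrelevant_ideal :: "nat \<Rightarrow> ('a::comm_ring_1) mpol set" where
  "irrelevant_ideal m = Idl\<^bsub>mpol_ring m\<^esub> (mpol_var ` {..<m})"


section \<open>Quotients, local cohomology and length\<close>

text \<open>\<open>R/I\<close> as an \<open>R\<close>-module: \<open>r\<close> acts as multiplication by its residue class.\<close>

definition quot_module :: "('a, 'r) ring_scheme \<Rightarrow> 'a set \<Rightarrow> ('a, 'a set) module" where
  "quot_module R I =
     ring.extend (R Quot I) (module.fields (\<lambda>r c. (I +>\<^bsub>R\<^esub> r) \<otimes>\<^bsub>R Quot I\<^esub> c))"

definition frobenius_power :: "('a, 'r) ring_scheme \<Rightarrow> 'a set \<Rightarrow> nat \<Rightarrow> 'a set" where
  "frobenius_power R I q = Idl\<^bsub>R\<^esub> ((\<lambda>x. x [^]\<^bsub>R\<^esub> q) ` I)"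

text \<open>Powers of an ideal are powers in the multiplicative monoid \<^const>\<open>ideals_set\<close> of ideals,
  whose unit is the whole ring.\<close>

definition local_cohomology0 ::
  "('a, 'r) ring_scheme \<Rightarrow> 'a set \<Rightarrow> ('a, 'b) module \<Rightarrow> ('a, 'b) module" where
  "local_cohomology0 R J M = M\<lparr>carrier :=
     {x \<in> carrier M. \<exists>k::nat. \<forall>a \<in> J [^]\<^bsub>ideals_set R\<^esub> k. a \<odot>\<^bsub>M\<^esub> x = \<zero>\<^bsub>M\<^esub>}\<rparr>"

definition module_length :: "('a, 'r) ring_scheme \<Rightarrow> ('a, 'b) module \<Rightarrow> enat" where
  "module_length R M =
     Sup {enat n | n. \<exists>N. (\<forall>i \<le> n. submodule (N i) R M) \<and> (\<forall>i < n. N i \<subset> N (Suc i))}"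

definition krull_dim :: "('a, 'r) ring_scheme \<Rightarrow> enat" where
  "krull_dim R =
     Sup {enat n | n. \<exists>Q. (\<forall>i \<le> n. primeideal (Q i) R) \<and> (\<forall>i < n. Q i \<subset> Q (Suc i))}"


section \<open>Projective dimension\<close>

definition module_hom ::
  "('a, 'r) ring_scheme \<Rightarrow> ('a, 'b) module \<Rightarrow> ('a, 'c) module \<Rightarrow> ('b \<Rightarrow> 'c) set" where
  "module_hom R M N = {h \<in> hom (add_monoid M) (add_monoid N).
     \<forall>a \<in> carrier R. \<forall>x \<in> carrier M. h (a \<odot>\<^bsub>M\<^esub> x) = a \<odot>\<^bsub>N\<^esub> h x}"

text \<open>The lifting property. A definition cannot quantify over the carrier types of the test modules
  \<open>N\<close> and \<open>L\<close>; the types chosen lose nothing. They admit \<open>L = P\<close> and, as \<open>N\<close>, the free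
  module on the carrier of \<open>P\<close> (finitely supported functions), so the property makes \<open>P\<close> a direct
  summand of a free module and thus yields lifting against test modules of every type.\<close>

definition projective_module :: "('a, 'r) ring_scheme \<Rightarrow> ('a, 'b) module \<Rightarrow> bool" where
  "projective_module R P \<longleftrightarrow> module R P \<and>
     (\<forall>(N :: ('a, 'b \<Rightarrow> 'a) module) (L :: ('a, 'b) module). \<forall>g f.
        module R N \<longrightarrow> module R L \<longrightarrow>
        g \<in> module_hom R N L \<longrightarrow> g ` carrier N = carrier L \<longrightarrow> f \<in> module_hom R P L \<longrightarrow>
        (\<exists>h \<in> module_hom R P N. \<forall>x \<in> carrier P. g (h x) = f x))"

text \<open>Exactness of \<open>\<dots> \<rightarrow> P\<^sub>2 \<rightarrow> P\<^sub>1 \<rightarrow> P\<^sub>0 \<rightarrow> M \<rightarrow> 0\<close> with \<open>d i : P (Suc i) \<rightarrow> P i\<close> and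
  augmentation \<open>e\<close>.\<close>

definition projective_resolution ::
  "('a, 'r) ring_scheme \<Rightarrow> ('a, 'b) module \<Rightarrow> (nat \<Rightarrow> ('a, 'c) module) \<Rightarrow>
   (nat \<Rightarrow> 'c \<Rightarrow> 'c) \<Rightarrow> ('c \<Rightarrow> 'b) \<Rightarrow> bool" where
  "projective_resolution R M P d e \<longleftrightarrow>
     (\<forall>i. projective_module R (P i)) \<and>
     e \<in> module_hom R (P 0) M \<and> (\<forall>i. d i \<in> module_hom R (P (Suc i)) (P i)) \<and>
     e ` carrier (P 0) = carrier M \<and>
     d 0 ` carrier (P 1) = {x \<in> carrier (P 0). e x = \<zero>\<^bsub>M\<^esub>} \<and>
     (\<forall>i. d (Suc i) ` carrier (P (Suc (Suc i))) =
          {x \<in> carrier (P (Suc i)). d i x = \<zero>\<^bsub>P i\<^esub>})"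

text \<open>The zero module has projective dimension \<open>-\<infinity>\<close>. The modules of the resolutions are taken with
  carrier type \<open>'b \<times> nat \<Rightarrow> 'a\<close>. This loses nothing: over a nonzero ring that type has at least
  \<open>max(\<aleph>\<^sub>0, |R|, |M|)\<close> elements, so it has room for a resolution of \<open>M\<close> by free modules and for
  its syzygies, and by Schanuel's lemma these already realise the infimum.\<close>

definition proj_dim :: "('a, 'r) ring_scheme \<Rightarrow> ('a, 'b) module \<Rightarrow> ereal" where
  "proj_dim R M = (if carrier M = {\<zero>\<^bsub>M\<^esub>} then -\<infinity> else
     Inf {ereal (real n) | n.
       \<exists>(P :: nat \<Rightarrow> ('a, 'b \<times> nat \<Rightarrow> 'a) module) d e.
         projective_resolution R M P d e \<and> (\<forall>i > n. carrier (P i) = {\<zero>\<^bsub>P i\<^esub>})})"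


section \<open>Generalized Hilbert--Kunz function and multiplicity\<close>

definition f_gHK :: "('a, 'r) ring_scheme \<Rightarrow> 'a set \<Rightarrow> nat \<Rightarrow> 'a set \<Rightarrow> nat \<Rightarrow> enat" where
  "f_gHK R J p I n =
     module_length R (local_cohomology0 R J (quot_module R (frobenius_power R I (p ^ n))))"

text \<open>Meant for rings of finite Krull dimension, where \<^const>\<open>the_enat\<close> is harmless.\<close>

definition e_gHK :: "('a, 'r) ring_scheme \<Rightarrow> 'a set \<Rightarrow> nat \<Rightarrow> 'a set \<Rightarrow> ereal" where
  "e_gHK R J p I =
     (let a = (\<lambda>n. ereal_of_enat (f_gHK R J p I n) /
                     ereal (real p ^ (n * the_enat (krull_dim R))))
      in if convergent a then lim a else \<infinity>)"

end

theory Submission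
  imports Defs
begin

text \<open>Over \<open>\<bbbF>\<^sub>p\<close> every polynomial is uniquely \<open>f = \<Sum>\<^sub>a X\<^sup>a f\<^sub>a\<^sup>q\<close> with \<open>0 \<le> a\<^sub>i < q\<close>, and \<open>f\<close> lies in
  \<open>I\<^bsup>[q]\<^esup>\<close> (respectively its saturation) iff every \<open>f\<^sub>a\<close> lies in \<open>I\<close> (respectively its saturation). Hence
  \<open>H\<^sup>0(R/I\<^bsup>[q]\<^esup>)\<close> has \<open>|H\<^sup>0(R/I)|\<^bsup>q\<^sup>m\<^esup>\<close> elements, and length is the logarithm to base \<open>p\<close> of the cardinality.
  This gives (i) and (ii) with \<open>e = length H\<^sup>0(R/I)\<close>.

  For (iii), \<open>e > 0\<close> means that \<open>R/I\<close> has a nonzero socle element. Instead of Koszul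
  complexes, the proof passes from a syzygy \<open>K\<close> to the next one \<open>Z\<close>: socle elements of
  \<open>K/(X\<^sub>1, \<dots>, X\<^sub>t)K\<close> correspond to socle elements of \<open>Z/(X\<^sub>1, \<dots>, X\<^bsub>t+1\<^esub>)Z\<close> that vanish in
  \<open>P/(X\<^sub>1, \<dots>, X\<^bsub>t+1\<^esub>)P\<close>, because the variables act regularly on projective modules. Along a resolution
  shorter than \<open>m\<close> the last syzygy is zero, so the socle is zero. Conversely, in a minimal graded free
  resolution the syzygy in step \<open>m\<close> (in step \<open>m - 1\<close>, if the socle is zero) satisfies \<open>Z = (X\<^sub>1, \<dots>, X\<^sub>m)Z\<close>
  and vanishes by Nakayama's lemma.\<close>

section \<open>Polynomials and monomials\<close>

text \<open>The lower bound in (iii) has to hold for every projective resolution, possibly of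
  infinite rank and ungraded, where nothing of Nakayama type applies. The transport of socle
  elements therefore relies only on the variables forming a regular sequence on every projective
  module: on free modules this is seen from monomials, and it passes to direct summands. Each step
  along the resolution costs one variable. The exchange is controlled by Tor_i(R/(X_1, ..., X_t),
  R/I) = 0 for i > t, and m is the point where the variables run out. The grading is used for the
  upper bound and for finiteness of H^0(R/I), which comes from Dickson's lemma through a bound on
  the degrees of generators. The Krull dimension, which normalises e and is compared in (iii), is
  shown to be m by counting: over a finite field a pigeonhole argument yields algebraic relations
  between any m + 1 polynomials.\<close>

abbreviation "lookup \<equiv> Poly_Mapping.lookup"
abbreviation "keys \<equiv> Poly_Mapping.keys"
abbreviation "single \<equiv> Poly_Mapping.single"

lemma mpol_ring_simps [simp]:
  "monoid.mult (mpol_ring m) = (*)" "one (mpol_ring m) = 1"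
  "ring.zero (mpol_ring m) = 0" "add (mpol_ring m) = (+)"
  by (simp_all add: mpol_ring_def)

lemma mpol_carrier_iff:
  "f \<in> carrier (mpol_ring m) \<longleftrightarrow> (\<forall>t \<in> keys f. keys t \<subseteq> {..<m})"
  by (simp add: mpol_ring_def)

lemma keys_add_nat:
  "keys (s + t) = keys s \<union> keys (t :: 'a \<Rightarrow>\<^sub>0 nat)"
  by (auto simp: in_keys_iff lookup_add)

lemma keys_eq_empty_nat: "keys t = {} \<longleftrightarrow> t = 0"
  by (auto intro!: poly_mapping_eqI simp: in_keys_iff)

lemma mpol_closed [simp, intro]:
  fixes f g :: "'a::comm_ring_1 mpol"
  shows "(0 :: 'a mpol) \<in> carrier (mpol_ring m)" "(1 :: 'a mpol) \<in> carrier (mpol_ring m)"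
    and "f \<in> carrier (mpol_ring m) \<Longrightarrow> g \<in> carrier (mpol_ring m) \<Longrightarrow> f + g \<in> carrier (mpol_ring m)"
    and "f \<in> carrier (mpol_ring m) \<Longrightarrow> g \<in> carrier (mpol_ring m) \<Longrightarrow> f * g \<in> carrier (mpol_ring m)"
    and "f \<in> carrier (mpol_ring m) \<Longrightarrow> - f \<in> carrier (mpol_ring m)"
    and "f \<in> carrier (mpol_ring m) \<Longrightarrow> g \<in> carrier (mpol_ring m) \<Longrightarrow> f - g \<in> carrier (mpol_ring m)"
proof -
  show add: "f + g \<in> carrier (mpol_ring m)"
    if "f \<in> carrier (mpol_ring m)" "g \<in> carrier (mpol_ring m)" for f g :: "'a mpol"
    using that keys_add[of f g] by (auto simp: mpol_carrier_iff)
  show "f * g \<in> carrier (mpol_ring m)"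
    if "f \<in> carrier (mpol_ring m)" "g \<in> carrier (mpol_ring m)"
    using that keys_mult[of f g] unfolding mpol_carrier_iff by (fastforce simp: keys_add_nat)
  show minus: "- f \<in> carrier (mpol_ring m)" if "f \<in> carrier (mpol_ring m)" for f :: "'a mpol"
    using that by (auto simp: mpol_carrier_iff in_keys_iff)
  show "f - g \<in> carrier (mpol_ring m)"
    if "f \<in> carrier (mpol_ring m)" "g \<in> carrier (mpol_ring m)"
    using add[OF that(1) minus[OF that(2)]] by simp
qed (simp_all add: mpol_carrier_iff)

lemma mpol_power_closed [simp, intro]:
  "f \<in> carrier (mpol_ring m) \<Longrightarrow> f ^ n \<in> carrier (mpol_ring m)"
  by (induction n) auto

lemma mpol_sum_closed [intro]:
  "(\<And>i. i \<in> A \<Longrightarrow> f i \<in> carrier (mpol_ring m)) \<Longrightarrow> sum f A \<in> carrier (mpol_ring m)"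
  by (induction A rule: infinite_finite_induct) auto

lemma mpol_prod_closed [intro]:
  "(\<And>i. i \<in> A \<Longrightarrow> f i \<in> carrier (mpol_ring m)) \<Longrightarrow> prod f A \<in> carrier (mpol_ring m)"
  by (induction A rule: infinite_finite_induct) auto

lemma mpol_single_closed [simp]:
  "single t c \<in> carrier (mpol_ring m) \<longleftrightarrow> c = 0 \<or> keys t \<subseteq> {..<m}"
  by (auto simp: mpol_carrier_iff)

lemma mpol_var_closed [simp, intro]: "i < m \<Longrightarrow> mpol_var i \<in> carrier (mpol_ring m)"
  by (simp add: mpol_var_def)

lemma cring_mpol_ring: "cring (mpol_ring m :: 'a::comm_ring_1 mpol ring)"
proof (rule cringI)
  show "abelian_group (mpol_ring m :: 'a mpol ring)"
    by (rule abelian_groupI) (auto simp: algebra_simps intro: bexI[of _ "- _"])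
  show "Group.comm_monoid (mpol_ring m :: 'a mpol ring)"
    by (rule comm_monoidI) (auto simp: algebra_simps)
qed (auto simp: algebra_simps)

lemma mpol_a_inv [simp]:
  fixes f :: "'a::comm_ring_1 mpol"
  assumes "f \<in> carrier (mpol_ring m)" shows "\<ominus>\<^bsub>mpol_ring m\<^esub> f = - f"
proof -
  interpret cring "mpol_ring m :: 'a mpol ring" by (rule cring_mpol_ring)
  show ?thesis by (rule minus_equality) (use assms in auto)
qed

lemma mpol_pow [simp]: "f [^]\<^bsub>mpol_ring m\<^esub> (n::nat) = f ^ n"
  by (induction n) (auto simp: nat_pow_def mult.commute)

lemma poly_mapping_sum_singles:
  "(\<Sum>t \<in> keys f. single t (lookup f t)) = f"
proof (rule poly_mapping_eqI)
  fix k
  have "lookup (\<Sum>t \<in> keys f. single t (lookup f t)) k =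
     (\<Sum>t \<in> keys f. if t = k then lookup f t else 0)"
    by (simp add: lookup_sum lookup_single when_def)
  also have "\<dots> = lookup f k" by (simp add: in_keys_iff)
  finally show "lookup (\<Sum>t \<in> keys f. single t (lookup f t)) k
    = lookup f k" .
qed

lemma single_mult_expand:
  fixes f :: "'a::comm_ring_1 mpol"
  shows "single s c * f =
    (\<Sum>t \<in> keys f. single (s + t) (c * lookup f t))"
  by (subst (1) poly_mapping_sum_singles[of f, symmetric]) (simp only: sum_distrib_left mult_single)

lemma lookup_single_mult_add [simp]:
  fixes f :: "'a::comm_ring_1 mpol"
  shows "lookup (single s c * f) (s + u) = c * lookup f u"
proof -
  have "lookup (single s c * f) (s + u) =
     (\<Sum>t \<in> keys f. if t = u then c * lookup f t else 0)"
    unfolding single_mult_expand by (simp add: lookup_sum lookup_single when_def)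
  also have "\<dots> = c * lookup f u" by (simp add: in_keys_iff)
  finally show ?thesis .
qed

lemma lookup_single_mult_eq_0:
  fixes f :: "'a::comm_ring_1 mpol"
  assumes "\<And>u. t \<noteq> s + u"
  shows "lookup (single s c * f) t = 0"
  unfolding single_mult_expand using assms[symmetric] by (simp add: lookup_sum lookup_single)

lemma monomial_split_var:
  fixes t :: "nat \<Rightarrow>\<^sub>0 nat"
  assumes "i \<in> keys t"
  obtains u where "t = single i 1 + u"
proof
  show "t = single i 1 + (t - single i 1)"
    using assms by (auto intro!: poly_mapping_eqI simp: lookup_add lookup_minus lookup_single when_def in_keys_iff)
qed

lemma lookup_var_mult:
  fixes f :: "'a::comm_ring_1 mpol"
  shows "lookup (mpol_var i * f) t =
    (if i \<in> keys t then lookup f (t - single i 1) else 0)"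
proof (cases "i \<in> keys t")
  case True
  then obtain u where "t = single i 1 + u" by (rule monomial_split_var)
  then show ?thesis using True by (simp add: mpol_var_def)
next
  case False
  then have "t \<noteq> single i 1 + u" for u by (auto simp: keys_add_nat)
  then show ?thesis using False by (simp add: mpol_var_def lookup_single_mult_eq_0)
qed

section \<open>Total degree and finite sets of monomials\<close>

lemma total_deg_eq: "finite A \<Longrightarrow> keys t \<subseteq> A \<Longrightarrow> total_deg t = (\<Sum>i\<in>A. lookup t i)"
  unfolding total_deg_def by (rule sum.mono_neutral_left) (auto simp: in_keys_iff)

lemma total_deg_add [simp]: "total_deg (s + t) = total_deg s + total_deg t"
proof -
  have "total_deg u = (\<Sum>i\<in>keys s \<union> keys t. lookup u i)"
    if "u \<in> {s, t, s + t}" for u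
    using that by (intro total_deg_eq) (auto simp: keys_add_nat)
  then show ?thesis by (simp add: lookup_add sum.distrib)
qed

lemma total_deg_single [simp]: "total_deg (single i n) = n"
  by (simp add: total_deg_def)

lemma total_deg_0 [simp]: "total_deg 0 = 0"
  by (simp add: total_deg_def)

lemma total_deg_eq_0 [simp]: "total_deg t = 0 \<longleftrightarrow> t = 0"
proof
  assume "total_deg t = 0"
  then show "t = 0" by (auto intro!: poly_mapping_eqI simp: total_deg_def in_keys_iff)
qed simp

lemma lookup_le_total_deg: "lookup t i \<le> total_deg t"
  by (cases "i \<in> keys t")
    (auto simp: total_deg_def in_keys_iff intro!: member_le_sum)

text \<open>A monomial in \<open>m\<close> variables is determined by the restriction of its
  exponents to \<open>{..<m}\<close>, so it is counted as a function into \<open>{..D}\<close>. The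
  explicit count, and not only finiteness, feeds the pigeonhole argument for algebraic
  dependence.\<close>

lemma finite_monomials_bounded:
  "finite {t :: nat \<Rightarrow>\<^sub>0 nat. keys t \<subseteq> {..<m} \<and> (\<forall>i. lookup t i \<le> D)}" (is "finite ?A")
  and card_monomials_bounded:
  "card {t :: nat \<Rightarrow>\<^sub>0 nat. keys t \<subseteq> {..<m} \<and> (\<forall>i. lookup t i \<le> D)} \<le> Suc D ^ m"
proof -
  let ?h = "\<lambda>t::nat \<Rightarrow>\<^sub>0 nat. restrict (lookup t) {..<m}"
  have inj: "inj_on ?h ?A"
  proof (rule inj_onI, rule poly_mapping_eqI)
    fix s t k assume st: "s \<in> ?A" "t \<in> ?A" "?h s = ?h t"
    show "lookup s k = lookup t k"
    proof (cases "k < m")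
      case True then show ?thesis using fun_cong[OF st(3), of k] by simp
    next
      case False
      then have "k \<notin> keys s" "k \<notin> keys t" using st by auto
      then show ?thesis by (simp add: in_keys_iff)
    qed
  qed
  have sub: "?h ` ?A \<subseteq> {..<m} \<rightarrow>\<^sub>E {..D}" by (auto simp: PiE_iff extensional_def split: if_splits)
  have fin: "finite ({..<m} \<rightarrow>\<^sub>E {..D})" by (intro finite_PiE) auto
  show "finite ?A" using finite_subset[OF sub fin] inj by (rule finite_imageD)
  have "card ?A = card (?h ` ?A)" using inj by (simp add: card_image)
  also have "\<dots> \<le> card ({..<m} \<rightarrow>\<^sub>E {..D})" using sub fin by (rule card_mono[rotated])
  finally show "card ?A \<le> Suc D ^ m" by (simp add: card_PiE)
qed

lemma finite_monomials_deg_le: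
  "finite {t. keys t \<subseteq> {..<m} \<and> total_deg t \<le> D}"
  by (rule finite_subset[OF _ finite_monomials_bounded[of m D]]) (auto intro: le_trans[OF lookup_le_total_deg])

lemma finite_poly_mappings_keys:
  fixes A :: "'b set"
  assumes "finite A"
  shows "finite {f :: 'b \<Rightarrow>\<^sub>0 'a::{finite,zero}. keys f \<subseteq> A}" (is "finite ?B")
    and "card {f :: 'b \<Rightarrow>\<^sub>0 'a::{finite,zero}. keys f \<subseteq> A} \<le> CARD('a) ^ card A"
proof -
  let ?h = "\<lambda>f::'b \<Rightarrow>\<^sub>0 'a. restrict (lookup f) A"
  have inj: "inj_on ?h ?B"
  proof (rule inj_onI, rule poly_mapping_eqI)
    fix s t k assume st: "s \<in> ?B" "t \<in> ?B" "?h s = ?h t"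
    show "lookup s k = lookup t k"
    proof (cases "k \<in> A")
      case True then show ?thesis using fun_cong[OF st(3), of k] by simp
    next
      case False
      then have "k \<notin> keys s" "k \<notin> keys t" using st by auto
      then show ?thesis by (simp add: in_keys_iff)
    qed
  qed
  have sub: "?h ` ?B \<subseteq> A \<rightarrow>\<^sub>E UNIV" by auto
  have fin: "finite (A \<rightarrow>\<^sub>E (UNIV :: 'a set))" using assms by (intro finite_PiE) auto
  show "finite ?B" using finite_subset[OF sub fin] inj by (rule finite_imageD)
  have "card ?B = card (?h ` ?B)" using inj by (simp add: card_image)
  also have "\<dots> \<le> card (A \<rightarrow>\<^sub>E (UNIV :: 'a set))" using sub fin by (rule card_mono[rotated])
  finally show "card ?B \<le> CARD('a) ^ card A" using assms by (simp add: card_PiE)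
qed

section \<open>Homogeneous components\<close>

lemma lookup_hom_component [simp]:
  "lookup (hom_component d f) t = (if total_deg t = d then lookup f t else 0)"
proof -
  have "lookup (hom_component d f) t =
     (\<Sum>s \<in> {s \<in> keys f. total_deg s = d}. if s = t then lookup f s else 0)"
    by (simp add: hom_component_def lookup_sum lookup_single when_def)
  also have "\<dots> = (if total_deg t = d then lookup f t else 0)"
    by (subst sum.delta) (auto simp: in_keys_iff)
  finally show ?thesis .
qed

lemma keys_hom_component: "keys (hom_component d f) = {t \<in> keys f. total_deg t = d}"
  by (auto simp: in_keys_iff split: if_splits)

lemma hom_component_closed [intro]:
  "f \<in> carrier (mpol_ring m) \<Longrightarrow> hom_component d f \<in> carrier (mpol_ring m)"
  by (auto simp: mpol_carrier_iff keys_hom_component)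

lemma hom_component_add: "hom_component d (f + g) = hom_component d f + hom_component d g"
  by (rule poly_mapping_eqI) (simp add: lookup_add)

lemma hom_component_0 [simp]: "hom_component d 0 = 0"
  by (rule poly_mapping_eqI) simp

lemma hom_component_hom_component:
  "hom_component d (hom_component e f) = (if d = e then hom_component d f else 0)"
  by (rule poly_mapping_eqI) auto

lemma total_deg_diff_var:
  "i \<in> keys t \<Longrightarrow> Suc (total_deg (t - single i 1)) = total_deg t"
  by (erule monomial_split_var) simp

lemma hom_component_var_mult:
  "hom_component d (mpol_var i * f) = (if d = 0 then 0 else mpol_var i * hom_component (d - 1) f)"
proof (rule poly_mapping_eqI)
  fix t
  show "lookup (hom_component d (mpol_var i * f)) t =
    lookup (if d = 0 then 0 else mpol_var i * hom_component (d - 1) f) t"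
    using total_deg_diff_var[of i t] by (auto simp: lookup_var_mult)
qed

lemma sum_hom_components:
  assumes "\<And>t. t \<in> keys f \<Longrightarrow> total_deg t \<le> D"
  shows "f = (\<Sum>d\<le>D. hom_component d f)"
proof (rule poly_mapping_eqI)
  fix t
  show "lookup f t = lookup (\<Sum>d\<le>D. hom_component d f) t"
    using assms[of t] by (cases "lookup f t = 0") (auto simp: lookup_sum in_keys_iff)
qed

lemma ex_total_deg_bound: "\<exists>D. \<forall>t \<in> keys f. total_deg t \<le> D"
  by (intro exI[of _ "Max (total_deg ` keys f)"]) simp

lemma monomial_induct [consumes 1, case_names zero var]:
  fixes t :: "nat \<Rightarrow>\<^sub>0 nat"
  assumes "keys t \<subseteq> {..<m}" "P 0"
    and "\<And>i t. i < m \<Longrightarrow> keys t \<subseteq> {..<m} \<Longrightarrow> P t \<Longrightarrow> P (single i 1 + t)"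
  shows "P t"
  using assms(1)
proof (induction "total_deg t" arbitrary: t)
  case 0 then show ?case using assms(2) by simp
next
  case (Suc d)
  then have "t \<noteq> 0" by auto
  then obtain i where i: "i \<in> keys t"
    by (metis ex_in_conv keys_eq_empty_nat)
  then obtain u where u: "t = single i 1 + u" by (rule monomial_split_var)
  have "P u" using Suc u by (intro Suc.hyps) (auto simp: keys_add_nat)
  then show ?case using assms(3)[of i u] Suc.prems i u by (auto simp: keys_add_nat)
qed

section \<open>Closure under sums and variables over a prime field\<close>

lemma mod_ring_of_nat: "\<exists>n. c = (of_nat n :: 'p::prime_card mod_ring)"
  using surj_of_nat_mod_ring[of c] by blast

text \<open>Over a prime field, scalar multiplication is repeated addition.\<close>

lemma mpol_ring_generated:
  fixes S :: "'p::prime_card mod_ring mpol set"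
  assumes "f \<in> carrier (mpol_ring m)" "0 \<in> S" "1 \<in> S"
    and add: "\<And>f g. f \<in> S \<Longrightarrow> g \<in> S \<Longrightarrow> f + g \<in> S"
    and var: "\<And>i f. i < m \<Longrightarrow> f \<in> S \<Longrightarrow> mpol_var i * f \<in> S"
  shows "f \<in> S"
proof -
  have single1: "single t 1 \<in> S" if "keys t \<subseteq> {..<m}" for t
    using that
  proof (induction rule: monomial_induct)
    case zero then show ?case using assms by simp
  next
    case (var i t)
    then show ?case using assms(5)[of i "single t 1"] by (simp add: mpol_var_def mult_single)
  qed
  have "single t (of_nat n) \<in> S" if "keys t \<subseteq> {..<m}" for t n
    by (induction n) (auto simp: single_add assms single1 that)
  then have single: "single t c \<in> S" if "keys t \<subseteq> {..<m}" for t c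
    using that mod_ring_of_nat[of c] by auto
  have "(\<Sum>t \<in> A. single t (lookup f t)) \<in> S"
    if "finite A" "A \<subseteq> keys f" for A
    using that assms(1) by (induction A) (auto intro!: add single assms(2) simp: mpol_carrier_iff)
  from this[of "keys f"] show ?thesis by (simp add: poly_mapping_sum_singles)
qed

lemma submodule_mpol_ringI:
  fixes M :: "('p::prime_card mod_ring mpol, 'b) module"
  assumes "module (mpol_ring m) M" "N \<subseteq> carrier M" "\<zero>\<^bsub>M\<^esub> \<in> N"
    and minus: "\<And>x. x \<in> N \<Longrightarrow> \<ominus>\<^bsub>M\<^esub> x \<in> N"
    and add: "\<And>x y. x \<in> N \<Longrightarrow> y \<in> N \<Longrightarrow> x \<oplus>\<^bsub>M\<^esub> y \<in> N"
    and var: "\<And>i x. i < m \<Longrightarrow> x \<in> N \<Longrightarrow> mpol_var i \<odot>\<^bsub>M\<^esub> x \<in> N"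
  shows "submodule N (mpol_ring m) M"
proof -
  interpret module "mpol_ring m" M by fact
  have "f \<odot>\<^bsub>M\<^esub> x \<in> N" if f: "f \<in> carrier (mpol_ring m)" and x: "x \<in> N" for f x
  proof -
    have "f \<in> {f \<in> carrier (mpol_ring m). f \<odot>\<^bsub>M\<^esub> x \<in> N}" using f
    proof (rule mpol_ring_generated)
      show "0 \<in> {f \<in> carrier (mpol_ring m). f \<odot>\<^bsub>M\<^esub> x \<in> N}"
        using smult_l_null[of x] x assms by auto
      show "1 \<in> {f \<in> carrier (mpol_ring m). f \<odot>\<^bsub>M\<^esub> x \<in> N}"
        using smult_one[of x] x assms by auto
      show "f + g \<in> {f \<in> carrier (mpol_ring m). f \<odot>\<^bsub>M\<^esub> x \<in> N}"
        if "f \<in> {f \<in> carrier (mpol_ring m). f \<odot>\<^bsub>M\<^esub> x \<in> N}"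
           "g \<in> {f \<in> carrier (mpol_ring m). f \<odot>\<^bsub>M\<^esub> x \<in> N}" for f g
        using that smult_l_distr[of f g x] x assms(2) add by auto
      show "mpol_var i * f \<in> {f \<in> carrier (mpol_ring m). f \<odot>\<^bsub>M\<^esub> x \<in> N}"
        if "i < m" "f \<in> {f \<in> carrier (mpol_ring m). f \<odot>\<^bsub>M\<^esub> x \<in> N}" for i f
        using that smult_assoc1[of "mpol_var i" f x] x assms(2) var by auto
    qed
    then show ?thesis by simp
  qed
  then show ?thesis using assms by (intro submoduleI) auto
qed

section \<open>Syzygies and regular sequences\<close>

lemma (in abelian_group) add_eq_add_imp_minus_eq_minus:
  assumes "a \<in> carrier G" "b \<in> carrier G" "c \<in> carrier G" "d \<in> carrier G" "a \<oplus> b = c \<oplus> d"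
  shows "a \<ominus> c = d \<ominus> b"
proof -
  have "a \<ominus> c = (a \<oplus> b) \<ominus> b \<ominus> c" using assms(1-4) by (simp add: minus_eq a_assoc r_neg)
  also have "\<dots> = (c \<oplus> d) \<ominus> b \<ominus> c" using assms(5) by simp
  also have "\<dots> = (c \<oplus> \<ominus> c) \<oplus> (d \<ominus> b)" using assms(1-4) by (simp only: minus_eq a_ac a_closed a_inv_closed)
  also have "\<dots> = d \<ominus> b" using assms(1-4) by (simp add: r_neg)
  finally show ?thesis .
qed

lemma (in abelian_group) add_minus_cancel:
  "a \<in> carrier G \<Longrightarrow> b \<in> carrier G \<Longrightarrow> b \<oplus> (a \<ominus> b) = a"
  by (simp add: minus_eq a_lcomm r_neg)

lemma (in abelian_group) minus_zero_right: "a \<in> carrier G \<Longrightarrow> a \<ominus> \<zero> = a"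
  using add.inv_one by (simp add: minus_eq a_inv_def)

lemma (in module) submodule_minus:
  assumes "submodule N R M" "a \<in> N" "b \<in> N"
  shows "a \<ominus>\<^bsub>M\<^esub> b \<in> N"
  using assms submoduleE[OF assms(1)] by (simp add: M.minus_eq)

lemma (in module) submodule_zero: "submodule N R M \<Longrightarrow> \<zero>\<^bsub>M\<^esub> \<in> N"
  using subgroup.one_closed[of N "add_monoid M"] by (simp add: submodule_def)

text \<open>\<open>seq_mult y M t N\<close> is \<open>y\<^sub>0 N + \<dots> + y\<^bsub>t-1\<^esub> N\<close>.\<close>

primrec seq_mult :: "(nat \<Rightarrow> 'a) \<Rightarrow> ('a, 'b, 'c) module_scheme \<Rightarrow> nat \<Rightarrow> 'b set \<Rightarrow> 'b set" where
  "seq_mult y M 0 N = {\<zero>\<^bsub>M\<^esub>}"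
| "seq_mult y M (Suc t) N = {y t \<odot>\<^bsub>M\<^esub> a \<oplus>\<^bsub>M\<^esub> b | a b. a \<in> N \<and> b \<in> seq_mult y M t N}"

text \<open>Weak regularity: the quotient by the whole sequence may be zero. Zero modules therefore
  qualify, as they must where a resolution stops.\<close>

definition regular_on :: "(nat \<Rightarrow> 'a) \<Rightarrow> nat \<Rightarrow> ('a, 'b, 'c) module_scheme \<Rightarrow> bool" where
  "regular_on y m M \<longleftrightarrow> (\<forall>t<m. \<forall>w \<in> carrier M.
     y t \<odot>\<^bsub>M\<^esub> w \<in> seq_mult y M t (carrier M) \<longrightarrow> w \<in> seq_mult y M t (carrier M))"

text \<open>\<open>socle_free y m M t N\<close> says that no nonzero element of \<open>N/(y\<^sub>0, \<dots>, y\<^bsub>t-1\<^esub>)N\<close> is annihilated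
  by \<open>y\<^sub>t, \<dots>, y\<^bsub>m-1\<^esub>\<close>.\<close>

definition socle_free :: "(nat \<Rightarrow> 'a) \<Rightarrow> nat \<Rightarrow> ('a, 'b, 'c) module_scheme \<Rightarrow> nat \<Rightarrow> 'b set \<Rightarrow> bool" where
  "socle_free y m M t N \<longleftrightarrow> (\<forall>z \<in> N. (\<forall>i. t \<le> i \<and> i < m \<longrightarrow> y i \<odot>\<^bsub>M\<^esub> z \<in> seq_mult y M t N)
     \<longrightarrow> z \<in> seq_mult y M t N)"

lemma seq_mult_mono: "N \<subseteq> N' \<Longrightarrow> seq_mult y M t N \<subseteq> seq_mult y M t N'"
proof (induction t)
  case (Suc t) then show ?case by (auto dest!: subsetD)
qed simp

context module
begin

lemma seq_mult_submodule:
  assumes N: "submodule N R M" and y: "\<And>i. i < t \<Longrightarrow> y i \<in> carrier R"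
  shows "submodule (seq_mult y M t N) R M"
  using y
proof (induction t)
  case 0 then show ?case by (intro submoduleI) auto
next
  case (Suc t)
  note NE = submoduleE[OF N]
  have IH: "submodule (seq_mult y M t N) R M" and yt: "y t \<in> carrier R" using Suc by auto
  note IE = submoduleE[OF IH]
  show ?case
  proof (rule submoduleI)
    show "seq_mult y M (Suc t) N \<subseteq> carrier M"
      using NE(1) IE(1) yt by (auto simp: subsetD)
    show "\<zero>\<^bsub>M\<^esub> \<in> seq_mult y M (Suc t) N"
      using submodule_zero[OF N] submodule_zero[OF IH] yt by (auto intro!: exI[of _ "\<zero>\<^bsub>M\<^esub>"])
  next
    fix x assume "x \<in> seq_mult y M (Suc t) N"
    then obtain a b where x: "x = y t \<odot>\<^bsub>M\<^esub> a \<oplus>\<^bsub>M\<^esub> b" "a \<in> N" "b \<in> seq_mult y M t N" by auto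
    then have carr: "a \<in> carrier M" "b \<in> carrier M" using NE(1) IE(1) by auto
    have "\<ominus>\<^bsub>M\<^esub> x = y t \<odot>\<^bsub>M\<^esub> (\<ominus>\<^bsub>M\<^esub> a) \<oplus>\<^bsub>M\<^esub> (\<ominus>\<^bsub>M\<^esub> b)"
      using carr yt by (simp add: x(1) smult_r_minus M.minus_add)
    then show "\<ominus>\<^bsub>M\<^esub> x \<in> seq_mult y M (Suc t) N" using x(2,3) NE(3)[of a] IE(3)[of b] by auto
    fix x' assume "x' \<in> seq_mult y M (Suc t) N"
    then obtain a' b' where x': "x' = y t \<odot>\<^bsub>M\<^esub> a' \<oplus>\<^bsub>M\<^esub> b'" "a' \<in> N" "b' \<in> seq_mult y M t N" by auto
    then have carr': "a' \<in> carrier M" "b' \<in> carrier M" using NE(1) IE(1) by auto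
    have "x \<oplus>\<^bsub>M\<^esub> x' = y t \<odot>\<^bsub>M\<^esub> (a \<oplus>\<^bsub>M\<^esub> a') \<oplus>\<^bsub>M\<^esub> (b \<oplus>\<^bsub>M\<^esub> b')"
      using carr carr' yt by (simp add: x(1) x'(1) smult_r_distr M.a_ac)
    then show "x \<oplus>\<^bsub>M\<^esub> x' \<in> seq_mult y M (Suc t) N" using x(2,3) x'(2,3) NE(5)[of a a'] IE(5)[of b b'] by auto
  next
    fix r x assume r: "r \<in> carrier R" and "x \<in> seq_mult y M (Suc t) N"
    then obtain a b where x: "x = y t \<odot>\<^bsub>M\<^esub> a \<oplus>\<^bsub>M\<^esub> b" "a \<in> N" "b \<in> seq_mult y M t N" by auto
    then have carr: "a \<in> carrier M" "b \<in> carrier M" using NE(1) IE(1) by auto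
    have "r \<odot>\<^bsub>M\<^esub> x = y t \<odot>\<^bsub>M\<^esub> (r \<odot>\<^bsub>M\<^esub> a) \<oplus>\<^bsub>M\<^esub> r \<odot>\<^bsub>M\<^esub> b"
      using carr yt r by (simp add: x(1) smult_r_distr smult_assoc1[symmetric] R.m_comm)
    then show "r \<odot>\<^bsub>M\<^esub> x \<in> seq_mult y M (Suc t) N" using x(2,3) r NE(4)[of r a] IE(4)[of r b] by auto
  qed
qed

end

section \<open>Linear maps with their images and kernels\<close>

locale module_map = P: module R P + Q: module R Q
  for R :: "('a, 'r) ring_scheme" and P :: "('a, 'b) module" and Q :: "('a, 'c) module" +
  fixes h
  assumes h: "h \<in> module_hom R P Q"
begin

lemma closed [simp, intro]: "x \<in> carrier P \<Longrightarrow> h x \<in> carrier Q"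
  using h by (auto simp: module_hom_def hom_def)

lemma add [simp]: "x \<in> carrier P \<Longrightarrow> x' \<in> carrier P \<Longrightarrow> h (x \<oplus>\<^bsub>P\<^esub> x') = h x \<oplus>\<^bsub>Q\<^esub> h x'"
  using h by (auto simp: module_hom_def hom_def)

lemma smult [simp]: "a \<in> carrier R \<Longrightarrow> x \<in> carrier P \<Longrightarrow> h (a \<odot>\<^bsub>P\<^esub> x) = a \<odot>\<^bsub>Q\<^esub> h x"
  using h by (auto simp: module_hom_def)

lemma zero [simp]: "h \<zero>\<^bsub>P\<^esub> = \<zero>\<^bsub>Q\<^esub>"
  using smult[OF P.R.zero_closed P.M.zero_closed] by simp

lemma uminus [simp]: "x \<in> carrier P \<Longrightarrow> h (\<ominus>\<^bsub>P\<^esub> x) = \<ominus>\<^bsub>Q\<^esub> h x"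
  by (rule Q.M.minus_equality[symmetric]) (simp_all flip: add add: P.M.l_neg)

lemma minus [simp]: "x \<in> carrier P \<Longrightarrow> x' \<in> carrier P \<Longrightarrow> h (x \<ominus>\<^bsub>P\<^esub> x') = h x \<ominus>\<^bsub>Q\<^esub> h x'"
  by (simp add: P.M.minus_eq Q.M.minus_eq)

abbreviation "K \<equiv> h ` carrier P"
abbreviation "Z \<equiv> {x \<in> carrier P. h x = \<zero>\<^bsub>Q\<^esub>}"

lemma image_submodule: "submodule K R Q"
proof (rule Q.submoduleI)
  show "\<zero>\<^bsub>Q\<^esub> \<in> K" using zero by (metis P.M.zero_closed imageI)
  show "\<ominus>\<^bsub>Q\<^esub> a \<in> K" if "a \<in> K" for a
    using that by (metis (no_types, lifting) P.M.a_inv_closed imageE imageI uminus)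
  show "a \<oplus>\<^bsub>Q\<^esub> b \<in> K" if "a \<in> K" "b \<in> K" for a b
    using that by (metis (no_types, lifting) P.M.a_closed imageE imageI add)
  show "a \<odot>\<^bsub>Q\<^esub> b \<in> K" if "a \<in> carrier R" "b \<in> K" for a b
    using that by (metis (no_types, lifting) P.smult_closed imageE imageI smult)
qed auto

lemma kernel_submodule: "submodule Z R P"
  by (rule P.submoduleI) auto

text \<open>Linearity lets the map pass through the sum. With \<open>N\<close> the whole module, it
  lifts an element of \<open>seq_mult y Q t K\<close> to
  \<open>seq_mult y P t (carrier P)\<close>.\<close>

lemma seq_mult_image:
  assumes "submodule N R P" "\<And>i. i < t \<Longrightarrow> y i \<in> carrier R"
  shows "seq_mult y Q t (h ` N) = h ` seq_mult y P t N"
  using assms(2)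
proof (induction t)
  case (Suc t)
  then have IH: "seq_mult y Q t (h ` N) = h ` seq_mult y P t N" and yt: "y t \<in> carrier R" by auto
  have "seq_mult y P t N \<subseteq> carrier P" "N \<subseteq> carrier P"
    using P.submoduleE(1) P.seq_mult_submodule assms(1) Suc.prems by (metis less_SucI)+
  then have eq: "h (y t \<odot>\<^bsub>P\<^esub> a \<oplus>\<^bsub>P\<^esub> b) = y t \<odot>\<^bsub>Q\<^esub> h a \<oplus>\<^bsub>Q\<^esub> h b" if "a \<in> N" "b \<in> seq_mult y P t N" for a b
    using that yt by (simp add: subsetD)
  show ?case
    unfolding seq_mult.simps IH by (auto simp: eq image_iff) (metis eq)+
qed simp

end

text \<open>The kernel \<open>Z\<close> of one differential and its image \<open>K\<close> are
  consecutive syzygies; the sequence \<open>y\<close> acts regularly on the modules of the resolution.\<close>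

locale syzygy_step = module_map +
  fixes y :: "nat \<Rightarrow> 'a" and m t :: nat
  assumes y: "\<And>i. i < m \<Longrightarrow> y i \<in> carrier R" and t: "t < m"
    and regP: "regular_on y m P"
    and AP: "seq_mult y P t (carrier P) \<inter> Z \<subseteq> seq_mult y P t Z"
begin

lemma yt [simp]: "y t \<in> carrier R" using y t by auto
lemma ylt: "i < t \<Longrightarrow> y i \<in> carrier R" using y t by auto

lemma sub_P: "submodule (seq_mult y P t (carrier P)) R P"
  by (rule P.seq_mult_submodule[OF P.carrier_is_submodule ylt])
lemma sub_K: "submodule (seq_mult y Q t K) R Q"
  by (rule Q.seq_mult_submodule[OF image_submodule ylt])
lemma JK: "seq_mult y Q t K = h ` seq_mult y P t (carrier P)"
  using seq_mult_image[OF P.carrier_is_submodule ylt] by simp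

text \<open>The inclusion \<open>AP\<close> says that 0 -> Z -> P -> K -> 0 stays exact on the left
  modulo y_0, ..., y_{t-1}; for projective P this is the vanishing of Tor_1 with K. For an element
  y_t w + u of Z, the image h(w) is annihilated by y_t modulo the earlier y_i. Regularity on Q and
  the inclusion for K put h(w) into (y_0, ..., y_{t-1})K, so w can be corrected to an element of Z,
  and the rest is covered by \<open>AP\<close>.\<close>

lemma tor_vanishing_step:
  assumes regQ: "regular_on y m Q"
    and AQ: "seq_mult y Q t (carrier Q) \<inter> K \<subseteq> seq_mult y Q t K"
  shows "seq_mult y P (Suc t) (carrier P) \<inter> Z \<subseteq> seq_mult y P (Suc t) Z"
proof
  fix x assume x: "x \<in> seq_mult y P (Suc t) (carrier P) \<inter> Z"
  then obtain w u where w: "w \<in> carrier P" and u: "u \<in> seq_mult y P t (carrier P)"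
    and xwu: "x = y t \<odot>\<^bsub>P\<^esub> w \<oplus>\<^bsub>P\<^esub> u" by auto
  have uP: "u \<in> carrier P" using u P.submoduleE(1)[OF sub_P] by auto
  have "y t \<odot>\<^bsub>Q\<^esub> h w \<oplus>\<^bsub>Q\<^esub> h u = \<zero>\<^bsub>Q\<^esub>" using x w uP xwu by simp
  then have "y t \<odot>\<^bsub>Q\<^esub> h w = \<ominus>\<^bsub>Q\<^esub> h u" using w uP by (simp add: Q.M.minus_equality)
  moreover have "\<ominus>\<^bsub>Q\<^esub> h u \<in> seq_mult y Q t K" using u Q.submoduleE(3)[OF sub_K] by (auto simp: JK)
  ultimately have "y t \<odot>\<^bsub>Q\<^esub> h w \<in> seq_mult y Q t (carrier Q)"
    using seq_mult_mono[of K "carrier Q" y Q t] closed by auto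
  then have "h w \<in> seq_mult y Q t (carrier Q)" using regQ t w by (auto simp: regular_on_def)
  then have "h w \<in> seq_mult y Q t K" using AQ w by auto
  then obtain v where v: "v \<in> seq_mult y P t (carrier P)" "h w = h v" by (auto simp: JK)
  have vP: "v \<in> carrier P" using v P.submoduleE(1)[OF sub_P] by auto
  have k: "w \<ominus>\<^bsub>P\<^esub> v \<in> Z" using w vP v(2) by (simp add: Q.M.r_neg Q.M.minus_eq)
  define b where "b = y t \<odot>\<^bsub>P\<^esub> v \<oplus>\<^bsub>P\<^esub> u"
  have bJ: "b \<in> seq_mult y P t (carrier P)"
    unfolding b_def using u v P.submoduleE(4,5)[OF sub_P] by simp
  have bP: "b \<in> carrier P" using bJ P.submoduleE(1)[OF sub_P] by auto
  have "y t \<odot>\<^bsub>P\<^esub> w = y t \<odot>\<^bsub>P\<^esub> v \<oplus>\<^bsub>P\<^esub> y t \<odot>\<^bsub>P\<^esub> (w \<ominus>\<^bsub>P\<^esub> v)"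
    using w vP by (simp flip: P.smult_r_distr add: P.M.add_minus_cancel)
  then have xb: "x = y t \<odot>\<^bsub>P\<^esub> (w \<ominus>\<^bsub>P\<^esub> v) \<oplus>\<^bsub>P\<^esub> b"
    using w vP uP by (simp add: xwu b_def P.M.a_ac)
  have "h x = y t \<odot>\<^bsub>Q\<^esub> h (w \<ominus>\<^bsub>P\<^esub> v) \<oplus>\<^bsub>Q\<^esub> h b"
    unfolding xb using w vP bP by simp
  then have "h b = \<zero>\<^bsub>Q\<^esub>" using x k bP by simp
  then have "b \<in> seq_mult y P t Z" using AP bJ bP by auto
  then show "x \<in> seq_mult y P (Suc t) Z" using xb k by auto
qed

text \<open>A socle element h(w) of K modulo y_0, ..., y_{t-1} is sent to the class of y_t w,
  corrected by some u in (y_0, ..., y_{t-1})P so as to lie in Z. This is a connecting map of Koszul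
  homology. Regularity of y_t on P makes it injective, so a nonzero socle class would survive in
  Z.\<close>

lemma socle_free_up:
  assumes S: "socle_free y m P (Suc t) Z"
  shows "socle_free y m Q t K"
  unfolding socle_free_def
proof (intro ballI impI)
  fix z assume "z \<in> K" and soc: "\<forall>i. t \<le> i \<and> i < m \<longrightarrow> y i \<odot>\<^bsub>Q\<^esub> z \<in> seq_mult y Q t K"
  then obtain w where w: "w \<in> carrier P" and z: "z = h w" by auto
  have ex: "\<exists>u \<in> seq_mult y P t (carrier P). y i \<odot>\<^bsub>P\<^esub> w \<ominus>\<^bsub>P\<^esub> u \<in> Z" if i: "t \<le> i" "i < m" for i
  proof -
    have "y i \<odot>\<^bsub>Q\<^esub> h w \<in> h ` seq_mult y P t (carrier P)" using soc i by (auto simp: JK z)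
    then obtain u where u: "u \<in> seq_mult y P t (carrier P)" "y i \<odot>\<^bsub>Q\<^esub> h w = h u" by auto
    have "u \<in> carrier P" using u P.submoduleE(1)[OF sub_P] by auto
    then have "y i \<odot>\<^bsub>P\<^esub> w \<ominus>\<^bsub>P\<^esub> u \<in> Z" using u(2) w y[OF i(2)] by (simp add: Q.M.minus_eq Q.M.r_neg)
    then show ?thesis using u by auto
  qed
  obtain u where u: "u \<in> seq_mult y P t (carrier P)" "y t \<odot>\<^bsub>P\<^esub> w \<ominus>\<^bsub>P\<^esub> u \<in> Z" using ex[of t] t by auto
  have uP: "u \<in> carrier P" using u P.submoduleE(1)[OF sub_P] by auto
  define z' where "z' = y t \<odot>\<^bsub>P\<^esub> w \<ominus>\<^bsub>P\<^esub> u"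
  have z'Z: "z' \<in> Z" and z'P: "z' \<in> carrier P" using u by (auto simp: z'_def)
  have z'u: "u \<oplus>\<^bsub>P\<^esub> z' = y t \<odot>\<^bsub>P\<^esub> w" using w uP by (simp add: z'_def P.M.add_minus_cancel)
  have "y i \<odot>\<^bsub>P\<^esub> z' \<in> seq_mult y P (Suc t) Z" if i: "Suc t \<le> i" "i < m" for i
  proof -
    obtain v where v: "v \<in> seq_mult y P t (carrier P)" "y i \<odot>\<^bsub>P\<^esub> w \<ominus>\<^bsub>P\<^esub> v \<in> Z" using ex[of i] i by auto
    define k where "k = y i \<odot>\<^bsub>P\<^esub> w \<ominus>\<^bsub>P\<^esub> v"
    note yi = y[OF i(2)]
    have vP: "v \<in> carrier P" using v P.submoduleE(1)[OF sub_P] by auto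
    have kP: "k \<in> carrier P" using v by (auto simp: k_def)
    have kv: "v \<oplus>\<^bsub>P\<^esub> k = y i \<odot>\<^bsub>P\<^esub> w" using w vP yi by (simp add: k_def P.M.add_minus_cancel)
    \<comment> \<open>Since y_i y_t w = y_t y_i w, the elements y_i z' and y_t k differ by an
      element of (y_0, ..., y_{t-1})P. It also lies in Z, so \<open>AP\<close> moves it into (y_0,
      ..., y_{t-1})Z.\<close>
    define b where "b = y i \<odot>\<^bsub>P\<^esub> z' \<ominus>\<^bsub>P\<^esub> y t \<odot>\<^bsub>P\<^esub> k"
    have "y i \<odot>\<^bsub>P\<^esub> (u \<oplus>\<^bsub>P\<^esub> z') = y t \<odot>\<^bsub>P\<^esub> (v \<oplus>\<^bsub>P\<^esub> k)"
      using w yi by (simp add: z'u kv flip: P.smult_assoc1) (simp add: P.R.m_comm)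
    then have "y i \<odot>\<^bsub>P\<^esub> z' \<oplus>\<^bsub>P\<^esub> y i \<odot>\<^bsub>P\<^esub> u = y t \<odot>\<^bsub>P\<^esub> k \<oplus>\<^bsub>P\<^esub> y t \<odot>\<^bsub>P\<^esub> v"
      using yi uP z'P kP vP by (simp add: P.smult_r_distr P.M.a_comm)
    then have b: "b = y t \<odot>\<^bsub>P\<^esub> v \<ominus>\<^bsub>P\<^esub> y i \<odot>\<^bsub>P\<^esub> u"
      unfolding b_def using yi uP z'P kP vP by (intro P.M.add_eq_add_imp_minus_eq_minus) auto
    have bJ: "b \<in> seq_mult y P t (carrier P)"
      unfolding b using u v yi P.submoduleE(4)[OF sub_P] by (intro P.submodule_minus[OF sub_P]) auto
    have bZ: "b \<in> Z" unfolding b_def using z'Z v(2) yi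
      by (intro P.submodule_minus[OF kernel_submodule] P.submoduleE(4)[OF kernel_submodule]) (auto simp: k_def)
    have "y i \<odot>\<^bsub>P\<^esub> z' = y t \<odot>\<^bsub>P\<^esub> k \<oplus>\<^bsub>P\<^esub> b"
      unfolding b_def using yi z'P kP by (simp add: P.M.add_minus_cancel)
    moreover have "b \<in> seq_mult y P t Z" using AP bJ bZ by auto
    ultimately show ?thesis using v(2) by (auto simp: k_def)
  qed
  then have "z' \<in> seq_mult y P (Suc t) Z" using S z'Z by (auto simp: socle_free_def)
  then obtain k b where k: "k \<in> Z" and b: "b \<in> seq_mult y P t Z" and z'kb: "z' = y t \<odot>\<^bsub>P\<^esub> k \<oplus>\<^bsub>P\<^esub> b"
    by auto
  have bJ: "b \<in> seq_mult y P t (carrier P)" using b seq_mult_mono[of Z "carrier P"] by auto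
  have bP: "b \<in> carrier P" using bJ P.submoduleE(1)[OF sub_P] by auto
  have kP: "k \<in> carrier P" using k by auto
  \<comment> \<open>Comparing the two expressions of z' puts y_t (w - k) into (y_0, ..., y_{t-1})P.
    Cancelling y_t on P and applying h, which kills k, gives the claim for z = h(w).\<close>
  have "y t \<odot>\<^bsub>P\<^esub> w \<oplus>\<^bsub>P\<^esub> \<zero>\<^bsub>P\<^esub> = y t \<odot>\<^bsub>P\<^esub> k \<oplus>\<^bsub>P\<^esub> (u \<oplus>\<^bsub>P\<^esub> b)"
    using z'kb z'u[symmetric] kP uP bP w by (simp add: P.M.a_ac)
  then have "y t \<odot>\<^bsub>P\<^esub> w \<ominus>\<^bsub>P\<^esub> y t \<odot>\<^bsub>P\<^esub> k = (u \<oplus>\<^bsub>P\<^esub> b) \<ominus>\<^bsub>P\<^esub> \<zero>\<^bsub>P\<^esub>"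
    using w kP uP bP by (intro P.M.add_eq_add_imp_minus_eq_minus) auto
  then have "y t \<odot>\<^bsub>P\<^esub> (w \<ominus>\<^bsub>P\<^esub> k) = u \<oplus>\<^bsub>P\<^esub> b"
    using w kP uP bP by (simp add: P.M.minus_eq P.smult_r_distr P.smult_r_minus)
  then have "y t \<odot>\<^bsub>P\<^esub> (w \<ominus>\<^bsub>P\<^esub> k) \<in> seq_mult y P t (carrier P)"
    using u bJ P.submoduleE(5)[OF sub_P] by simp
  then have "w \<ominus>\<^bsub>P\<^esub> k \<in> seq_mult y P t (carrier P)"
    using regP t w kP by (auto simp: regular_on_def)
  then have "h (w \<ominus>\<^bsub>P\<^esub> k) \<in> seq_mult y Q t K" unfolding JK by blast
  then show "z \<in> seq_mult y Q t K" using w k by (simp add: z Q.M.minus_zero_right)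
qed

text \<open>This inverts the map of \<open>socle_free_up\<close>: exactly the elements that vanish
  in P/(y_0, ..., y_t)P have the form y_t w + u from which a preimage h(w) can be read off. Modulo
  y_0, ..., y_{t-1}, the preimage is killed by y_t because h(z') = 0, and by the later y_i after
  cancelling y_t on P.\<close>

lemma socle_free_down:
  assumes S: "socle_free y m Q t K"
    and z': "z' \<in> Z" "z' \<in> seq_mult y P (Suc t) (carrier P)"
    and soc: "\<And>i. t < i \<Longrightarrow> i < m \<Longrightarrow> y i \<odot>\<^bsub>P\<^esub> z' \<in> seq_mult y P (Suc t) Z"
  shows "z' \<in> seq_mult y P (Suc t) Z"
proof -
  obtain w u where w: "w \<in> carrier P" and u: "u \<in> seq_mult y P t (carrier P)"
    and z'wu: "z' = y t \<odot>\<^bsub>P\<^esub> w \<oplus>\<^bsub>P\<^esub> u" using z'(2) by auto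
  have uP: "u \<in> carrier P" using u P.submoduleE(1)[OF sub_P] by auto
  have z'P: "z' \<in> carrier P" using z' by auto
  have "y t \<odot>\<^bsub>Q\<^esub> h w \<oplus>\<^bsub>Q\<^esub> h u = \<zero>\<^bsub>Q\<^esub>" using z' w uP z'wu by simp
  then have "y t \<odot>\<^bsub>Q\<^esub> h w = \<ominus>\<^bsub>Q\<^esub> h u" using w uP by (simp add: Q.M.minus_equality)
  moreover have "\<ominus>\<^bsub>Q\<^esub> h u \<in> seq_mult y Q t K" using u Q.submoduleE(3)[OF sub_K] by (auto simp: JK)
  ultimately have soct: "y t \<odot>\<^bsub>Q\<^esub> h w \<in> seq_mult y Q t K" by simp
  have soci: "y i \<odot>\<^bsub>Q\<^esub> h w \<in> seq_mult y Q t K" if i: "t < i" "i < m" for i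
  proof -
    note yi = y[OF i(2)]
    obtain k v where k: "k \<in> Z" and v: "v \<in> seq_mult y P t Z" and eq: "y i \<odot>\<^bsub>P\<^esub> z' = y t \<odot>\<^bsub>P\<^esub> k \<oplus>\<^bsub>P\<^esub> v"
      using soc[OF i] by auto
    have vJ: "v \<in> seq_mult y P t (carrier P)" using v seq_mult_mono[of Z "carrier P"] by auto
    have vP: "v \<in> carrier P" using vJ P.submoduleE(1)[OF sub_P] by auto
    have kP: "k \<in> carrier P" using k by auto
    have "y t \<odot>\<^bsub>P\<^esub> (y i \<odot>\<^bsub>P\<^esub> w) \<oplus>\<^bsub>P\<^esub> y i \<odot>\<^bsub>P\<^esub> u = y t \<odot>\<^bsub>P\<^esub> k \<oplus>\<^bsub>P\<^esub> v"
      using eq w uP yi by (simp add: z'wu P.smult_r_distr flip: P.smult_assoc1) (simp add: P.R.m_comm)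
    then have "y t \<odot>\<^bsub>P\<^esub> (y i \<odot>\<^bsub>P\<^esub> w) \<ominus>\<^bsub>P\<^esub> y t \<odot>\<^bsub>P\<^esub> k = v \<ominus>\<^bsub>P\<^esub> y i \<odot>\<^bsub>P\<^esub> u"
      using w kP uP vP yi by (intro P.M.add_eq_add_imp_minus_eq_minus) auto
    then have "y t \<odot>\<^bsub>P\<^esub> (y i \<odot>\<^bsub>P\<^esub> w \<ominus>\<^bsub>P\<^esub> k) = v \<ominus>\<^bsub>P\<^esub> y i \<odot>\<^bsub>P\<^esub> u"
      using w kP uP vP yi by (simp add: P.M.minus_eq P.smult_r_distr P.smult_r_minus)
    also have "\<dots> \<in> seq_mult y P t (carrier P)"
      using u vJ yi P.submoduleE(4)[OF sub_P] by (intro P.submodule_minus[OF sub_P]) auto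
    finally have "y i \<odot>\<^bsub>P\<^esub> w \<ominus>\<^bsub>P\<^esub> k \<in> seq_mult y P t (carrier P)"
      using regP t w kP yi by (auto simp: regular_on_def)
    then have "h (y i \<odot>\<^bsub>P\<^esub> w \<ominus>\<^bsub>P\<^esub> k) \<in> seq_mult y Q t K" unfolding JK by blast
    then show ?thesis using w k yi by (simp add: Q.M.minus_zero_right)
  qed
  have "h w \<in> seq_mult y Q t K"
    using S w soct soci by (auto simp: socle_free_def le_less)
  then obtain v where v: "v \<in> seq_mult y P t (carrier P)" "h w = h v" by (auto simp: JK)
  have vP: "v \<in> carrier P" using v P.submoduleE(1)[OF sub_P] by auto
  have k: "w \<ominus>\<^bsub>P\<^esub> v \<in> Z" using w vP v(2) by (simp add: Q.M.r_neg Q.M.minus_eq)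
  define b where "b = y t \<odot>\<^bsub>P\<^esub> v \<oplus>\<^bsub>P\<^esub> u"
  have bJ: "b \<in> seq_mult y P t (carrier P)"
    unfolding b_def using u v P.submoduleE(4,5)[OF sub_P] by simp
  have bP: "b \<in> carrier P" using bJ P.submoduleE(1)[OF sub_P] by auto
  have "y t \<odot>\<^bsub>P\<^esub> w = y t \<odot>\<^bsub>P\<^esub> v \<oplus>\<^bsub>P\<^esub> y t \<odot>\<^bsub>P\<^esub> (w \<ominus>\<^bsub>P\<^esub> v)"
    using w vP by (simp flip: P.smult_r_distr add: P.M.add_minus_cancel)
  then have xb: "z' = y t \<odot>\<^bsub>P\<^esub> (w \<ominus>\<^bsub>P\<^esub> v) \<oplus>\<^bsub>P\<^esub> b"
    using w vP uP by (simp add: z'wu b_def P.M.a_ac)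
  have "h z' = y t \<odot>\<^bsub>Q\<^esub> h (w \<ominus>\<^bsub>P\<^esub> v) \<oplus>\<^bsub>Q\<^esub> h b"
    unfolding xb using w vP bP by simp
  then have "h b = \<zero>\<^bsub>Q\<^esub>" using z' k bP by simp
  then have "b \<in> seq_mult y P t Z" using AP bJ bP by auto
  then show ?thesis using xb k by auto
qed

end

text \<open>Projective resolutions enter through \<open>regular_projective\<close>; of projectivity
  only the regularity of the sequence is kept.\<close>

locale regular_resolution =
  fixes R :: "('a, 'r) ring_scheme" and M :: "('a, 'b) module" and P :: "nat \<Rightarrow> ('a, 'c) module"
    and d :: "nat \<Rightarrow> 'c \<Rightarrow> 'c" and e :: "'c \<Rightarrow> 'b" and y :: "nat \<Rightarrow> 'a" and m :: nat
  assumes modules: "module R M" "\<And>i. module R (P i)"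
    and homs: "e \<in> module_hom R (P 0) M" "\<And>i. d i \<in> module_hom R (P (Suc i)) (P i)"
    and surj: "e ` carrier (P 0) = carrier M"
    and exact_0: "d 0 ` carrier (P 1) = {x \<in> carrier (P 0). e x = \<zero>\<^bsub>M\<^esub>}"
    and exact_Suc: "\<And>i. d (Suc i) ` carrier (P (Suc (Suc i))) = {x \<in> carrier (P (Suc i)). d i x = \<zero>\<^bsub>P i\<^esub>}"
    and y: "\<And>i. i < m \<Longrightarrow> y i \<in> carrier R"
    and regular: "\<And>i. regular_on y m (P i)"
begin

text \<open>\<open>syz s\<close> lies in \<open>P s\<close> and is the image of \<open>d s\<close>,
  so it is the (s+1)-st syzygy of M. The quotient of \<open>P s\<close> by it is the s-th syzygy,
  which is M itself for s = 0.\<close>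

definition syz :: "nat \<Rightarrow> 'c set" where
  "syz s = (case s of 0 \<Rightarrow> {x \<in> carrier (P 0). e x = \<zero>\<^bsub>M\<^esub>}
     | Suc i \<Rightarrow> {x \<in> carrier (P (Suc i)). d i x = \<zero>\<^bsub>P i\<^esub>})"

lemma syz_simps: "syz 0 = {x \<in> carrier (P 0). e x = \<zero>\<^bsub>M\<^esub>}"
  "syz (Suc i) = {x \<in> carrier (P (Suc i)). d i x = \<zero>\<^bsub>P i\<^esub>}"
  by (simp_all add: syz_def)

lemma image_d: "d s ` carrier (P (Suc s)) = syz s"
  using exact_0 exact_Suc by (cases s) (simp_all add: syz_simps)

sublocale e: module_map R "P 0" M e
  by (intro module_map.intro modules module_map_axioms.intro homs)

sublocale d: module_map R "P (Suc i)" "P i" "d i" for i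
  by (intro module_map.intro modules module_map_axioms.intro homs)

text \<open>Dimension shifting: for projective modules over the polynomial ring the inclusion
  expresses Tor_{s+1}(R/(y_0, ..., y_{t-1}), M) = 0, which holds for t \<le> s because the Koszul
  resolution of the first argument has length t.\<close>

lemma tor_vanishing:
  "t \<le> s \<Longrightarrow> t \<le> m \<Longrightarrow> seq_mult y (P s) t (carrier (P s)) \<inter> syz s \<subseteq> seq_mult y (P s) t (syz s)"
proof (induction t arbitrary: s)
  case (Suc t)
  then obtain r where s: "s = Suc r" "t \<le> r" by (cases s) auto
  interpret syzygy_step R "P (Suc r)" "P r" "d r" y m t
    using Suc.IH[of "Suc r"] Suc.prems s y regular by unfold_locales (auto simp: syz_simps)
  show ?case
    using tor_vanishing_step Suc.IH[of r] Suc.prems s regular by (simp add: syz_simps image_d)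
qed auto

lemma syzygy_step_0: "0 < m \<Longrightarrow> syzygy_step R (P 0) M e y m 0"
  using y regular e.kernel_submodule by unfold_locales auto

text \<open>On the diagonal, where the number of variables equals the index of the module,
  \<open>tor_vanishing\<close> is just available.\<close>

lemma syzygy_step_Suc: "Suc s < m \<Longrightarrow> syzygy_step R (P (Suc s)) (P s) (d s) y m (Suc s)"
  using y regular tor_vanishing[of "Suc s" "Suc s"] by unfold_locales (auto simp: syz_simps)

lemma socle_free_of_syz:
  "s < m \<Longrightarrow> socle_free y m (P s) (Suc s) (syz s) \<Longrightarrow> socle_free y m M 0 (carrier M)"
proof (induction s)
  case 0
  then show ?case
    using syzygy_step.socle_free_up[OF syzygy_step_0] by (simp add: syz_simps surj)
next
  case (Suc s)
  then show ?case
    using syzygy_step.socle_free_up[OF syzygy_step_Suc, of s] by (simp add: syz_simps image_d)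
qed

text \<open>The premise that z vanishes in \<open>P s\<close> modulo the first s+1 elements
  restricts to the image of the map inverted by \<open>socle_free_down\<close>. For a socle element
  it follows from regularity of the next element as long as s+1 < m. At s+1 = m there is no next
  element, hence the premise is carried through the induction.\<close>

lemma socle_free_syz_aux:
  assumes "socle_free y m M 0 (carrier M)"
  shows "s < m \<Longrightarrow> z \<in> syz s \<Longrightarrow> z \<in> seq_mult y (P s) (Suc s) (carrier (P s)) \<Longrightarrow>
    (\<And>i. s < i \<Longrightarrow> i < m \<Longrightarrow> y i \<odot>\<^bsub>P s\<^esub> z \<in> seq_mult y (P s) (Suc s) (syz s)) \<Longrightarrow>
    z \<in> seq_mult y (P s) (Suc s) (syz s)"
proof (induction s arbitrary: z)
  case 0
  show ?case
    using syzygy_step.socle_free_down[OF syzygy_step_0, of z] 0 assms by (simp only: syz_simps surj)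
next
  case (Suc s)
  have sub: "syz s \<subseteq> carrier (P s)" by (cases s) (auto simp: syz_simps)
  have "socle_free y m (P s) (Suc s) (syz s)"
    unfolding socle_free_def
  proof (intro ballI impI)
    fix z assume z: "z \<in> syz s"
      "\<forall>i. Suc s \<le> i \<and> i < m \<longrightarrow> y i \<odot>\<^bsub>P s\<^esub> z \<in> seq_mult y (P s) (Suc s) (syz s)"
    then have "y (Suc s) \<odot>\<^bsub>P s\<^esub> z \<in> seq_mult y (P s) (Suc s) (carrier (P s))"
      using seq_mult_mono[OF sub] Suc.prems(1) by blast
    then have "z \<in> seq_mult y (P s) (Suc s) (carrier (P s))"
      using regular[of s] z(1) sub Suc.prems(1) unfolding regular_on_def by blast
    then show "z \<in> seq_mult y (P s) (Suc s) (syz s)"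
      using Suc.IH[of z] Suc.prems(1) z by simp
  qed
  then show ?case
    using syzygy_step.socle_free_down[OF syzygy_step_Suc, of s z] Suc.prems by (simp only: syz_simps image_d)
qed

text \<open>For m = s+1 the condition on later elements of the sequence is empty, so a bare
  inclusion remains.\<close>

lemma syz_socle_free:
  assumes "socle_free y m M 0 (carrier M)" "m = Suc s"
  shows "seq_mult y (P s) m (carrier (P s)) \<inter> syz s \<subseteq> seq_mult y (P s) m (syz s)"
  using socle_free_syz_aux[OF assms(1), of s] assms(2) by auto

end

section \<open>Free modules\<close>

text \<open>Functions on the whole index type with finite support in \<open>B\<close>: all modules
  of a resolution then share one carrier type, as \<open>proj_dim\<close> requires, while their
  bases vary. The multiplicative fields are fillers demanded by the \<open>module\<close>
  record.\<close>

definition free_mod :: "nat \<Rightarrow> 'i set \<Rightarrow> ('a::comm_ring_1 mpol, 'i \<Rightarrow> 'a mpol) module" where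
  "free_mod m B = \<lparr>carrier = {f. (\<forall>x. f x \<in> carrier (mpol_ring m)) \<and> finite {x. f x \<noteq> 0} \<and> {x. f x \<noteq> 0} \<subseteq> B},
     monoid.mult = (\<lambda>_ _ _. 0), one = (\<lambda>_. 0), ring.zero = (\<lambda>_. 0), add = (\<lambda>f g x. f x + g x),
     module.smult = (\<lambda>a f x. a * f x)\<rparr>"

definition unit_vec :: "'i \<Rightarrow> 'i \<Rightarrow> 'a::comm_ring_1 mpol" where
  "unit_vec b = (\<lambda>x. if x = b then 1 else 0)"

lemma free_mod_simps [simp]:
  "\<zero>\<^bsub>free_mod m B\<^esub> = (\<lambda>_. 0)"
  "f \<oplus>\<^bsub>free_mod m B\<^esub> g = (\<lambda>x. f x + g x)"
  "a \<odot>\<^bsub>free_mod m B\<^esub> f = (\<lambda>x. a * f x)"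
  by (simp_all add: free_mod_def)

lemma free_mod_carrier_iff:
  "f \<in> carrier (free_mod m B) \<longleftrightarrow>
    (\<forall>x. f x \<in> carrier (mpol_ring m)) \<and> finite {x. f x \<noteq> 0} \<and> {x. f x \<noteq> 0} \<subseteq> B"
  by (simp add: free_mod_def)

lemma free_mod_add_closed:
  assumes "f \<in> carrier (free_mod m B)" "g \<in> carrier (free_mod m B)"
  shows "(\<lambda>x. f x + g x) \<in> carrier (free_mod m B)"
proof -
  have "{x. f x + g x \<noteq> 0} \<subseteq> {x. f x \<noteq> 0} \<union> {x. g x \<noteq> 0}" by auto
  then show ?thesis using assms by (auto simp: free_mod_carrier_iff intro: finite_subset)
qed

lemma free_mod_map_closed:
  assumes "f \<in> carrier (free_mod m B)" "\<And>x. h x 0 = 0"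
    and "\<And>x g. g \<in> carrier (mpol_ring m) \<Longrightarrow> h x g \<in> carrier (mpol_ring m)"
  shows "(\<lambda>x. h x (f x)) \<in> carrier (free_mod m B)"
proof -
  have "{x. h x (f x) \<noteq> 0} \<subseteq> {x. f x \<noteq> 0}" using assms(2) by (metis (mono_tags, lifting) Collect_mono)
  then show ?thesis using assms by (auto simp: free_mod_carrier_iff intro: finite_subset)
qed

lemma module_free_mod: "module (mpol_ring m) (free_mod m B :: ('a::comm_ring_1 mpol, 'i \<Rightarrow> 'a mpol) module)"
proof (rule moduleI[OF cring_mpol_ring])
  let ?F = "free_mod m B :: ('a mpol, 'i \<Rightarrow> 'a mpol) module"
  show "abelian_group ?F"
  proof (rule abelian_groupI)
    fix f g h assume f: "f \<in> carrier ?F"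
    show "\<exists>g\<in>carrier ?F. g \<oplus>\<^bsub>?F\<^esub> f = \<zero>\<^bsub>?F\<^esub>"
      using free_mod_map_closed[OF f, of "\<lambda>_ g. - g"] by (intro bexI[of _ "\<lambda>x. - f x"]) auto
    show "\<zero>\<^bsub>?F\<^esub> \<oplus>\<^bsub>?F\<^esub> f = f" by simp
    show "f \<oplus>\<^bsub>?F\<^esub> g = g \<oplus>\<^bsub>?F\<^esub> f" by (simp add: add.commute)
    show "f \<oplus>\<^bsub>?F\<^esub> g \<oplus>\<^bsub>?F\<^esub> h = f \<oplus>\<^bsub>?F\<^esub> (g \<oplus>\<^bsub>?F\<^esub> h)" by (simp add: add.assoc)
    assume "g \<in> carrier ?F"
    with f show "f \<oplus>\<^bsub>?F\<^esub> g \<in> carrier ?F" by (simp add: free_mod_add_closed)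
  qed (simp add: free_mod_carrier_iff)
  fix a b :: "'a mpol" and f g assume a: "a \<in> carrier (mpol_ring m)" and f: "f \<in> carrier ?F"
  show "a \<odot>\<^bsub>?F\<^esub> f \<in> carrier ?F"
    using free_mod_map_closed[OF f, of "\<lambda>_ g. a * g"] a by simp
qed (simp_all add: algebra_simps)

lemma free_mod_uminus [simp]:
  assumes "f \<in> carrier (free_mod m B)" shows "\<ominus>\<^bsub>free_mod m B\<^esub> f = (\<lambda>x. - f x)"
proof -
  interpret module "mpol_ring m" "free_mod m B" by (rule module_free_mod)
  show ?thesis
    using free_mod_map_closed[OF assms, of "\<lambda>_ g. - g"] assms by (intro M.minus_equality) auto
qed

lemma unit_vec_closed: "b \<in> B \<Longrightarrow> unit_vec b \<in> carrier (free_mod m B)"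
  by (auto simp: free_mod_carrier_iff unit_vec_def)

lemma free_mod_induct [consumes 1, case_names zero add unit]:
  fixes f :: "'i \<Rightarrow> 'a::comm_ring_1 mpol"
  assumes "f \<in> carrier (free_mod m B)" "P (\<lambda>_. 0)"
    and add: "\<And>f g. f \<in> carrier (free_mod m B) \<Longrightarrow> g \<in> carrier (free_mod m B) \<Longrightarrow>
      P f \<Longrightarrow> P g \<Longrightarrow> P (\<lambda>x. f x + g x)"
    and unit: "\<And>a b. a \<in> carrier (mpol_ring m) \<Longrightarrow> b \<in> B \<Longrightarrow> P (\<lambda>x. a * unit_vec b x)"
  shows "P f"
proof -
  have "P f" if "finite A" "f \<in> carrier (free_mod m B)" "{x. f x \<noteq> 0} \<subseteq> A" for A f
    using that
  proof (induction A arbitrary: f)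
    case empty
    then have "f = (\<lambda>_. 0)" by auto
    then show ?case using assms(2) by simp
  next
    case (insert b A)
    let ?g = "f(b := 0)" and ?u = "\<lambda>x. f b * unit_vec b x"
    have g: "?g \<in> carrier (free_mod m B)"
      using insert.prems by (auto simp: free_mod_carrier_iff elim!: rev_finite_subset)
    have eq: "f = (\<lambda>x. ?g x + ?u x)" by (auto simp: unit_vec_def)
    show ?case
    proof (cases "f b = 0")
      case True
      then show ?thesis using insert.IH[of f] insert.prems by auto
    next
      case False
      then have b: "b \<in> B" and fb: "f b \<in> carrier (mpol_ring m)"
        using insert.prems by (auto simp: free_mod_carrier_iff)
      have u: "?u \<in> carrier (free_mod m B)"
        using b fb by (auto simp: free_mod_carrier_iff unit_vec_def)
      have "{x. ?g x \<noteq> 0} \<subseteq> A" using insert.prems by auto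
      then have "P ?g" using insert.IH g by blast
      then show ?thesis using add[OF g u _ unit[OF fb b]] eq by simp
    qed
  qed
  then show ?thesis using assms(1) by (auto simp: free_mod_carrier_iff)
qed

definition free_hom :: "('a::comm_ring_1 mpol, 'b) module \<Rightarrow> ('i \<Rightarrow> 'b) \<Rightarrow> ('i \<Rightarrow> 'a mpol) \<Rightarrow> 'b" where
  "free_hom M v f = (\<Oplus>\<^bsub>M\<^esub>x \<in> {x. f x \<noteq> 0}. f x \<odot>\<^bsub>M\<^esub> v x)"

text \<open>Summing over any finite set that contains the support makes the values at f, g and f + g
  comparable term by term, although their supports differ.\<close>

lemma free_hom_eq:
  fixes M :: "('a::comm_ring_1 mpol, 'b) module"
  assumes M: "module (mpol_ring m) M" and v: "v \<in> B \<rightarrow> carrier M"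
    and f: "f \<in> carrier (free_mod m B)" and A: "finite A" "A \<subseteq> B" "{x. f x \<noteq> 0} \<subseteq> A"
  shows "free_hom M v f = (\<Oplus>\<^bsub>M\<^esub>x \<in> A. f x \<odot>\<^bsub>M\<^esub> v x)"
proof -
  interpret module "mpol_ring m" M by fact
  have "f x \<odot>\<^bsub>M\<^esub> v x = \<zero>\<^bsub>M\<^esub>" if "x \<in> A - {x. f x \<noteq> 0}" for x
    using that smult_l_null[of "v x"] v A(2) by auto
  moreover have "f x \<odot>\<^bsub>M\<^esub> v x \<in> carrier M" if "x \<in> A" for x
    using that v A(2) f by (auto simp: free_mod_carrier_iff)
  ultimately show ?thesis
    unfolding free_hom_def using A by (intro M.add.finprod_mono_neutral_cong_left) auto
qed

lemma free_hom_hom: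
  fixes M :: "('a::comm_ring_1 mpol, 'b) module"
  assumes M: "module (mpol_ring m) M" and v: "v \<in> B \<rightarrow> carrier M"
  shows "free_hom M v \<in> module_hom (mpol_ring m) (free_mod m B) M"
proof -
  interpret module "mpol_ring m" M by fact
  have cl: "f x \<odot>\<^bsub>M\<^esub> v x \<in> carrier M" if "f \<in> carrier (free_mod m B)" "x \<in> B" for f x
    using that v by (auto simp: free_mod_carrier_iff)
  show ?thesis
    unfolding module_hom_def hom_def
  proof (intro CollectI conjI ballI funcsetI)
    fix f :: "'c \<Rightarrow> 'a mpol" assume f: "f \<in> carrier (add_monoid (free_mod m B :: ('a mpol, 'c \<Rightarrow> 'a mpol) module))"
    then show "free_hom M v f \<in> carrier (add_monoid M)"
      using cl[of f] by (auto simp: free_hom_def free_mod_carrier_iff intro!: M.finsum_closed)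
    fix g assume g: "g \<in> carrier (add_monoid (free_mod m B :: ('a mpol, 'c \<Rightarrow> 'a mpol) module))"
    let ?A = "{x. f x \<noteq> 0} \<union> {x. g x \<noteq> 0}"
    have f': "f \<in> carrier (free_mod m B)" and g': "g \<in> carrier (free_mod m B)" using f g by auto
    have A: "finite ?A" "?A \<subseteq> B" using f' g' by (auto simp: free_mod_carrier_iff)
    have "free_hom M v (\<lambda>x. f x + g x) = (\<Oplus>\<^bsub>M\<^esub>x \<in> ?A. (f x + g x) \<odot>\<^bsub>M\<^esub> v x)"
      using A f' g' by (intro free_hom_eq[OF M v] free_mod_add_closed) auto
    also have "\<dots> = (\<Oplus>\<^bsub>M\<^esub>x \<in> ?A. f x \<odot>\<^bsub>M\<^esub> v x \<oplus>\<^bsub>M\<^esub> g x \<odot>\<^bsub>M\<^esub> v x)"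
    proof (intro M.finsum_cong')
      fix x assume "x \<in> ?A"
      then have "v x \<in> carrier M" using A v by auto
      then show "(f x + g x) \<odot>\<^bsub>M\<^esub> v x = f x \<odot>\<^bsub>M\<^esub> v x \<oplus>\<^bsub>M\<^esub> g x \<odot>\<^bsub>M\<^esub> v x"
        using smult_l_distr[of "f x" "g x" "v x"] f' g' by (simp add: free_mod_carrier_iff)
    qed (use cl[OF f'] cl[OF g'] A in auto)
    also have "\<dots> = (\<Oplus>\<^bsub>M\<^esub>x \<in> ?A. f x \<odot>\<^bsub>M\<^esub> v x) \<oplus>\<^bsub>M\<^esub> (\<Oplus>\<^bsub>M\<^esub>x \<in> ?A. g x \<odot>\<^bsub>M\<^esub> v x)"
      using cl[OF f'] cl[OF g'] A by (intro M.finsum_addf) auto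
    also have "\<dots> = free_hom M v f \<oplus>\<^bsub>M\<^esub> free_hom M v g"
      using A f' g' by (simp add: free_hom_eq[OF M v _ A])
    finally show "free_hom M v (f \<otimes>\<^bsub>add_monoid (free_mod m B)\<^esub> g) =
      free_hom M v f \<otimes>\<^bsub>add_monoid M\<^esub> free_hom M v g" by simp
  next
    fix a :: "'a mpol" and f :: "'c \<Rightarrow> 'a mpol" assume a: "a \<in> carrier (mpol_ring m)" and f: "f \<in> carrier (free_mod m B)"
    let ?A = "{x. f x \<noteq> 0}"
    have A: "finite ?A" "?A \<subseteq> B" using f by (auto simp: free_mod_carrier_iff)
    have af: "(\<lambda>x. a * f x) \<in> carrier (free_mod m B)"
      using a by (intro free_mod_map_closed[OF f, of "\<lambda>_ g. a * g"]) auto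
    have "free_hom M v (\<lambda>x. a * f x) = (\<Oplus>\<^bsub>M\<^esub>x \<in> ?A. (a * f x) \<odot>\<^bsub>M\<^esub> v x)"
      using A by (intro free_hom_eq[OF M v af]) auto
    also have "\<dots> = (\<Oplus>\<^bsub>M\<^esub>x \<in> ?A. a \<odot>\<^bsub>M\<^esub> (f x \<odot>\<^bsub>M\<^esub> v x))"
    proof (intro M.finsum_cong')
      fix x assume "x \<in> ?A"
      then have "v x \<in> carrier M" using A v by auto
      then show "(a * f x) \<odot>\<^bsub>M\<^esub> v x = a \<odot>\<^bsub>M\<^esub> (f x \<odot>\<^bsub>M\<^esub> v x)"
        using smult_assoc1[of a "f x" "v x"] a f by (simp add: free_mod_carrier_iff)
    qed (use cl[OF f] A a in auto)
    also have "\<dots> = a \<odot>\<^bsub>M\<^esub> free_hom M v f"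
      unfolding free_hom_def using A a cl[OF f] by (intro finsum_smult_ldistr[symmetric]) auto
    finally show "free_hom M v (a \<odot>\<^bsub>free_mod m B\<^esub> f) = a \<odot>\<^bsub>M\<^esub> free_hom M v f" by simp
  qed
qed

lemma free_hom_unit:
  fixes M :: "('a::comm_ring_1 mpol, 'b) module"
  assumes M: "module (mpol_ring m) M" and v: "v \<in> B \<rightarrow> carrier M" and b: "b \<in> B"
  shows "free_hom M v (unit_vec b) = v b"
proof -
  interpret module "mpol_ring m" M by fact
  have vb: "v b \<in> carrier M" using v b by auto
  have "free_hom M v (unit_vec b) = (\<Oplus>\<^bsub>M\<^esub>x \<in> {b}. unit_vec b x \<odot>\<^bsub>M\<^esub> v x)"
    using b by (intro free_hom_eq[OF M v unit_vec_closed[OF b]]) (auto simp: unit_vec_def)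
  also have "\<dots> = v b" using vb smult_one[OF vb] by (simp add: unit_vec_def)
  finally show ?thesis .
qed

lemma free_mod_hom_ext:
  fixes M :: "('a::comm_ring_1 mpol, 'b) module"
  assumes M: "module (mpol_ring m) M"
    and g: "g \<in> module_hom (mpol_ring m) (free_mod m B) M" and h: "h \<in> module_hom (mpol_ring m) (free_mod m B) M"
    and eq: "\<And>b. b \<in> B \<Longrightarrow> g (unit_vec b) = h (unit_vec b)" and f: "f \<in> carrier (free_mod m B)"
  shows "g f = h f"
proof -
  interpret g: module_map "mpol_ring m" "free_mod m B" M g
    using g M by (intro module_map.intro module_map_axioms.intro module_free_mod)
  interpret h: module_map "mpol_ring m" "free_mod m B" M h
    using h M by (intro module_map.intro module_map_axioms.intro module_free_mod)
  show ?thesis using f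
  proof (induction rule: free_mod_induct)
    case zero then show ?case using g.zero h.zero by simp
  next
    case (add f f') then show ?case using g.add[of f f'] h.add[of f f'] by simp
  next
    case (unit a b)
    then show ?case
      using g.smult[OF unit(1) unit_vec_closed[of b B]] h.smult[OF unit(1) unit_vec_closed[of b B]] eq[of b]
      by simp
  qed
qed

section \<open>Projectivity of free modules and regularity of the variables\<close>

lemma module_hom_comp:
  "f \<in> module_hom R L M \<Longrightarrow> g \<in> module_hom R M N \<Longrightarrow> (\<lambda>x. g (f x)) \<in> module_hom R L N"
  by (auto simp: module_hom_def hom_def Pi_iff)

lemma projective_free_mod:
  "projective_module (mpol_ring m) (free_mod m B :: ('a::comm_ring_1 mpol, 'i \<Rightarrow> 'a mpol) module)"
  unfolding projective_module_def
proof (intro conjI allI impI module_free_mod)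
  let ?R = "mpol_ring m :: 'a mpol ring"
  let ?F = "free_mod m B :: ('a mpol, 'i \<Rightarrow> 'a mpol) module"
  fix N :: "('a mpol, ('i \<Rightarrow> 'a mpol) \<Rightarrow> 'a mpol) module" and L :: "('a mpol, 'i \<Rightarrow> 'a mpol) module" and g f
  assume N: "module ?R N" and L: "module ?R L" and g: "g \<in> module_hom ?R N L" and surj: "g ` carrier N = carrier L"
    and f: "f \<in> module_hom ?R ?F L"
  have "\<forall>b\<in>B. \<exists>x\<in>carrier N. g x = f (unit_vec b)"
  proof
    fix b assume "b \<in> B"
    then have "f (unit_vec b) \<in> carrier L"
      using f unit_vec_closed[of b B m] unfolding module_hom_def hom_def by auto
    then show "\<exists>x\<in>carrier N. g x = f (unit_vec b)" using surj by (metis (no_types, lifting) imageE)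
  qed
  then obtain v where v: "v \<in> B \<rightarrow> carrier N" "\<And>b. b \<in> B \<Longrightarrow> g (v b) = f (unit_vec b)"
    by (metis Pi_I)
  have h: "free_hom N v \<in> module_hom ?R ?F N" by (rule free_hom_hom[OF N v(1)])
  show "\<exists>h\<in>module_hom ?R ?F N. \<forall>x\<in>carrier ?F. g (h x) = f x"
  proof (intro bexI[OF _ h] ballI)
    fix x assume "x \<in> carrier ?F"
    then show "g (free_hom N v x) = f x"
      using free_mod_hom_ext[OF L module_hom_comp[OF h g] f _, of x] by (simp add: free_hom_unit[OF N v(1)] v(2))
  qed
qed

text \<open>Precomposing the coefficients with the shift by the variable discards the terms without
  it and divides the others by it.\<close>

definition var_quot :: "nat \<Rightarrow> 'a::comm_ring_1 mpol \<Rightarrow> 'a mpol" where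
  "var_quot i f = Poly_Mapping.map_key ((+) (single i 1)) f"

lemma lookup_var_quot:
  "lookup (var_quot i f) t = lookup f (single i 1 + t)"
  by (simp add: var_quot_def map_key.rep_eq inj_def)

lemma var_quot_0 [simp]: "var_quot i 0 = 0"
  by (rule poly_mapping_eqI) (simp add: lookup_var_quot)

lemma var_quot_closed: "f \<in> carrier (mpol_ring m) \<Longrightarrow> var_quot i f \<in> carrier (mpol_ring m)"
  unfolding mpol_carrier_iff
proof
  fix t assume f: "\<forall>t\<in>keys f. keys t \<subseteq> {..<m}" and t: "t \<in> keys (var_quot i f)"
  then have "single i 1 + t \<in> keys f" by (simp add: in_keys_iff lookup_var_quot)
  then have "keys (single i 1 + t) \<subseteq> {..<m}" using f by blast
  then show "keys t \<subseteq> {..<m}" by (simp add: keys_add_nat)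
qed

lemma lookup_var_mult_var_quot:
  "lookup (mpol_var i * var_quot i f) t =
    (if i \<in> keys t then lookup f t else 0)"
proof (cases "i \<in> keys t")
  case True
  then obtain u where "t = single i 1 + u" by (rule monomial_split_var)
  then show ?thesis using True by (simp add: lookup_var_mult lookup_var_quot)
qed (simp add: lookup_var_mult)

text \<open>Splitting off the terms divisible by variable t handles the variables one at a time.
  Membership becomes a condition on exponents.\<close>

lemma seq_mult_free_mod:
  fixes B :: "'i set"
  assumes "t \<le> m"
  shows "seq_mult mpol_var (free_mod m B :: ('a::comm_ring_1 mpol, 'i \<Rightarrow> 'a mpol) module) t (carrier (free_mod m B)) =
    {f \<in> carrier (free_mod m B). \<forall>x. \<forall>u \<in> keys (f x). keys u \<inter> {..<t} \<noteq> {}}"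
  using assms
proof (induction t)
  case 0
  show ?case
    by (auto simp: free_mod_carrier_iff fun_eq_iff)
next
  case (Suc t)
  let ?F = "free_mod m B :: ('a mpol, 'i \<Rightarrow> 'a mpol) module"
  have IH: "seq_mult mpol_var ?F t (carrier ?F) =
    {f \<in> carrier ?F. \<forall>x. \<forall>u \<in> keys (f x). keys u \<inter> {..<t} \<noteq> {}}"
    by (intro Suc.IH) (use Suc.prems in simp)
  show ?case
  proof (intro subset_antisym subsetI)
    fix f assume "f \<in> seq_mult mpol_var ?F (Suc t) (carrier ?F)"
    then obtain a b where f: "f = (\<lambda>x. mpol_var t * a x + b x)" and a: "a \<in> carrier ?F"
      and b: "b \<in> seq_mult mpol_var ?F t (carrier ?F)" by auto
    have "f \<in> carrier ?F"
      unfolding f using a b Suc.prems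
      by (intro free_mod_add_closed free_mod_map_closed[OF a, of "\<lambda>_ g. mpol_var t * g"]) (auto simp: IH)
    moreover have "keys u \<inter> {..<Suc t} \<noteq> {}" if "u \<in> keys (f x)" for x u
    proof (cases "u \<in> keys (b x)")
      case True
      then have "keys u \<inter> {..<t} \<noteq> {}" using b IH by auto
      then show ?thesis by (auto simp: less_Suc_eq)
    next
      case False
      then have "t \<in> keys u"
        using that by (auto simp: f in_keys_iff lookup_add lookup_var_mult split: if_splits)
      then show ?thesis by auto
    qed
    ultimately show "f \<in> {f \<in> carrier ?F.
      \<forall>x. \<forall>u \<in> keys (f x). keys u \<inter> {..<Suc t} \<noteq> {}}" by auto
  next
    fix f assume "f \<in> {f \<in> carrier ?F.
      \<forall>x. \<forall>u \<in> keys (f x). keys u \<inter> {..<Suc t} \<noteq> {}}"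
    then have f: "f \<in> carrier ?F"
      and fk: "\<And>x u. u \<in> keys (f x) \<Longrightarrow> keys u \<inter> {..<Suc t} \<noteq> {}" by auto
    let ?a = "\<lambda>x. var_quot t (f x)"
    let ?b = "\<lambda>x. f x - mpol_var t * var_quot t (f x)"
    have a: "?a \<in> carrier ?F"
      by (intro free_mod_map_closed[OF f, of "\<lambda>_. var_quot t"] var_quot_closed) auto
    have b: "?b \<in> carrier ?F"
      using Suc.prems by (intro free_mod_map_closed[OF f, of "\<lambda>_ g. g - mpol_var t * var_quot t g"])
        (auto intro!: mpol_closed var_quot_closed)
    have "keys u \<inter> {..<t} \<noteq> {}" if "u \<in> keys (?b x)" for x u
    proof -
      have "t \<notin> keys u" "u \<in> keys (f x)"
        using that by (auto simp: in_keys_iff lookup_minus lookup_var_mult_var_quot split: if_splits)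
      then show ?thesis using fk[of u x] by (auto simp: less_Suc_eq)
    qed
    then have "?b \<in> seq_mult mpol_var ?F t (carrier ?F)"
      using b by (auto simp: IH)
    moreover have "f = mpol_var t \<odot>\<^bsub>?F\<^esub> ?a \<oplus>\<^bsub>?F\<^esub> ?b" by simp
    ultimately show "f \<in> seq_mult mpol_var ?F (Suc t) (carrier ?F)"
      using a unfolding seq_mult.simps mem_Collect_eq by blast
  qed
qed

text \<open>Multiplying a monomial by variable t introduces none of the variables below t, so a
  monomial of w already contains one of these if its product does.\<close>

lemma regular_free_mod: "regular_on mpol_var m (free_mod m B :: ('a::comm_ring_1 mpol, 'i \<Rightarrow> 'a mpol) module)"
  unfolding regular_on_def
proof (intro allI impI ballI)
  let ?F = "free_mod m B :: ('a mpol, 'i \<Rightarrow> 'a mpol) module"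
  fix t w assume t: "t < m" and w: "w \<in> carrier ?F"
    and *: "mpol_var t \<odot>\<^bsub>?F\<^esub> w \<in> seq_mult mpol_var ?F t (carrier ?F)"
  have "keys u \<inter> {..<t} \<noteq> {}" if "u \<in> keys (w x)" for u x
  proof -
    have "single t 1 + u \<in> keys (mpol_var t * w x)"
      using that by (simp add: in_keys_iff mpol_var_def)
    then have "keys (single t 1 + u) \<inter> {..<t} \<noteq> {}"
      using * t by (auto simp: seq_mult_free_mod)
    then show ?thesis by (auto simp: keys_add_nat)
  qed
  then show "w \<in> seq_mult mpol_var ?F t (carrier ?F)"
    using t w by (auto simp: seq_mult_free_mod)
qed

text \<open>The membership of y_t w is carried to F by i, y_t is cancelled there, and r carries the
  result back.\<close>

lemma regular_on_retract:
  fixes P :: "('a, 'b) module" and F :: "('a, 'c) module"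
  assumes P: "module R P" and F: "module R F" and y: "\<And>i. i < m \<Longrightarrow> y i \<in> carrier R"
    and i: "i \<in> module_hom R P F" and r: "r \<in> module_hom R F P"
    and ri: "\<And>w. w \<in> carrier P \<Longrightarrow> r (i w) = w" and reg: "regular_on y m F"
  shows "regular_on y m P"
  unfolding regular_on_def
proof (intro allI impI ballI)
  interpret i: module_map R P F i using assms by (intro module_map.intro module_map_axioms.intro)
  interpret r: module_map R F P r using assms by (intro module_map.intro module_map_axioms.intro)
  fix t w assume t: "t < m" and w: "w \<in> carrier P" and yw: "y t \<odot>\<^bsub>P\<^esub> w \<in> seq_mult y P t (carrier P)"
  have "i ` seq_mult y P t (carrier P) = seq_mult y F t (i ` carrier P)"
    using y t by (intro i.seq_mult_image[symmetric] i.P.carrier_is_submodule) auto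
  also have "\<dots> \<subseteq> seq_mult y F t (carrier F)" by (intro seq_mult_mono) auto
  finally have "i (y t \<odot>\<^bsub>P\<^esub> w) \<in> seq_mult y F t (carrier F)" using yw by auto
  then have "i w \<in> seq_mult y F t (carrier F)"
    using reg t w y by (auto simp: regular_on_def)
  then have "r (i w) \<in> r ` seq_mult y F t (carrier F)" by blast
  also have "r ` seq_mult y F t (carrier F) = seq_mult y P t (r ` carrier F)"
    using y t by (intro r.seq_mult_image[symmetric] i.Q.carrier_is_submodule) auto
  also have "\<dots> \<subseteq> seq_mult y P t (carrier P)" by (intro seq_mult_mono) auto
  finally show "w \<in> seq_mult y P t (carrier P)" using ri w by simp
qed

text \<open>A projective module is a retract of the free module on its own carrier. The lifting
  property is applied with that free module as N, with P as L and with the identity of P as the map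
  to lift, which fits the types in \<open>projective_module\<close>.\<close>

lemma regular_projective:
  fixes P :: "('a::comm_ring_1 mpol, 'b) module"
  assumes "projective_module (mpol_ring m) P"
  shows "regular_on mpol_var m P"
proof -
  let ?F = "free_mod m (carrier P) :: ('a mpol, 'b \<Rightarrow> 'a mpol) module"
  have P: "module (mpol_ring m) P" using assms by (simp add: projective_module_def)
  have id: "id \<in> carrier P \<rightarrow> carrier P" by auto
  have r: "free_hom P id \<in> module_hom (mpol_ring m) ?F P" by (rule free_hom_hom[OF P id])
  have surj: "free_hom P id ` carrier ?F = carrier P"
  proof
    show "free_hom P id ` carrier ?F \<subseteq> carrier P" using r by (auto simp: module_hom_def hom_def)
    show "carrier P \<subseteq> free_hom P id ` carrier ?F"
    proof
      fix b assume b: "b \<in> carrier P"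
      show "b \<in> free_hom P id ` carrier ?F"
        using free_hom_unit[OF P id b] unit_vec_closed[OF b] by (metis id_apply image_eqI)
    qed
  qed
  have "(\<lambda>x. x) \<in> module_hom (mpol_ring m) P P" by (auto simp: module_hom_def hom_def)
  with assms P r surj module_free_mod obtain i where
    "i \<in> module_hom (mpol_ring m) P ?F" "\<And>x. x \<in> carrier P \<Longrightarrow> free_hom P id (i x) = x"
    unfolding projective_module_def by meson
  then show ?thesis
    using regular_on_retract[OF P module_free_mod _ _ r _ regular_free_mod] by auto
qed

section \<open>Minimal graded free resolutions\<close>

text \<open>Degree d component when the basis vector x is given degree \<open>w x\<close>; the guard
  is there because subtraction on naturals truncates.\<close>

definition hcomp :: "('i \<Rightarrow> nat) \<Rightarrow> nat \<Rightarrow> ('i \<Rightarrow> 'a::comm_ring_1 mpol) \<Rightarrow> 'i \<Rightarrow> 'a mpol" where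
  "hcomp w d f = (\<lambda>x. if w x \<le> d then hom_component (d - w x) (f x) else 0)"

definition graded_submodule ::
  "nat \<Rightarrow> 'i set \<Rightarrow> ('i \<Rightarrow> nat) \<Rightarrow> ('i \<Rightarrow> 'a::comm_ring_1 mpol) set \<Rightarrow> bool" where
  "graded_submodule m B w K \<longleftrightarrow>
     submodule K (mpol_ring m) (free_mod m B) \<and> (\<forall>f \<in> K. \<forall>d. hcomp w d f \<in> K)"

lemma hcomp_closed: "f \<in> carrier (free_mod m B) \<Longrightarrow> hcomp w d f \<in> carrier (free_mod m B)"
  unfolding hcomp_def
  by (rule free_mod_map_closed[where h = "\<lambda>x g. if w x \<le> d then hom_component (d - w x) g else 0"]) auto

lemma hcomp_zero [simp]: "hcomp w d (\<lambda>_. 0) = (\<lambda>_. 0)"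
  by (simp add: hcomp_def fun_eq_iff)

lemma hcomp_add: "hcomp w d (\<lambda>x. f x + g x) = (\<lambda>x. hcomp w d f x + hcomp w d g x)"
  by (simp add: hcomp_def fun_eq_iff hom_component_add)

lemma hcomp_var:
  "hcomp w d (\<lambda>x. mpol_var i * f x) = (\<lambda>x. if d = 0 then 0 else mpol_var i * hcomp w (d - 1) f x)"
proof
  fix x
  show "hcomp w d (\<lambda>x. mpol_var i * f x) x = (if d = 0 then 0 else mpol_var i * hcomp w (d - 1) f x)"
    by (cases "w x = d") (auto simp: hcomp_def hom_component_var_mult)
qed

lemma hcomp_hcomp: "hcomp w d (hcomp w e f) = (\<lambda>x. if d = e then hcomp w d f x else 0)"
  by (auto simp: hcomp_def fun_eq_iff hom_component_hom_component)

lemma hcomp_decomp: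
  assumes "f \<in> carrier (free_mod m B)"
  shows "\<exists>D. f = (\<lambda>x. \<Sum>d\<le>D. hcomp w d f x)"
proof -
  obtain b where b: "\<And>g t. t \<in> keys g \<Longrightarrow> total_deg t \<le> b (g :: 'b mpol)"
    using ex_total_deg_bound by metis
  \<comment> \<open>The weight of a coordinate adds to the degree of its entry, so both go into the
    bound.\<close>
  define D where "D = Max ((\<lambda>x. w x + b (f x)) ` {x. f x \<noteq> 0})"
  have fin: "finite {x. f x \<noteq> 0}" using assms by (simp add: free_mod_carrier_iff)
  have "f x = (\<Sum>d\<le>D. hcomp w d f x)" for x
  proof (cases "f x = 0")
    case False
    then have D: "w x + b (f x) \<le> D" unfolding D_def using fin by (intro Max_ge) auto
    have "(\<Sum>d\<le>D. hcomp w d f x) = (\<Sum>d\<in>{w x..D}. hom_component (d - w x) (f x))"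
      by (intro sum.mono_neutral_cong_right) (auto simp: hcomp_def)
    also have "\<dots> = (\<Sum>d\<le>D - w x. hom_component d (f x))"
      using D by (intro sum.reindex_bij_witness[of _ "\<lambda>d. d + w x" "\<lambda>d. d - w x"]) auto
    also have "\<dots> = f x"
    proof (rule sum_hom_components[symmetric])
      fix t assume "t \<in> keys (f x)"
      then show "total_deg t \<le> D - w x" using b[of t "f x"] D by linarith
    qed
    finally show ?thesis by simp
  qed (simp add: hcomp_def cong: if_cong)
  then have "f = (\<lambda>x. \<Sum>d\<le>D. hcomp w d f x)" by (rule ext)
  then show ?thesis by (rule exI)
qed

lemma free_submodule_closed:
  assumes "submodule N (mpol_ring m) (free_mod m B)"
  shows "(\<lambda>_. 0) \<in> N" "f \<in> N \<Longrightarrow> g \<in> N \<Longrightarrow> (\<lambda>x. f x + g x) \<in> N"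
    "a \<in> carrier (mpol_ring m) \<Longrightarrow> f \<in> N \<Longrightarrow> (\<lambda>x. a * f x) \<in> N"
    "f \<in> N \<Longrightarrow> g \<in> N \<Longrightarrow> (\<lambda>x. f x - g x) \<in> N" "N \<subseteq> carrier (free_mod m B)"
proof -
  interpret module "mpol_ring m" "free_mod m B" by (rule module_free_mod)
  note E = submoduleE[OF assms]
  show "(\<lambda>_. 0) \<in> N" using submodule_zero[OF assms] by simp
  show add: "f \<in> N \<Longrightarrow> g \<in> N \<Longrightarrow> (\<lambda>x. f x + g x) \<in> N" for f g using E(5)[of f g] by simp
  show "a \<in> carrier (mpol_ring m) \<Longrightarrow> f \<in> N \<Longrightarrow> (\<lambda>x. a * f x) \<in> N" using E(4)[of a f] by simp
  show "N \<subseteq> carrier (free_mod m B)" by fact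
  assume f: "f \<in> N" and g: "g \<in> N"
  have "(\<lambda>x. - g x) \<in> N" using E(3)[of g] g E(1) free_mod_uminus[of g m B] by auto
  then show "(\<lambda>x. f x - g x) \<in> N" using add[OF f, of "\<lambda>x. - g x"] by simp
qed

lemma free_submodule_sum:
  assumes N: "submodule N (mpol_ring m) (free_mod m B)" and "\<And>a. a \<in> A \<Longrightarrow> g a \<in> N"
  shows "(\<lambda>x. \<Sum>a\<in>A. g a x) \<in> N"
  using assms(2)
proof (induction A rule: infinite_finite_induct)
  case (insert a A)
  then have "(\<lambda>x. g a x + (\<Sum>a\<in>A. g a x)) \<in> N" by (intro free_submodule_closed(2)[OF N]) auto
  then show ?case using insert(1,2) by simp
qed (simp_all add: free_submodule_closed(1)[OF N])

lemma graded_submodule_eqI: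
  assumes N: "submodule N (mpol_ring m) (free_mod m B)" and f: "f \<in> carrier (free_mod m B)"
    and "\<And>d. hcomp w d f \<in> N"
  shows "f \<in> N"
proof -
  obtain D where "f = (\<lambda>x. \<Sum>d\<le>D. hcomp w d f x)" using hcomp_decomp[OF f] by blast
  then show ?thesis using free_submodule_sum[OF N, of "{..D}" "\<lambda>d. hcomp w d f"] assms(3) by simp
qed

text \<open>Each variable raises degrees by one, so the degree d part of an element of (X_1, ...,
  X_m)K is made of degree d - 1 parts of elements of K and vanishes for d = 0. This drives the
  degree inductions for Nakayama's lemma and for the surjectivity of minimal covers.\<close>

lemma hcomp_seq_mult:
  fixes N K :: "('i \<Rightarrow> 'a::comm_ring_1 mpol) set"
  assumes N: "submodule N (mpol_ring m) (free_mod m B)"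
    and K: "\<And>k. k \<in> K \<Longrightarrow> d > 0 \<Longrightarrow> hcomp w (d - 1) k \<in> N"
    and "t \<le> m" "r \<in> seq_mult mpol_var (free_mod m B') t K"
  shows "hcomp w d r \<in> N"
  using assms(3,4)
proof (induction t arbitrary: r)
  case 0 then show ?case using free_submodule_closed(1)[OF N] by simp
next
  case (Suc t)
  then obtain a b where r: "r = (\<lambda>x. mpol_var t * a x + b x)" and a: "a \<in> K"
    and b: "b \<in> seq_mult mpol_var (free_mod m B') t K" by auto
  have "hcomp w d b \<in> N" using Suc b by simp
  moreover have "(\<lambda>x. if d = 0 then 0 else mpol_var t * hcomp w (d - 1) a x) \<in> N"
    using K[OF a] Suc.prems(1) free_submodule_closed(1,3)[OF N] by (cases "d = 0") simp_all
  ultimately show ?case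
    unfolding r hcomp_add hcomp_var by (rule free_submodule_closed(2)[OF N, rotated])
qed

text \<open>Degrees are natural numbers, so a nonzero component of lowest degree would have to come
  from components of still lower degree. Induction on the degree takes the place of finite
  generation.\<close>

lemma graded_nakayama:
  fixes K :: "('i \<Rightarrow> 'a::comm_ring_1 mpol) set"
  assumes K: "graded_submodule m B w K" and "K \<subseteq> seq_mult mpol_var (free_mod m B) m K" and k: "k \<in> K"
  shows "k = (\<lambda>_. 0)"
proof -
  interpret module "mpol_ring m" "free_mod m B :: ('a mpol, 'i \<Rightarrow> 'a mpol) module" by (rule module_free_mod)
  have Z: "submodule {\<lambda>_. 0} (mpol_ring m) (free_mod m B :: ('a mpol, 'i \<Rightarrow> 'a mpol) module)"
    using M.minus_zero_right[of "\<lambda>_. 0"] free_mod_uminus[of "\<lambda>_. 0" m B]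
    by (intro submoduleI) (auto simp: free_mod_carrier_iff)
  have "hcomp w d k \<in> {\<lambda>_. 0}" if "k \<in> K" for k d
    using that
  proof (induction d arbitrary: k)
    case (Suc d)
    then show ?case using hcomp_seq_mult[OF Z, of K "Suc d" w m k] assms(2) by auto
  next
    case 0
    then show ?case using hcomp_seq_mult[OF Z, of K 0 w m k] assms(2) by auto
  qed
  then have hk: "hcomp w d k \<in> {\<lambda>_. 0}" for d using k by blast
  have kc: "k \<in> carrier (free_mod m B)"
    using k K free_submodule_closed(5)[of K m B] by (auto simp: graded_submodule_def)
  have "k \<in> {\<lambda>_. 0}" by (rule graded_submodule_eqI[OF Z kc hk])
  then show ?thesis by simp
qed

text \<open>Finitely many basis vectors of weight at most d and finitely many coefficients leave
  finitely many vectors of degree d. Generators can then be selected from a finite set.\<close>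

lemma finite_degree_piece:
  fixes w :: "'i \<Rightarrow> nat"
  assumes "finite {x \<in> B. w x \<le> d}"
  shows "finite {f \<in> carrier (free_mod m B :: ('a::{finite,comm_ring_1} mpol, 'i \<Rightarrow> 'a mpol) module). hcomp w d f = f}"
proof -
  let ?A = "{x \<in> B. w x \<le> d}"
  let ?H = "{g :: 'a mpol. keys g \<subseteq> {t. keys t \<subseteq> {..<m} \<and> total_deg t \<le> d}}"
  have "f x \<in> ?H" if f: "f \<in> carrier (free_mod m B)" "hcomp w d f = f" for f :: "'i \<Rightarrow> 'a mpol" and x
  proof -
    have "hcomp w d f x = f x" using f by simp
    then have "keys (f x) = keys (hcomp w d f x)" by simp
    also have "\<dots> \<subseteq> {t. total_deg t \<le> d}"
      unfolding hcomp_def by (auto simp: keys_hom_component simp del: lookup_hom_component)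
    finally show ?thesis using f(1) unfolding free_mod_carrier_iff mpol_carrier_iff by blast
  qed
  moreover have "f x = 0" if f: "f \<in> carrier (free_mod m B)" "hcomp w d f = f" "x \<notin> ?A" for f :: "'i \<Rightarrow> 'a mpol" and x
  proof (cases "x \<in> B")
    case True
    have "hcomp w d f x = f x" using f by simp
    then show ?thesis using True f(3) by (auto simp: hcomp_def)
  qed (use f in \<open>auto simp: free_mod_carrier_iff\<close>)
  ultimately have "{f \<in> carrier (free_mod m B :: ('a mpol, 'i \<Rightarrow> 'a mpol) module). hcomp w d f = f} \<subseteq>
      {f. \<forall>x. (x \<in> ?A \<longrightarrow> f x \<in> ?H) \<and> (x \<notin> ?A \<longrightarrow> f x = 0)}"
    by auto
  moreover have "finite {f. \<forall>x. (x \<in> ?A \<longrightarrow> f x \<in> ?H) \<and> (x \<notin> ?A \<longrightarrow> f x = 0)}"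
    by (intro finite_set_of_finite_funs assms finite_poly_mappings_keys(1) finite_monomials_deg_le)
  ultimately show ?thesis by (rule finite_subset)
qed

section \<open>Minimal generators and minimal covers\<close>

abbreviation const :: "'a \<Rightarrow> 'a::comm_ring_1 mpol" where
  "const c \<equiv> single 0 c"

text \<open>A subset of least cardinality that spans V modulo J with constant coefficients is
  independent: a relation with nonzero coefficient at g would express g by the others. This is the
  choice of a vector space basis modulo J.\<close>

lemma exists_minimal_generators:
  fixes V J :: "('i \<Rightarrow> 'a::field mpol) set"
  assumes J: "submodule J (mpol_ring m) (free_mod m B)" and V: "finite V"
  obtains G where "G \<subseteq> V" "finite G" "\<And>f. f \<in> V \<Longrightarrow> \<exists>c. (\<lambda>x. f x - (\<Sum>b\<in>G. const (c b) * b x)) \<in> J"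
    and "\<And>c b. (\<lambda>x. \<Sum>b\<in>G. const (c b) * b x) \<in> J \<Longrightarrow> b \<in> G \<Longrightarrow> c b = 0"
proof -
  note J_closed = free_submodule_closed[OF J]
  define gen where "gen G \<longleftrightarrow> G \<subseteq> V \<and> (\<forall>f \<in> V. \<exists>c. (\<lambda>x. f x - (\<Sum>b\<in>G. const (c b) * b x)) \<in> J)" for G
  have "gen V"
    unfolding gen_def
  proof (intro conjI ballI subset_refl)
    fix f assume "f \<in> V"
    then have "(\<Sum>b\<in>V. const (if b = f then 1 else 0) * b x) = f x" for x
      using V by (simp add: if_distrib[of const] if_distrib[of "\<lambda>c. c * _"] cong: if_cong)
    then show "\<exists>c. (\<lambda>x. f x - (\<Sum>b\<in>V. const (c b) * b x)) \<in> J"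
      using J_closed(1) by (intro exI[of _ "\<lambda>b. if b = f then 1 else 0"]) simp
  qed
  then obtain G where G: "gen G" "\<And>G'. gen G' \<Longrightarrow> card G \<le> card G'"
    using ex_has_least_nat[of gen V card] by metis
  have fin: "finite G" using G(1) V by (auto simp: gen_def intro: finite_subset)
  show ?thesis
  proof (rule that)
    show "G \<subseteq> V" "finite G" using G(1) fin by (auto simp: gen_def)
    show "\<exists>c. (\<lambda>x. f x - (\<Sum>b\<in>G. const (c b) * b x)) \<in> J" if "f \<in> V" for f
      using G(1) that by (auto simp: gen_def)
    fix c g assume rel: "(\<lambda>x. \<Sum>b\<in>G. const (c b) * b x) \<in> J" and g: "g \<in> G"
    show "c g = 0"
    proof (rule ccontr)
      assume c: "c g \<noteq> 0"
      have "gen (G - {g})"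
        unfolding gen_def
      proof (intro conjI ballI)
        show "G - {g} \<subseteq> V" using G(1) by (auto simp: gen_def)
        fix f assume "f \<in> V"
        then obtain a where a: "(\<lambda>x. f x - (\<Sum>b\<in>G. const (a b) * b x)) \<in> J" using G(1) by (auto simp: gen_def)
        \<comment> \<open>Subtracting this multiple of the relation from the combination for f makes
          the coefficient of g vanish.\<close>
        let ?s = "a g / c g"
        have "(\<lambda>x. const ?s * (\<Sum>b\<in>G. const (c b) * b x)) \<in> J"
          using rel by (intro J_closed(3)) auto
        then have "(\<lambda>x. (f x - (\<Sum>b\<in>G. const (a b) * b x)) + const ?s * (\<Sum>b\<in>G. const (c b) * b x)) \<in> J"
          by (rule J_closed(2)[OF a])
        moreover have "(f x - (\<Sum>b\<in>G. const (a b) * b x)) + const ?s * (\<Sum>b\<in>G. const (c b) * b x) =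
          f x - (\<Sum>b\<in>G - {g}. const (a b - ?s * c b) * b x)" for x
        proof -
          have "(\<Sum>b\<in>G. const (a b) * b x) - const ?s * (\<Sum>b\<in>G. const (c b) * b x) =
            (\<Sum>b\<in>G. const (a b - ?s * c b) * b x)"
            unfolding sum_distrib_left sum_subtractf[symmetric]
            by (simp add: single_diff left_diff_distrib mult.assoc[symmetric] mult_single)
          also have "\<dots> = (\<Sum>b\<in>G - {g}. const (a b - ?s * c b) * b x)"
            using fin g c by (simp add: sum.remove)
          finally show ?thesis by (simp add: algebra_simps)
        qed
        ultimately show "\<exists>c. (\<lambda>x. f x - (\<Sum>b\<in>G - {g}. const (c b) * b x)) \<in> J"
          by (intro exI[of _ "\<lambda>b. a b - ?s * c b"]) simp
      qed
      then have "card G \<le> card (G - {g})" by (rule G(2))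
      then show False using fin g by (metis card_Diff1_less not_le)
    qed
  qed
qed

lemma hom_component_1: "hom_component d 1 = (if d = 0 then 1 else 0)"
  by (rule poly_mapping_eqI) (auto simp: lookup_one when_def)

text \<open>Multiplication by a homogeneous vector of degree e shifts degrees by e. The scalars for
  which this holds contain 1 and are closed under sums and multiplication by variables, and over a
  prime field that is everything.\<close>

lemma hcomp_smult_homogeneous:
  fixes v :: "'i \<Rightarrow> 'p::prime_card mod_ring mpol"
  assumes v: "hcomp w e v = v" and a: "a \<in> carrier (mpol_ring m)"
  shows "hcomp w d (\<lambda>x. a * v x) = (\<lambda>x. (if e \<le> d then hom_component (d - e) a else 0) * v x)"
proof -
  have "a \<in> {a. \<forall>d. hcomp w d (\<lambda>x. a * v x) = (\<lambda>x. (if e \<le> d then hom_component (d - e) a else 0) * v x)}"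
    (is "a \<in> ?S") using a
  proof (rule mpol_ring_generated)
    show "0 \<in> ?S" by (auto cong: if_cong)
    have "hcomp w d v = (\<lambda>x. if d = e then v x else 0)" for d
      using hcomp_hcomp[of w d e v] v by (cases "d = e") simp_all
    then show "1 \<in> ?S" by (auto simp: hom_component_1 fun_eq_iff)
    fix f g assume f: "f \<in> ?S" and g: "g \<in> ?S"
    show "f + g \<in> ?S"
    proof (intro CollectI allI)
      fix d
      have "hcomp w d (\<lambda>x. (f + g) * v x) = (\<lambda>x. hcomp w d (\<lambda>x. f * v x) x + hcomp w d (\<lambda>x. g * v x) x)"
        by (simp add: distrib_right hcomp_add)
      then show "hcomp w d (\<lambda>x. (f + g) * v x) = (\<lambda>x. (if e \<le> d then hom_component (d - e) (f + g) else 0) * v x)"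
        using f g by (simp add: hom_component_add distrib_right)
    qed
    fix i
    show "mpol_var i * f \<in> ?S"
    proof (intro CollectI allI)
      fix d
      have "hcomp w d (\<lambda>x. mpol_var i * f * v x) =
        (\<lambda>x. if d = 0 then 0 else mpol_var i * hcomp w (d - 1) (\<lambda>x. f * v x) x)"
        using hcomp_var[of w d i "\<lambda>x. f * v x"] by (simp add: mult.assoc)
      also have "\<dots> = (\<lambda>x. (if e \<le> d then hom_component (d - e) (mpol_var i * f) else 0) * v x)"
        using f by (auto simp: hom_component_var_mult fun_eq_iff mult.assoc le_Suc_eq)
      finally show "hcomp w d (\<lambda>x. mpol_var i * f * v x) =
        (\<lambda>x. (if e \<le> d then hom_component (d - e) (mpol_var i * f) else 0) * v x)" .
    qed
  qed
  then show ?thesis by blast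
qed

lemma hcomp_unit_vec: "hcomp w (w b) (unit_vec b) = unit_vec b"
  by (auto simp: hcomp_def unit_vec_def fun_eq_iff hom_component_1)

lemma free_mod_finsum:
  assumes "finite A" "\<And>a. a \<in> A \<Longrightarrow> g a \<in> carrier (free_mod m B)"
  shows "(\<Oplus>\<^bsub>free_mod m B\<^esub>a \<in> A. g a) = (\<lambda>x. \<Sum>a\<in>A. g a x)"
  using assms
proof (induction A)
  interpret module "mpol_ring m" "free_mod m B" by (rule module_free_mod)
  case empty
  show ?case by simp
next
  interpret module "mpol_ring m" "free_mod m B" by (rule module_free_mod)
  case (insert a A)
  then have "g \<in> A \<rightarrow> carrier (free_mod m B)" "g a \<in> carrier (free_mod m B)" by auto
  then show ?case using insert by simp
qed

lemma free_hom_pointwise: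
  fixes v :: "'j \<Rightarrow> 'i \<Rightarrow> 'a::comm_ring_1 mpol"
  assumes v: "v \<in> B' \<rightarrow> carrier (free_mod m B)" and f: "f \<in> carrier (free_mod m B')"
    and A: "finite A" "A \<subseteq> B'" "{x. f x \<noteq> 0} \<subseteq> A"
  shows "free_hom (free_mod m B) v f = (\<lambda>x. \<Sum>a\<in>A. f a * v a x)"
proof -
  have "(\<lambda>x. f a * v a x) \<in> carrier (free_mod m B)" if "a \<in> A" for a
    using that A(2) v f free_mod_map_closed[of "v a" m B "\<lambda>_ g. f a * g"]
    by (auto simp: free_mod_carrier_iff[of f])
  then show ?thesis
    using free_hom_eq[OF module_free_mod v f A] A(1) free_mod_finsum[of A "\<lambda>a x. f a * v a x" m B] by simp
qed

text \<open>The weights of the new basis are the degrees of the images, which makes the map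
  homogeneous of degree 0. This is what keeps kernels graded from one step of a resolution to the
  next.\<close>

lemma free_hom_hcomp:
  fixes v :: "'j \<Rightarrow> 'i \<Rightarrow> 'p::prime_card mod_ring mpol"
  assumes v: "v \<in> B' \<rightarrow> carrier (free_mod m B)" and deg: "\<And>b. b \<in> B' \<Longrightarrow> hcomp w (w' b) (v b) = v b"
    and f: "f \<in> carrier (free_mod m B')"
  shows "free_hom (free_mod m B) v (hcomp w' d f) = hcomp w d (free_hom (free_mod m B) v f)"
proof -
  interpret h: module_map "mpol_ring m" "free_mod m B' :: ('p mod_ring mpol, 'j \<Rightarrow> 'p mod_ring mpol) module"
    "free_mod m B" "free_hom (free_mod m B) v"
    using free_hom_hom[OF module_free_mod v] by (intro module_map.intro module_map_axioms.intro module_free_mod)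
  show ?thesis using f
  proof (induction rule: free_mod_induct)
    case zero
    show ?case using h.zero by simp
  next
    case (add f g)
    have "free_hom (free_mod m B) v (hcomp w' d (\<lambda>x. f x + g x)) =
      free_hom (free_mod m B) v (hcomp w' d f) \<oplus>\<^bsub>free_mod m B\<^esub> free_hom (free_mod m B) v (hcomp w' d g)"
      using h.add[of "hcomp w' d f" "hcomp w' d g"] add(1,2) by (simp add: hcomp_add hcomp_closed)
    also have "\<dots> = hcomp w d (free_hom (free_mod m B) v (\<lambda>x. f x + g x))"
      using h.add[of f g] add by (simp add: hcomp_add)
    finally show ?case .
  next
    case (unit a b)
    have u: "unit_vec b \<in> carrier (free_mod m B')" by (rule unit_vec_closed) fact
    have eq: "free_hom (free_mod m B) v (\<lambda>x. c * unit_vec b x) = (\<lambda>x. c * v b x)"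
      if "c \<in> carrier (mpol_ring m)" for c
      using h.smult[OF that u] free_hom_unit[OF module_free_mod v unit(2)] by simp
    let ?c = "if w' b \<le> d then hom_component (d - w' b) a else 0"
    have c: "?c \<in> carrier (mpol_ring m)" using unit by auto
    have "free_hom (free_mod m B) v (hcomp w' d (\<lambda>x. a * unit_vec b x)) = (\<lambda>x. ?c * v b x)"
      unfolding hcomp_smult_homogeneous[OF hcomp_unit_vec unit(1)] by (rule eq[OF c])
    also have "\<dots> = hcomp w d (free_hom (free_mod m B) v (\<lambda>x. a * unit_vec b x))"
      unfolding eq[OF unit(1)] by (rule hcomp_smult_homogeneous[OF deg[OF unit(2)] unit(1), symmetric])
    finally show ?case .
  qed
qed

text \<open>Generators of each degree \<open>d\<close> are chosen to form a basis of \<open>K\<^sub>d\<close> modulo \<open>(X\<^sub>1, \<dots>, X\<^sub>m) K\<close>; the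
  \<open>j\<close>-th of them is attached to the basis vector with index \<open>\<iota> (prod_encode (d, j))\<close>.\<close>

lemma minimal_cover:
  fixes B :: "'i set" and w :: "'i \<Rightarrow> nat" and K :: "('i \<Rightarrow> 'p::prime_card mod_ring mpol) set"
    and \<iota> :: "nat \<Rightarrow> 'i"
  assumes \<iota>: "inj \<iota>" and K: "graded_submodule m B w K" and fin: "\<And>d. finite {x \<in> B. w x \<le> d}"
  shows "\<exists>(B' :: 'i set) w' \<phi>. \<phi> \<in> module_hom (mpol_ring m) (free_mod m B') (free_mod m B) \<and>
    \<phi> ` carrier (free_mod m B') = K \<and>
    {f \<in> carrier (free_mod m B'). \<phi> f = (\<lambda>_. 0)} \<subseteq> seq_mult mpol_var (free_mod m B') m (carrier (free_mod m B')) \<and>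
    graded_submodule m B' w' {f \<in> carrier (free_mod m B'). \<phi> f = (\<lambda>_. 0)} \<and>
    (\<forall>d. finite {x \<in> B'. w' x \<le> d})"
proof -
  let ?F = "\<lambda>B. free_mod m B :: ('p mod_ring mpol, 'i \<Rightarrow> 'p mod_ring mpol) module"
  interpret F: module "mpol_ring m" "?F B" by (rule module_free_mod)
  define J where "J = seq_mult mpol_var (?F B) m K"
  define V where "V d = {f \<in> K. hcomp w d f = f}" for d
  have K_sub: "submodule K (mpol_ring m) (?F B)" using K by (simp add: graded_submodule_def)
  have K_hcomp: "hcomp w d k \<in> K" if "k \<in> K" for k d using K that by (simp add: graded_submodule_def)
  have J_sub: "submodule J (mpol_ring m) (?F B)"
    unfolding J_def by (rule F.seq_mult_submodule[OF K_sub]) auto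
  have V_fin: "finite (V d)" for d
    using free_submodule_closed(5)[OF K_sub]
    by (intro finite_subset[OF _ finite_degree_piece[OF fin, of m d]]) (auto simp: V_def)
  define good where "good d G \<longleftrightarrow> G \<subseteq> V d \<and> finite G \<and>
    (\<forall>f\<in>V d. \<exists>c. (\<lambda>x. f x - (\<Sum>b\<in>G. const (c b) * b x)) \<in> J) \<and>
    (\<forall>c b. (\<lambda>x. \<Sum>b\<in>G. const (c b) * b x) \<in> J \<longrightarrow> b \<in> G \<longrightarrow> c b = 0)" for d G
  have "\<exists>G. good d G" for d
    unfolding good_def by (rule exists_minimal_generators[OF J_sub V_fin[of d]]) blast
  then obtain G where G: "\<And>d. good d (G d)" by metis
  have GV: "G d \<subseteq> V d" and G_fin: "finite (G d)"
    and G_gen: "f \<in> V d \<Longrightarrow> \<exists>c. (\<lambda>x. f x - (\<Sum>b\<in>G d. const (c b) * b x)) \<in> J"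
    and G_min: "(\<lambda>x. \<Sum>b\<in>G d. const (c b) * b x) \<in> J \<Longrightarrow> b \<in> G d \<Longrightarrow> c b = 0" for d f c b
    using G[of d] unfolding good_def by blast+
  have "\<exists>g. bij_betw g {0..<card (G d)} (G d)" for d using ex_bij_betw_nat_finite[OF G_fin] .
  then obtain g where g: "\<And>d. bij_betw (g d) {0..<card (G d)} (G d)" by metis
  define idx where "idx d j = \<iota> (prod_encode (d, j))" for d j
  define A where "A d = idx d ` {0..<card (G d)}" for d
  define B' where "B' = (\<Union>d. A d)"
  \<comment> \<open>An index encodes the degree and the position of its generator, so weight and
    image are obtained by decoding.\<close>
  define w' where "w' x = fst (prod_decode (inv_into UNIV \<iota> x))" for x
  define v where "v x = (case prod_decode (inv_into UNIV \<iota> x) of (d, j) \<Rightarrow> g d j)" for x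
  have w'_idx [simp]: "w' (idx d j) = d" and v_idx [simp]: "v (idx d j) = g d j" for d j
    by (simp_all add: w'_def v_def idx_def inv_f_f[OF \<iota>])
  have A_iff: "x \<in> A d \<longleftrightarrow> x \<in> B' \<and> w' x = d" for x d by (auto simp: B'_def A_def)
  have A_fin: "finite (A d)" for d by (simp add: A_def)
  have vG: "bij_betw v (A d) (G d)" for d
  proof -
    have "v ` A d = g d ` {0..<card (G d)}" by (auto simp: A_def image_image)
    moreover have "inj_on v (A d)" using g[of d] by (auto simp: A_def inj_on_def bij_betw_def)
    ultimately show ?thesis using g[of d] by (simp add: bij_betw_def)
  qed
  have v_mem: "v b \<in> K" "hcomp w (w' b) (v b) = v b" if "b \<in> B'" for b
  proof -
    have "b \<in> A (w' b)" using that by (simp add: A_iff)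
    then have "v b \<in> G (w' b)" using vG[of "w' b"] by (auto simp: bij_betw_def)
    then show "v b \<in> K" "hcomp w (w' b) (v b) = v b" using GV[of "w' b"] by (auto simp: V_def)
  qed
  have v: "v \<in> B' \<rightarrow> carrier (?F B)" using v_mem(1) free_submodule_closed(5)[OF K_sub] by auto
  define \<phi> where "\<phi> = free_hom (?F B) v"
  have \<phi>: "\<phi> \<in> module_hom (mpol_ring m) (?F B') (?F B)"
    unfolding \<phi>_def by (rule free_hom_hom[OF module_free_mod v])
  interpret \<phi>: module_map "mpol_ring m" "?F B'" "?F B" \<phi>
    using \<phi> by (intro module_map.intro module_map_axioms.intro module_free_mod)
  have \<phi>_hcomp: "\<phi> (hcomp w' d f) = hcomp w d (\<phi> f)" if "f \<in> carrier (?F B')" for d f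
    unfolding \<phi>_def by (rule free_hom_hcomp[OF v v_mem(2) that])
  have \<phi>_unit: "\<phi> (unit_vec b) = v b" if "b \<in> B'" for b
    unfolding \<phi>_def by (rule free_hom_unit[OF module_free_mod v that])
  define Im where "Im = \<phi> ` carrier (?F B')"
  have Im_sub: "submodule Im (mpol_ring m) (?F B)" unfolding Im_def by (rule \<phi>.image_submodule)
  have "Im \<subseteq> K"
  proof
    fix y assume "y \<in> Im"
    then obtain f where f: "f \<in> carrier (?F B')" "y = \<phi> f" by (auto simp: Im_def)
    then have "y = (\<lambda>x. \<Sum>a\<in>{x. f x \<noteq> 0}. f a * v a x)"
      unfolding \<phi>_def using free_hom_pointwise[OF v f(1), of "{x. f x \<noteq> 0}"]
      by (auto simp: free_mod_carrier_iff)
    also have "\<dots> \<in> K"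
      using f v_mem(1)
      by (intro free_submodule_sum[OF K_sub] free_submodule_closed(3)[OF K_sub]) (auto simp: free_mod_carrier_iff)
    finally show "y \<in> K" .
  qed
  \<comment> \<open>Modulo J a component of degree d is a combination of the chosen generators. The
    degree d part of the error is built from components of degree d - 1 of elements of K, which the
    induction hypothesis covers.\<close>
  have K_Im: "hcomp w d k \<in> Im" if "k \<in> K" for d k
    using that
  proof (induction d arbitrary: k rule: less_induct)
    case (less d)
    have "hcomp w d (hcomp w d k) = hcomp w d k" by (simp add: hcomp_hcomp)
    then obtain c where c: "(\<lambda>x. hcomp w d k x - (\<Sum>b\<in>G d. const (c b) * b x)) \<in> J" (is "?r \<in> J")
      using G_gen[of "hcomp w d k" d] K_hcomp[OF less.prems] by (auto simp: V_def)
    have "b \<in> Im" if b: "b \<in> G d" for b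
    proof -
      obtain x where x: "x \<in> A d" "b = v x" using b vG[of d] by (auto simp: bij_betw_def)
      then have "b = \<phi> (unit_vec x)" using \<phi>_unit by (simp add: A_iff)
      moreover have "unit_vec x \<in> carrier (?F B')" using x by (intro unit_vec_closed) (simp add: A_iff)
      ultimately show ?thesis by (simp add: Im_def)
    qed
    then have "(\<lambda>x. \<Sum>b\<in>G d. const (c b) * b x) \<in> Im" (is "?s \<in> Im")
      by (intro free_submodule_sum[OF Im_sub] free_submodule_closed(3)[OF Im_sub]) auto
    then obtain h where h: "h \<in> carrier (?F B')" "?s = \<phi> h" unfolding Im_def by (rule imageE)
    have s: "hcomp w d ?s \<in> Im"
      unfolding h(2) \<phi>_hcomp[OF h(1), symmetric] Im_def by (intro imageI hcomp_closed h(1))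
    have "hcomp w d ?r \<in> Im"
    proof (rule hcomp_seq_mult[OF Im_sub])
      show "?r \<in> seq_mult mpol_var (?F B) m K" using c by (simp add: J_def)
      show "hcomp w (d - 1) k \<in> Im" if "k \<in> K" "d > 0" for k using less.IH[of "d - 1"] that by simp
    qed simp
    then have "(\<lambda>x. hcomp w d ?r x + hcomp w d ?s x) \<in> Im" by (rule free_submodule_closed(2)[OF Im_sub _ s])
    moreover have "(\<lambda>x. hcomp w d ?r x + hcomp w d ?s x) = hcomp w d (hcomp w d k)"
      unfolding hcomp_add[symmetric] by simp
    ultimately show ?case by (simp add: hcomp_hcomp)
  qed
  have "K \<subseteq> Im"
  proof
    fix k assume k: "k \<in> K"
    then have "k \<in> carrier (?F B)" using free_submodule_closed(5)[OF K_sub] by auto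
    then show "k \<in> Im" by (rule graded_submodule_eqI[OF Im_sub _ K_Im[OF k]])
  qed
  with \<open>Im \<subseteq> K\<close> have Im_K: "\<phi> ` carrier (?F B') = K" by (simp add: Im_def)
  define Z where "Z = {f \<in> carrier (?F B'). \<phi> f = (\<lambda>_. 0)}"
  have Z_sub: "submodule Z (mpol_ring m) (?F B')" using \<phi>.kernel_submodule by (simp add: Z_def)
  have Z_hcomp: "hcomp w' d f \<in> Z" if "f \<in> Z" for f d
    using that \<phi>_hcomp[of f d] by (simp add: Z_def hcomp_closed)
  have "Z \<subseteq> seq_mult mpol_var (?F B') m (carrier (?F B'))"
  proof
    fix f assume f: "f \<in> Z"
    \<comment> \<open>If the coefficient at x had a constant term, the component of f in degree
      \<open>w' x\<close> would yield a relation modulo J, with constant coefficients not all zero,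
      among the generators of that degree, against their independence.\<close>
    have "lookup (f x) 0 = 0" for x
    proof (cases "x \<in> B'")
      case True
      define d where "d = w' x"
      define f' where "f' = hcomp w' d f"
      \<comment> \<open>\<open>f1\<close> holds the constant terms. The coefficients of
        \<open>f2\<close> have none, so the image of \<open>f2\<close> lies in J.\<close>
      define f1 where "f1 = (\<lambda>y. const (lookup (f' y) 0))"
      define f2 where "f2 = (\<lambda>y. f' y - f1 y)"
      have f': "f' \<in> carrier (?F B')" "\<phi> f' = (\<lambda>_. 0)" using Z_hcomp[OF f, of d] by (simp_all add: f'_def Z_def)
      have f1: "f1 \<in> carrier (?F B')"
        unfolding f1_def by (rule free_mod_map_closed[OF f'(1), of "\<lambda>_ g. const (lookup g 0)"]) auto
      have f2: "f2 \<in> carrier (?F B')"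
        unfolding f2_def f1_def
        by (rule free_mod_map_closed[OF f'(1), of "\<lambda>_ g. g - const (lookup g 0)"]) auto
      have "keys u \<inter> {..<m} \<noteq> {}" if "u \<in> keys (f2 y)" for u y
      proof -
        have "u \<noteq> 0" using that by (auto simp: f2_def f1_def in_keys_iff lookup_minus)
        moreover have "keys u \<subseteq> {..<m}"
          using that f2 by (auto simp: free_mod_carrier_iff mpol_carrier_iff)
        ultimately show ?thesis using keys_eq_empty_nat[of u] by (metis Int_absorb2)
      qed
      then have "f2 \<in> seq_mult mpol_var (?F B') m (carrier (?F B'))"
        using f2 by (simp add: seq_mult_free_mod)
      then have "\<phi> f2 \<in> seq_mult mpol_var (?F B) m (\<phi> ` carrier (?F B'))"
        using \<phi>.seq_mult_image[OF \<phi>.P.carrier_is_submodule, of m mpol_var] by auto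
      then have \<phi>f2: "\<phi> f2 \<in> J" by (simp add: Im_K J_def)
      have "\<phi> f' = \<phi> (f1 \<oplus>\<^bsub>?F B'\<^esub> f2)" by (simp add: f2_def)
      then have "\<phi> f1 = (\<lambda>x. 0 - \<phi> f2 x)"
        using f' \<phi>.add[OF f1 f2] by (simp add: fun_eq_iff add_eq_0_iff2)
      then have "\<phi> f1 \<in> J"
        using free_submodule_closed(4)[OF J_sub free_submodule_closed(1)[OF J_sub] \<phi>f2] by simp
      moreover have "\<phi> f1 = (\<lambda>y. \<Sum>a\<in>A d. f1 a * v a y)"
        unfolding \<phi>_def
      proof (rule free_hom_pointwise[OF v f1 A_fin])
        show "A d \<subseteq> B'" by (auto simp: A_iff)
        show "{x. f1 x \<noteq> 0} \<subseteq> A d"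
        proof
          fix y assume "y \<in> {x. f1 x \<noteq> 0}"
          then have y: "f1 y \<noteq> 0" "y \<in> B'" using f1 by (auto simp: free_mod_carrier_iff)
          \<comment> \<open>A constant term can contribute to degree d only at a basis vector of
            weight d.\<close>
          then have "w' y = d" by (auto simp: f1_def f'_def hcomp_def split: if_splits)
          then show "y \<in> A d" using y by (simp add: A_iff)
        qed
      qed
      moreover have "(\<Sum>a\<in>A d. f1 a * v a y) =
        (\<Sum>b\<in>G d. const (lookup (f' (inv_into (A d) v b)) 0) * b y)" for y
      proof (rule sum.reindex_bij_betw[OF vG, symmetric, THEN trans, symmetric])
        show "(\<Sum>a\<in>A d. const (lookup (f' (inv_into (A d) v (v a))) 0) * v a y) = (\<Sum>a\<in>A d. f1 a * v a y)"
          using vG[of d] by (intro sum.cong) (auto simp: f1_def bij_betw_def inv_into_f_f)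
      qed
      ultimately have inJ: "(\<lambda>y. \<Sum>b\<in>G d. const (lookup (f' (inv_into (A d) v b)) 0) * b y) \<in> J"
        by simp
      have xA: "x \<in> A d" using True by (simp add: A_iff d_def)
      then have vx: "v x \<in> G d" using vG[of d] by (auto simp: bij_betw_def)
      have "lookup (f' (inv_into (A d) v (v x))) 0 = 0" by (rule G_min[OF inJ vx])
      then have "lookup (f' x) 0 = 0" using xA vG[of d] by (simp add: bij_betw_def inv_into_f_f)
      then show ?thesis by (simp add: f'_def hcomp_def d_def)
    next
      case False
      then have "f x = 0" using f by (auto simp: Z_def free_mod_carrier_iff)
      then show ?thesis by simp
    qed
    then have "u \<noteq> 0" if "u \<in> keys (f x)" for u x using that by (auto simp: in_keys_iff)
    moreover have "keys u \<subseteq> {..<m}" if "u \<in> keys (f x)" for u x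
      using that f by (auto simp: Z_def free_mod_carrier_iff mpol_carrier_iff)
    ultimately have "keys u \<inter> {..<m} \<noteq> {}" if "u \<in> keys (f x)" for u x
      using that keys_eq_empty_nat[of u] by (metis Int_absorb2)
    then show "f \<in> seq_mult mpol_var (?F B') m (carrier (?F B'))"
      using f by (simp add: seq_mult_free_mod Z_def)
  qed
  moreover have "graded_submodule m B' w' Z" using Z_sub Z_hcomp by (simp add: graded_submodule_def)
  moreover have "finite {x \<in> B'. w' x \<le> d}" for d
  proof -
    have "{x \<in> B'. w' x \<le> d} = (\<Union>e\<le>d. A e)" by (auto simp: A_iff)
    then show ?thesis using A_fin by simp
  qed
  ultimately have "\<phi> \<in> module_hom (mpol_ring m) (?F B') (?F B) \<and> \<phi> ` carrier (?F B') = K \<and>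
    Z \<subseteq> seq_mult mpol_var (?F B') m (carrier (?F B')) \<and> graded_submodule m B' w' Z \<and>
    (\<forall>d. finite {x \<in> B'. w' x \<le> d})"
    using \<phi> Im_K by simp
  then show ?thesis unfolding Z_def by - (rule exI[of _ B'], rule exI[of _ w'], rule exI[of _ \<phi>])
qed

section \<open>Projective dimension of quotients\<close>

lemma quot_module_simps:
  "carrier (quot_module R I) = a_rcosets\<^bsub>R\<^esub> I"
  "add (quot_module R I) = set_add R"
  "ring.zero (quot_module R I) = I"
  "module.smult (quot_module R I) = (\<lambda>r c. rcoset_mult R I (I +>\<^bsub>R\<^esub> r) c)"
  by (simp_all add: quot_module_def ring.defs module.defs FactRing_def)

section \<open>The quotient module and its cosets\<close>

context ideal
begin

lemma quot_module_add:
  "a \<in> carrier R \<Longrightarrow> b \<in> carrier R \<Longrightarrow> (I +> a) \<oplus>\<^bsub>quot_module R I\<^esub> (I +> b) = I +> (a \<oplus> b)"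
  by (simp add: quot_module_simps a_rcos_sum)

lemma quot_module_smult:
  "a \<in> carrier R \<Longrightarrow> b \<in> carrier R \<Longrightarrow> a \<odot>\<^bsub>quot_module R I\<^esub> (I +> b) = I +> (a \<otimes> b)"
  by (simp add: quot_module_simps rcoset_mult_add)

lemma quot_module_coset: "a \<in> carrier R \<Longrightarrow> I +> a \<in> carrier (quot_module R I)"
  by (simp add: quot_module_simps a_rcosetsI a_subset)

lemma quot_module_cosetE:
  assumes "x \<in> carrier (quot_module R I)"
  obtains a where "a \<in> carrier R" "x = I +> a"
  using assms by (auto simp: quot_module_simps A_RCOSETS_def')

lemma coset_eq_zero_iff: "a \<in> carrier R \<Longrightarrow> I +> a = I \<longleftrightarrow> a \<in> I"
  using a_rcos_const a_rcos_self by metis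

lemma quot_module_zero: "\<zero>\<^bsub>quot_module R I\<^esub> = I +> \<zero>"
  using coset_eq_zero_iff[of \<zero>] by (simp add: quot_module_simps)

lemma module_quot_module:
  assumes "cring R" shows "module R (quot_module R I)"
proof (rule moduleI[OF assms])
  show "abelian_group (quot_module R I)"
  proof (rule abelian_groupI)
    fix x y z assume "x \<in> carrier (quot_module R I)" "y \<in> carrier (quot_module R I)" "z \<in> carrier (quot_module R I)"
    then obtain a b c where "a \<in> carrier R" "x = I +> a" "b \<in> carrier R" "y = I +> b" "c \<in> carrier R" "z = I +> c"
      by (auto elim!: quot_module_cosetE)
    then show "x \<oplus>\<^bsub>quot_module R I\<^esub> y \<oplus>\<^bsub>quot_module R I\<^esub> z = x \<oplus>\<^bsub>quot_module R I\<^esub> (y \<oplus>\<^bsub>quot_module R I\<^esub> z)"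
      by (simp add: quot_module_add a_assoc)
  next
    fix x y assume "x \<in> carrier (quot_module R I)" "y \<in> carrier (quot_module R I)"
    then obtain a b where "a \<in> carrier R" "x = I +> a" "b \<in> carrier R" "y = I +> b"
      by (auto elim!: quot_module_cosetE)
    then show "x \<oplus>\<^bsub>quot_module R I\<^esub> y \<in> carrier (quot_module R I)"
      "x \<oplus>\<^bsub>quot_module R I\<^esub> y = y \<oplus>\<^bsub>quot_module R I\<^esub> x"
      by (simp_all add: quot_module_add quot_module_coset a_comm)
  next
    fix x assume "x \<in> carrier (quot_module R I)"
    then obtain a where a: "a \<in> carrier R" "x = I +> a" by (auto elim!: quot_module_cosetE)
    then show "\<zero>\<^bsub>quot_module R I\<^esub> \<oplus>\<^bsub>quot_module R I\<^esub> x = x"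
      by (simp add: quot_module_zero quot_module_add)
    show "\<exists>y\<in>carrier (quot_module R I). y \<oplus>\<^bsub>quot_module R I\<^esub> x = \<zero>\<^bsub>quot_module R I\<^esub>"
      using a by (intro bexI[of _ "I +> \<ominus> a"])
        (simp_all add: quot_module_zero quot_module_add quot_module_coset l_neg)
  qed (simp add: quot_module_zero quot_module_coset)
  fix a x assume a: "a \<in> carrier R" and "x \<in> carrier (quot_module R I)"
  then obtain r where r: "r \<in> carrier R" "x = I +> r" by (auto elim: quot_module_cosetE)
  show "a \<odot>\<^bsub>quot_module R I\<^esub> x \<in> carrier (quot_module R I)"
    using a r by (simp add: quot_module_smult quot_module_coset)
  fix b assume b: "b \<in> carrier R"
  show "(a \<oplus> b) \<odot>\<^bsub>quot_module R I\<^esub> x = a \<odot>\<^bsub>quot_module R I\<^esub> x \<oplus>\<^bsub>quot_module R I\<^esub> b \<odot>\<^bsub>quot_module R I\<^esub> x"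
    using a b r by (simp add: quot_module_smult quot_module_add l_distr)
  show "(a \<otimes> b) \<odot>\<^bsub>quot_module R I\<^esub> x = a \<odot>\<^bsub>quot_module R I\<^esub> (b \<odot>\<^bsub>quot_module R I\<^esub> x)"
    using a b r by (simp add: quot_module_smult m_assoc)
next
  fix x assume "x \<in> carrier (quot_module R I)"
  then show "\<one> \<odot>\<^bsub>quot_module R I\<^esub> x = x" by (auto elim!: quot_module_cosetE simp: quot_module_smult)
next
  fix a x y assume a: "a \<in> carrier R" and "x \<in> carrier (quot_module R I)" "y \<in> carrier (quot_module R I)"
  then obtain r s where "r \<in> carrier R" "x = I +> r" "s \<in> carrier R" "y = I +> s"
    by (auto elim!: quot_module_cosetE)
  then show "a \<odot>\<^bsub>quot_module R I\<^esub> (x \<oplus>\<^bsub>quot_module R I\<^esub> y) =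
    a \<odot>\<^bsub>quot_module R I\<^esub> x \<oplus>\<^bsub>quot_module R I\<^esub> a \<odot>\<^bsub>quot_module R I\<^esub> y"
    using a by (simp add: quot_module_smult quot_module_add r_distr)
qed

lemma quot_module_trivial_iff:
  "carrier (quot_module R I) = {\<zero>\<^bsub>quot_module R I\<^esub>} \<longleftrightarrow> I = carrier R"
proof
  assume *: "carrier (quot_module R I) = {\<zero>\<^bsub>quot_module R I\<^esub>}"
  have "a \<in> I" if "a \<in> carrier R" for a
    using quot_module_coset[OF that] coset_eq_zero_iff[OF that] * by (simp add: quot_module_simps)
  then show "I = carrier R" using a_subset by auto
next
  assume *: "I = carrier R"
  have "x = \<zero>\<^bsub>quot_module R I\<^esub>" if "x \<in> carrier (quot_module R I)" for x
    using that by (rule quot_module_cosetE) (use * coset_eq_zero_iff in \<open>auto simp: quot_module_simps\<close>)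
  moreover have "\<zero>\<^bsub>quot_module R I\<^esub> \<in> carrier (quot_module R I)"
    using quot_module_coset[of \<zero>] coset_eq_zero_iff[of \<zero>] by (simp add: quot_module_simps)
  ultimately show "carrier (quot_module R I) = {\<zero>\<^bsub>quot_module R I\<^esub>}" by blast
qed

end

text \<open>Basis, weights and syzygy form the state that dependent choice hands from one minimal
  cover to the next. Each cover is only known to exist, so the conclusion records all that is used
  of it later.\<close>

lemma minimal_free_complex:
  fixes B\<^sub>0 :: "'i set" and w\<^sub>0 :: "'i \<Rightarrow> nat" and K\<^sub>0 :: "('i \<Rightarrow> 'p::prime_card mod_ring mpol) set"
    and \<iota> :: "nat \<Rightarrow> 'i"
  assumes \<iota>: "inj \<iota>" and K\<^sub>0: "graded_submodule m B\<^sub>0 w\<^sub>0 K\<^sub>0" and fin: "\<And>d. finite {x \<in> B\<^sub>0. w\<^sub>0 x \<le> d}"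
  shows "\<exists>B w K \<phi>. B 0 = B\<^sub>0 \<and> K 0 = K\<^sub>0 \<and> (\<forall>n. graded_submodule m (B n) (w n) (K n)) \<and>
    (\<forall>n. \<phi> n \<in> module_hom (mpol_ring m) (free_mod m (B (Suc n))) (free_mod m (B n))) \<and>
    (\<forall>n. \<phi> n ` carrier (free_mod m (B (Suc n))) = K n) \<and>
    (\<forall>n. K (Suc n) = {f \<in> carrier (free_mod m (B (Suc n))). \<phi> n f = (\<lambda>_. 0)}) \<and>
    (\<forall>n. K (Suc n) \<subseteq> seq_mult mpol_var (free_mod m (B (Suc n))) m (carrier (free_mod m (B (Suc n)))))"
proof -
  define st where "st s \<longleftrightarrow> (case s of (B, w, K) \<Rightarrow> graded_submodule m B w K \<and> (\<forall>d. finite {x \<in> B. w x \<le> d}))"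
    for s :: "'i set \<times> ('i \<Rightarrow> nat) \<times> ('i \<Rightarrow> 'p mod_ring mpol) set"
  define cov where "cov s s' \<phi> \<longleftrightarrow> (case s of (B, w, K) \<Rightarrow> case s' of (B', w', K') \<Rightarrow>
    \<phi> \<in> module_hom (mpol_ring m) (free_mod m B') (free_mod m B) \<and> \<phi> ` carrier (free_mod m B') = K \<and>
    K' = {f \<in> carrier (free_mod m B'). \<phi> f = (\<lambda>_. 0)} \<and>
    K' \<subseteq> seq_mult mpol_var (free_mod m B') m (carrier (free_mod m B')))"
    for s s' :: "'i set \<times> ('i \<Rightarrow> nat) \<times> ('i \<Rightarrow> 'p mod_ring mpol) set" and \<phi>
  have step: "\<exists>s'. st s' \<and> (\<exists>\<phi>. cov s s' \<phi>)" if "st s" for s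
  proof -
    obtain B w K where s: "s = (B, w, K)" by (cases s)
    have "graded_submodule m B w K" "\<And>d. finite {x \<in> B. w x \<le> d}" using that by (auto simp: st_def s)
    from minimal_cover[OF \<iota> this] obtain B' :: "'i set" and w' \<phi> where
      "\<phi> \<in> module_hom (mpol_ring m) (free_mod m B') (free_mod m B)" "\<phi> ` carrier (free_mod m B') = K"
      "{f \<in> carrier (free_mod m B'). \<phi> f = (\<lambda>_. 0)} \<subseteq> seq_mult mpol_var (free_mod m B') m (carrier (free_mod m B'))"
      "graded_submodule m B' w' {f \<in> carrier (free_mod m B'). \<phi> f = (\<lambda>_. 0)}"
      "\<forall>d. finite {x \<in> B'. w' x \<le> d}" by blast
    then show ?thesis
      by (intro exI[of _ "(B', w', {f \<in> carrier (free_mod m B'). \<phi> f = (\<lambda>_. 0)})"])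
        (auto simp: st_def cov_def s)
  qed
  let ?s0 = "(B\<^sub>0, w\<^sub>0, K\<^sub>0)"
  have "st ?s0" using K\<^sub>0 fin by (simp add: st_def)
  have "\<exists>f. \<forall>n. (st (f n) \<and> (n = 0 \<longrightarrow> f n = ?s0)) \<and> (\<exists>\<phi>. cov (f n) (f (Suc n)) \<phi>)"
    using \<open>st ?s0\<close> step
    by (intro dependent_nat_choice[where P = "\<lambda>n s. st s \<and> (n = 0 \<longrightarrow> s = ?s0)" and Q = "\<lambda>_ s s'. \<exists>\<phi>. cov s s' \<phi>"]) auto
  then obtain f where f: "\<And>n. st (f n)" "f 0 = ?s0" "\<And>n. \<exists>\<phi>. cov (f n) (f (Suc n)) \<phi>" by blast
  obtain \<phi> where \<phi>: "\<And>n. cov (f n) (f (Suc n)) (\<phi> n)" using f(3) by metis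
  let ?B = "\<lambda>n. fst (f n)" and ?w = "\<lambda>n. fst (snd (f n))" and ?K = "\<lambda>n. snd (snd (f n))"
  show ?thesis
    using f(1) \<phi> unfolding st_def cov_def
    by (intro exI[of _ ?B] exI[of _ ?w] exI[of _ ?K] exI[of _ \<phi>])
      (simp only: f(2) fst_conv snd_conv split_beta, blast)
qed

section \<open>From resolutions to projective dimension\<close>

lemma regular_resolution_of_projective:
  fixes M :: "('a::comm_ring_1 mpol, 'b) module"
  assumes "module (mpol_ring m) M" "projective_resolution (mpol_ring m) M P d e"
  shows "regular_resolution (mpol_ring m) M P d e mpol_var m"
  using assms unfolding projective_resolution_def
  by (intro regular_resolution.intro) (auto simp: projective_module_def intro: regular_projective)

lemma socle_free_of_short_resolution:
  fixes M :: "('a::comm_ring_1 mpol, 'b) module"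
  assumes M: "module (mpol_ring m) M" and res: "projective_resolution (mpol_ring m) M P d e"
    and short: "\<And>i. i > n \<Longrightarrow> carrier (P i) = {\<zero>\<^bsub>P i\<^esub>}" and n: "n < m"
  shows "socle_free mpol_var m M 0 (carrier M)"
proof -
  interpret regular_resolution "mpol_ring m" M P d e mpol_var m
    by (rule regular_resolution_of_projective[OF M res])
  have "syz n = {\<zero>\<^bsub>P n\<^esub>}"
    using image_d[of n] short[of "Suc n"] d.zero[of n] by simp
  moreover have "submodule (syz n) (mpol_ring m) (P n)"
    unfolding image_d[symmetric] by (rule d.image_submodule)
  then have "submodule (seq_mult mpol_var (P n) (Suc n) (syz n)) (mpol_ring m) (P n)"
    using n by (intro d.Q.seq_mult_submodule) auto
  then have "\<zero>\<^bsub>P n\<^esub> \<in> seq_mult mpol_var (P n) (Suc n) (syz n)" by (rule d.Q.submodule_zero)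
  ultimately have "socle_free mpol_var m (P n) (Suc n) (syz n)" by (simp add: socle_free_def)
  then show ?thesis using n by (intro socle_free_of_syz)
qed

text \<open>A nonzero constant term would be a component of f, hence a unit in I. The lemma supplies
  minimality of the augmentation from R onto R/I.\<close>

lemma graded_ideal_lookup_0:
  fixes I :: "'a::field mpol set"
  assumes I: "graded_ideal m I" "I \<noteq> carrier (mpol_ring m)" and f: "f \<in> I"
  shows "lookup f 0 = 0"
proof (rule ccontr)
  interpret ideal I "mpol_ring m" using I by (simp add: graded_ideal_def)
  let ?c = "lookup f 0"
  assume c: "?c \<noteq> 0"
  have "hom_component 0 f = const ?c" by (rule poly_mapping_eqI) (auto simp: lookup_single when_def)
  then have "const ?c \<in> I" using I f by (metis graded_ideal_def)
  then have "const (1 / ?c) * const ?c \<in> I" using I_l_closed[of "const ?c" "const (1 / ?c)"] by simp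
  then have "1 \<in> I" using c by (simp add: mult_single)
  then show False using one_imp_carrier I(2) by simp
qed

text \<open>Every nonconstant monomial in the m variables contains one of them, so only constant
  terms matter.\<close>

lemma in_seq_mult_free_mod_iff:
  "f \<in> seq_mult mpol_var (free_mod m B) m (carrier (free_mod m B)) \<longleftrightarrow>
    f \<in> carrier (free_mod m B) \<and> (\<forall>x. lookup (f x) 0 = 0)"
proof -
  have "keys u \<inter> {..<m} \<noteq> {} \<longleftrightarrow> u \<noteq> 0"
    if "f \<in> carrier (free_mod m B)" "u \<in> keys (f x)" for u x
  proof -
    have "keys u \<subseteq> {..<m}" using that by (auto simp: free_mod_carrier_iff mpol_carrier_iff)
    then show ?thesis using keys_eq_empty_nat[of u] by (metis Int_absorb2)
  qed
  then show ?thesis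
    by (auto simp: seq_mult_free_mod in_keys_iff) (metis in_keys_iff)+
qed

text \<open>The number n is the index at which the minimal syzygy vanishes: m in general, m - 1
  without socle. The injection \<open>\<iota>\<close> makes room for infinitely many basis vectors
  in an index type that is left open until \<open>proj_dim\<close> prescribes it.\<close>

lemma exists_short_resolution:
  fixes m :: nat and I :: "'p::prime_card mod_ring mpol set" and \<iota> :: "nat \<Rightarrow> 'i"
  defines "R \<equiv> mpol_ring m" and "M \<equiv> quot_module (mpol_ring m) I"
  assumes I: "graded_ideal m I" "I \<noteq> carrier R" and \<iota>: "inj \<iota>"
    and n: "n = m \<or> m = Suc n \<and> socle_free mpol_var m M 0 (carrier M)"
  shows "\<exists>(P :: nat \<Rightarrow> ('p mod_ring mpol, 'i \<Rightarrow> 'p mod_ring mpol) module) d e.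
    projective_resolution R M P d e \<and> (\<forall>i>n. carrier (P i) = {\<zero>\<^bsub>P i\<^esub>})"
proof -
  interpret I: ideal I "mpol_ring m" using I by (simp add: graded_ideal_def)
  have M: "module R M" unfolding R_def M_def by (rule I.module_quot_module[OF cring_mpol_ring])
  let ?F = "\<lambda>B. free_mod m B :: ('p mod_ring mpol, 'i \<Rightarrow> 'p mod_ring mpol) module"
  \<comment> \<open>The resolution starts with R itself, as a free module on one basis vector of
    degree 0.\<close>
  let ?B0 = "{\<iota> 0}"
  define K0 where "K0 = {f \<in> carrier (?F ?B0). f (\<iota> 0) \<in> I}"
  define e where "e f = I +>\<^bsub>R\<^esub> f (\<iota> 0)" for f :: "'i \<Rightarrow> 'p mod_ring mpol"
  have e: "e \<in> module_hom R (?F ?B0) M"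
    unfolding module_hom_def hom_def R_def M_def e_def
    by (auto simp: free_mod_carrier_iff I.quot_module_add I.quot_module_smult I.quot_module_coset)
  interpret aug: module_map R "?F ?B0" M e
    using e M module_free_mod unfolding R_def by (intro module_map.intro module_map_axioms.intro)
  have "e f = \<zero>\<^bsub>M\<^esub> \<longleftrightarrow> f (\<iota> 0) \<in> I" if "f \<in> carrier (?F ?B0)" for f
    using that I.coset_eq_zero_iff[of "f (\<iota> 0)"]
    by (simp add: e_def R_def M_def quot_module_simps(3) free_mod_carrier_iff)
  then have ker_e: "{f \<in> carrier (?F ?B0). e f = \<zero>\<^bsub>M\<^esub>} = K0" by (auto simp: K0_def)
  have im_e: "e ` carrier (?F ?B0) = carrier M"
  proof
    show "carrier M \<subseteq> e ` carrier (?F ?B0)"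
    proof
      fix x assume "x \<in> carrier M"
      then obtain a where a: "a \<in> carrier R" "x = I +>\<^bsub>R\<^esub> a"
        unfolding M_def R_def by (rule I.quot_module_cosetE)
      have "(\<lambda>i. a * unit_vec (\<iota> 0) i) \<in> carrier (?F ?B0)"
        using a by (intro free_mod_map_closed[OF unit_vec_closed, of _ _ "\<lambda>_ g. a * g"]) (auto simp: R_def)
      moreover have "e (\<lambda>i. a * unit_vec (\<iota> 0) i) = x" by (simp add: a e_def unit_vec_def)
      ultimately show "x \<in> e ` carrier (?F ?B0)" by blast
    qed
  qed auto
  have "graded_submodule m ?B0 (\<lambda>_. 0) K0"
    unfolding graded_submodule_def
  proof (intro conjI ballI allI)
    show "submodule K0 (mpol_ring m) (?F ?B0)"
      using aug.kernel_submodule unfolding ker_e R_def .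
    fix f d assume "f \<in> K0"
    then show "hcomp (\<lambda>_. 0) d f \<in> K0"
      using I hcomp_closed[of f m ?B0 "\<lambda>_. 0" d] by (auto simp: K0_def graded_ideal_def hcomp_def)
  qed
  moreover have "finite {x \<in> ?B0. 0 \<le> d}" for d :: nat by auto
  ultimately obtain B w K \<phi> where BK: "B 0 = ?B0" "K 0 = K0" "\<And>n. graded_submodule m (B n) (w n) (K n)"
    and \<phi>: "\<And>n. \<phi> n \<in> module_hom (mpol_ring m) (?F (B (Suc n))) (?F (B n))"
    and im: "\<And>n. \<phi> n ` carrier (?F (B (Suc n))) = K n"
    and ker: "\<And>n. K (Suc n) = {f \<in> carrier (?F (B (Suc n))). \<phi> n f = (\<lambda>_. 0)}"
    and minimal: "\<And>n. K (Suc n) \<subseteq> seq_mult mpol_var (?F (B (Suc n))) m (carrier (?F (B (Suc n))))"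
    using minimal_free_complex[OF \<iota>, of m ?B0 "\<lambda>_. 0" K0] by blast
  define P where "P n = ?F (B n)" for n
  have res: "projective_resolution R M P \<phi> e"
    unfolding projective_resolution_def P_def R_def
    using \<phi> im e[unfolded R_def] im_e ker_e BK ker by (simp add: projective_free_mod)
  interpret regular_resolution R M P \<phi> e mpol_var m
    using regular_resolution_of_projective[of m M P \<phi> e] M res by (simp add: R_def)
  have syz: "syz i = K i" for i using image_d[of i] im[of i] by (simp add: P_def)
  have minimal': "K i \<subseteq> seq_mult mpol_var (P i) m (carrier (P i))" for i
  proof (cases i)
    case 0
    have "f \<in> seq_mult mpol_var (?F ?B0) m (carrier (?F ?B0))" if f: "f \<in> K0" for f
    proof -
      have "lookup (f x) 0 = 0" for x
        using f graded_ideal_lookup_0[OF I(1) I(2)[unfolded R_def], of "f x"]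
        by (cases "f x = 0") (auto simp: K0_def free_mod_carrier_iff)
      then show ?thesis using f by (simp add: in_seq_mult_free_mod_iff K0_def)
    qed
    then show ?thesis using 0 BK by (auto simp: P_def)
  qed (use minimal P_def in auto)
  \<comment> \<open>For n = m this is the vanishing of Tor in degree m + 1, for n = m - 1 the
    absence of socle elements. Minimality puts the n-th kernel into (X_1, ..., X_m)P_n, so it is
    contained in (X_1, ..., X_m) times itself.\<close>
  have "seq_mult mpol_var (P n) m (carrier (P n)) \<inter> syz n \<subseteq> seq_mult mpol_var (P n) m (syz n)"
    using n tor_vanishing[of m m] syz_socle_free[of n] by blast
  then have "K n \<subseteq> seq_mult mpol_var (?F (B n)) m (K n)" using minimal'[of n] by (auto simp: syz P_def)
  then have "k = (\<lambda>_. 0)" if "k \<in> K n" for k by (rule graded_nakayama[OF BK(3) _ that])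
  moreover have "submodule (K n) (mpol_ring m) (?F (B n))" using BK(3)[of n] by (simp add: graded_submodule_def)
  then have "(\<lambda>_. 0) \<in> K n" by (rule free_submodule_closed(1))
  ultimately have Kn: "K n = {\<lambda>_. 0}" by blast
  \<comment> \<open>Beyond n the kernel is the whole free module, yet minimality confines it to
    vectors without constant terms. A unit vector has one, so the basis is empty.\<close>
  have vanish: "K (n + i) = {\<lambda>_. 0} \<and> (i > 0 \<longrightarrow> carrier (P (n + i)) = {\<lambda>_. 0})" for i
  proof (induction i)
    case (Suc i)
    then have "\<phi> (n + i) f = (\<lambda>_. 0)" if "f \<in> carrier (P (Suc (n + i)))" for f
      using im[of "n + i"] that by (auto simp: P_def)
    then have all: "carrier (P (Suc (n + i))) = K (Suc (n + i))" using ker by (auto simp: P_def)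
    have "B (Suc (n + i)) = {}"
    proof (rule ccontr)
      assume "B (Suc (n + i)) \<noteq> {}"
      then obtain b where "b \<in> B (Suc (n + i))" by auto
      then have "unit_vec b \<in> seq_mult mpol_var (P (Suc (n + i))) m (carrier (P (Suc (n + i))))"
        using minimal'[of "Suc (n + i)"] all unit_vec_closed[of b "B (Suc (n + i))" m] by (auto simp: P_def)
      then have "lookup (unit_vec b b :: 'p mod_ring mpol) 0 = 0"
        by (simp add: P_def in_seq_mult_free_mod_iff)
      then show False by (simp add: unit_vec_def)
    qed
    then have "carrier (P (Suc (n + i))) = {\<lambda>_. 0}"
      by (auto simp: P_def free_mod_carrier_iff)
    then show ?case using all by simp
  qed (simp add: Kn)
  have "\<forall>i>n. carrier (P i) = {\<zero>\<^bsub>P i\<^esub>}"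
  proof (intro allI impI)
    fix i assume "i > n"
    then obtain k where "k > 0" "i = n + k" using less_imp_add_positive by metis
    then have "carrier (P i) = {\<lambda>_. 0}" using vanish[of k] by blast
    then show "carrier (P i) = {\<zero>\<^bsub>P i\<^esub>}" unfolding P_def free_mod_simps .
  qed
  from conjI[OF res this] show ?thesis by - (rule exI[of _ P], rule exI[of _ \<phi>], rule exI[of _ e])
qed

text \<open>For a proper ideal the minimal resolution bounds the projective dimension by m, and by m
  - 1 in the absence of a socle; with a socle no shorter resolution exists. For I = R the projective
  dimension is -\<infinity> and the zero module is trivially socle free.\<close>

theorem proj_dim_quot_module_eq_iff:
  fixes m :: nat and I :: "'p::prime_card mod_ring mpol set"
  defines "R \<equiv> mpol_ring m" and "M \<equiv> quot_module (mpol_ring m) I"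
  assumes I: "graded_ideal m I"
  shows "proj_dim R M = ereal (real m) \<longleftrightarrow> \<not> socle_free mpol_var m M 0 (carrier M)"
proof -
  interpret I: ideal I "mpol_ring m" using I by (simp add: graded_ideal_def)
  have M: "module (mpol_ring m) M" unfolding M_def by (rule I.module_quot_module[OF cring_mpol_ring])
  show ?thesis
  proof (cases "I = carrier R")
    case True
    then have triv: "carrier M = {\<zero>\<^bsub>M\<^esub>}" using I.quot_module_trivial_iff by (simp add: M_def R_def)
    then show ?thesis by (simp add: proj_dim_def socle_free_def)
  next
    case False
    then have nontriv: "carrier M \<noteq> {\<zero>\<^bsub>M\<^esub>}" using I.quot_module_trivial_iff by (simp add: M_def R_def)
    define L where "L = {ereal (real n) | n.
       \<exists>(P :: nat \<Rightarrow> ('p mod_ring mpol, 'p mod_ring mpol set \<times> nat \<Rightarrow> 'p mod_ring mpol) module) d e.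
         projective_resolution R M P d e \<and> (\<forall>i > n. carrier (P i) = {\<zero>\<^bsub>P i\<^esub>})}"
    have pd: "proj_dim R M = Inf L" using nontriv by (simp add: proj_dim_def L_def)
    \<comment> \<open>Any injection of the naturals into the index type prescribed by
      \<open>proj_dim\<close> will do.\<close>
    have \<iota>: "inj (\<lambda>n::nat. ({} :: 'p mod_ring mpol set, n))" by (simp add: inj_def)
    have mem: "ereal (real n) \<in> L" if "n = m \<or> m = Suc n \<and> socle_free mpol_var m M 0 (carrier M)" for n
      using exists_short_resolution[OF I False[unfolded R_def] \<iota> that[unfolded M_def]]
      unfolding L_def R_def M_def by blast
    show ?thesis
    proof (cases "socle_free mpol_var m M 0 (carrier M)")
      case True
      \<comment> \<open>For m = 0 every element is a socle element, so a nonzero module is not socle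
        free. This is what makes a resolution of length m - 1 meaningful.\<close>
      have "m \<noteq> 0"
      proof
        assume "m = 0"
        then have "carrier M \<subseteq> {\<zero>\<^bsub>M\<^esub>}" using True by (auto simp: socle_free_def)
        moreover have "\<zero>\<^bsub>M\<^esub> \<in> carrier M" using M by (simp add: module_def abelian_group_def abelian_monoid.zero_closed)
        ultimately show False using nontriv by auto
      qed
      then obtain n where n: "m = Suc n" by (cases m) auto
      then have "Inf L \<le> ereal (real n)" using mem[of n] True by (intro Inf_lower) simp
      then show ?thesis using True n by (auto simp: pd)
    next
      case no: False
      have "ereal (real m) \<le> l" if "l \<in> L" for l
      proof -
        obtain n and P :: "nat \<Rightarrow> ('p mod_ring mpol, 'p mod_ring mpol set \<times> nat \<Rightarrow> 'p mod_ring mpol) module" and d e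
          where l: "l = ereal (real n)" and res: "projective_resolution (mpol_ring m) M P d e"
            and short: "\<And>i. i > n \<Longrightarrow> carrier (P i) = {\<zero>\<^bsub>P i\<^esub>}"
          using \<open>l \<in> L\<close> unfolding L_def R_def by blast
        have "\<not> n < m" using socle_free_of_short_resolution[OF M res short] no by blast
        then show ?thesis by (simp add: l)
      qed
      then have "Inf L = ereal (real m)"
        using mem[of m] by (intro antisym Inf_lower Inf_greatest) auto
      then show ?thesis using no by (simp add: pd)
    qed
  qed
qed

section \<open>Krull dimension of the polynomial ring\<close>

lemma mult_bounded_exponents:
  fixes f g :: "'a::comm_ring_1 mpol"
  assumes "\<forall>t \<in> keys f. \<forall>i. lookup t i \<le> a"
    and "\<forall>t \<in> keys g. \<forall>i. lookup t i \<le> b"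
  shows "\<forall>t \<in> keys (f * g). \<forall>i. lookup t i \<le> a + b"
proof (intro ballI allI)
  fix t i assume "t \<in> keys (f * g)"
  then obtain u v where "t = u + v" "u \<in> keys f" "v \<in> keys g"
    using keys_mult[of f g] by auto
  then show "lookup t i \<le> a + b" using assms by (auto simp: lookup_add intro: add_mono)
qed

lemma power_bounded_exponents:
  fixes f :: "'a::comm_ring_1 mpol"
  assumes "\<forall>t \<in> keys f. \<forall>i. lookup t i \<le> a"
  shows "\<forall>t \<in> keys (f ^ n). \<forall>i. lookup t i \<le> n * a"
proof (induction n)
  case (Suc n)
  then show ?case using mult_bounded_exponents[OF assms Suc] by simp
qed simp

lemma prod_bounded_exponents:
  fixes f :: "'j \<Rightarrow> 'a::comm_ring_1 mpol"
  assumes "\<And>j. j \<in> A \<Longrightarrow> \<forall>t \<in> keys (f j). \<forall>i. lookup t i \<le> a"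
  shows "\<forall>t \<in> keys (prod f A). \<forall>i. lookup t i \<le> card A * a"
  using assms
proof (induction A rule: infinite_finite_induct)
  case (insert j A)
  have "\<forall>t \<in> keys (f j * prod f A). \<forall>i. lookup t i \<le> a + card A * a"
    by (rule mult_bounded_exponents[OF insert.prems insert.IH[OF insert.prems]]) simp_all
  then show ?case using insert by simp
qed auto

text \<open>There are more polynomials in \<open>m + 1\<close> variables with exponents below \<open>N\<close> than values they can
  take, once \<open>N\<close> is large.\<close>

lemma algebraic_dependence:
  fixes x :: "nat \<Rightarrow> 'a::{finite,field} mpol"
  assumes x: "\<And>i. i \<le> m \<Longrightarrow> x i \<in> carrier (mpol_ring m)"
  shows "\<exists>E c. finite E \<and> E \<noteq> {} \<and> E \<subseteq> extensional {..m} \<and> (\<forall>e \<in> E. c e \<noteq> (0::'a)) \<and>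
    (\<Sum>e\<in>E. single 0 (c e) * (\<Prod>i\<le>m. x i ^ e i)) = 0"
proof -
  let ?b = "\<lambda>f D. \<forall>t \<in> keys f. \<forall>i. lookup t i \<le> (D::nat)"
  have "\<exists>D. ?b f D" for f :: "'a mpol"
    using ex_total_deg_bound[of f] lookup_le_total_deg le_trans by metis
  then obtain b where b: "\<And>f :: 'a mpol. ?b f (b f)" by metis
  define D where "D = Max ((\<lambda>i. b (x i)) ` {..m})"
  have D: "?b (x i) D" if "i \<le> m" for i
  proof -
    have "b (x i) \<le> D" unfolding D_def using that by (intro Max_ge) auto
    then show ?thesis using b[of "x i"] le_trans by blast
  qed
  \<comment> \<open>Each of the m + 1 factors of a product has exponents at most N D, so the product
    has exponents at most D' N.\<close>
  define D' where "D' = Suc m * D"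
  \<comment> \<open>Chosen to exceed (D' + 1)^m. Then (D' N + 1)^m \<le> (D' + 1)^m N^m < N^(m + 1),
    so fewer monomials can occur in a value than there are exponent vectors to combine.\<close>
  define N where "N = Suc ((D' + 1) ^ m)"
  define Ex where "Ex = {..m} \<rightarrow>\<^sub>E {..<N}"
  define Mon where "Mon = {t :: nat \<Rightarrow>\<^sub>0 nat. keys t \<subseteq> {..<m} \<and> (\<forall>i. lookup t i \<le> D' * N)}"
  define ev where "ev c = (\<Sum>e\<in>Ex. single 0 (c e) * (\<Prod>i\<le>m. x i ^ e i))" for c :: "(nat \<Rightarrow> nat) \<Rightarrow> 'a"
  have finEx: "finite Ex" unfolding Ex_def by (intro finite_PiE) auto
  have cardEx: "card Ex = N ^ Suc m" by (simp add: Ex_def card_PiE)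
  have prod_b: "?b (\<Prod>i\<le>m. x i ^ e i) (D' * N)" if e: "e \<in> Ex" for e
  proof -
    have "?b (x i ^ e i) (N * D)" if "i \<le> m" for i
    proof -
      have "e i < N" using e that by (auto simp: Ex_def PiE_iff)
      then have "e i * D \<le> N * D" by simp
      then show ?thesis using power_bounded_exponents[OF D[OF that], of "e i"] le_trans by blast
    qed
    then show ?thesis using prod_bounded_exponents[of "{..m}" "\<lambda>i. x i ^ e i" "N * D"]
      by (simp add: D'_def algebra_simps)
  qed
  have evM: "ev c \<in> {f. keys f \<subseteq> Mon}" for c
  proof -
    have car: "ev c \<in> carrier (mpol_ring m)"
      unfolding ev_def using x by (intro mpol_sum_closed mpol_closed mpol_prod_closed mpol_power_closed) auto
    have "lookup t i \<le> D' * N" if "t \<in> keys (ev c)" for t i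
    proof -
      have "\<exists>e\<in>Ex. t \<in> keys (single 0 (c e) * (\<Prod>i\<le>m. x i ^ e i))"
      proof (rule ccontr)
        assume "\<not> ?thesis"
        then have "lookup (ev c) t = 0"
          unfolding ev_def lookup_sum by (intro sum.neutral) (auto simp: in_keys_iff)
        then show False using that by (simp add: in_keys_iff)
      qed
      then obtain e where e: "e \<in> Ex" "t \<in> keys (single 0 (c e) * (\<Prod>i\<le>m. x i ^ e i))"
        by blast
      have "?b (single 0 (c e) * (\<Prod>i\<le>m. x i ^ e i)) (0 + D' * N)"
        by (intro mult_bounded_exponents prod_b e) auto
      then show ?thesis using e(2) by auto
    qed
    then show ?thesis using car by (auto simp: Mon_def mpol_carrier_iff)
  qed
  have finMon: "finite Mon" unfolding Mon_def by (rule finite_monomials_bounded)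
  have ca: "1 < CARD('a)" using card_mono[of "UNIV :: 'a set" "{0, 1}"] by simp
  have "(D' * N + 1) ^ m \<le> ((D' + 1) * N) ^ m" by (intro power_mono) (auto simp: N_def)
  also have "\<dots> = (D' + 1) ^ m * N ^ m" by (rule power_mult_distrib)
  also have "\<dots> < N * N ^ m" by (simp add: N_def)
  finally have lt: "(D' * N + 1) ^ m < N ^ Suc m" by simp
  have "card (ev ` (Ex \<rightarrow>\<^sub>E UNIV)) \<le> card {f :: 'a mpol. keys f \<subseteq> Mon}"
    using evM by (intro card_mono finite_poly_mappings_keys finMon) auto
  also have "\<dots> \<le> CARD('a) ^ card Mon" by (rule finite_poly_mappings_keys(2)[OF finMon])
  also have "\<dots> \<le> CARD('a) ^ (Suc (D' * N) ^ m)"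
    unfolding Mon_def using ca by (intro power_increasing card_monomials_bounded) auto
  also have "\<dots> < CARD('a) ^ (N ^ Suc m)" using ca lt by (intro power_strict_increasing) auto
  also have "\<dots> = card (Ex \<rightarrow>\<^sub>E (UNIV :: 'a set))" by (simp add: card_PiE finEx cardEx)
  finally have "\<not> inj_on ev (Ex \<rightarrow>\<^sub>E UNIV)" by (rule pigeonhole)
  then obtain c c' where c: "c \<in> Ex \<rightarrow>\<^sub>E UNIV" "c' \<in> Ex \<rightarrow>\<^sub>E UNIV" "c \<noteq> c'" "ev c = ev c'"
    by (auto simp: inj_on_def)
  \<comment> \<open>Two coefficient families with the same value differ by a relation; keeping only
    the places where they differ makes all its coefficients nonzero.\<close>
  define E where "E = {e \<in> Ex. c e - c' e \<noteq> 0}"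
  have "E \<noteq> {}"
  proof
    assume "E = {}"
    then have "c = c'" using c(1,2) by (intro PiE_ext[of c Ex "\<lambda>_. UNIV" c' ]) (auto simp: E_def)
    then show False using c by simp
  qed
  moreover have "(\<Sum>e\<in>E. single 0 (c e - c' e) * (\<Prod>i\<le>m. x i ^ e i)) = ev c - ev c'"
  proof -
    have "(\<Sum>e\<in>E. single 0 (c e - c' e) * (\<Prod>i\<le>m. x i ^ e i)) =
      (\<Sum>e\<in>Ex. single 0 (c e - c' e) * (\<Prod>i\<le>m. x i ^ e i))"
      using finEx by (intro sum.mono_neutral_left) (auto simp: E_def)
    then show ?thesis by (simp add: ev_def single_diff left_diff_distrib sum_subtractf)
  qed
  moreover have "finite E" using finEx by (simp add: E_def)
  moreover have "E \<subseteq> extensional {..m}" by (auto simp: E_def Ex_def PiE_def)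
  moreover have "\<forall>e \<in> E. c e - c' e \<noteq> 0" by (simp add: E_def)
  ultimately show ?thesis
    using c(4) by (intro exI[of _ E] exI[of _ "\<lambda>e. c e - c' e"]) simp
qed

text \<open>Taking the lexicographically smallest term of a relation yields, step by step, relations modulo the
  larger primes with one variable fewer.\<close>

lemma no_long_prime_chain:
  fixes P :: "nat \<Rightarrow> 'a::{finite,field} mpol set"
  assumes prime: "\<And>i. i \<le> Suc m \<Longrightarrow> primeideal (P i) (mpol_ring m)"
    and chain: "\<And>i. i \<le> m \<Longrightarrow> P i \<subset> P (Suc i)"
  shows False
proof -
  let ?R = "mpol_ring m :: 'a mpol ring"
  have idE: "0 \<in> P i" "f \<in> P i \<Longrightarrow> g \<in> P i \<Longrightarrow> f + g \<in> P i" "a \<in> carrier ?R \<Longrightarrow> f \<in> P i \<Longrightarrow> a * f \<in> P i"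
    "P i \<subseteq> carrier ?R" if i: "i \<le> Suc m" for i f g a
  proof -
    interpret primeideal "P i" ?R by (rule prime[OF i])
    show "0 \<in> P i" using additive_subgroup.zero_closed[OF is_additive_subgroup] by simp
    show "f \<in> P i \<Longrightarrow> g \<in> P i \<Longrightarrow> f + g \<in> P i"
      using additive_subgroup.a_closed[OF is_additive_subgroup, of f g] by simp
    show "a \<in> carrier ?R \<Longrightarrow> f \<in> P i \<Longrightarrow> a * f \<in> P i" using I_l_closed[of f a] by simp
    show "P i \<subseteq> carrier ?R" by (rule a_subset)
  qed
  have sum_closed: "(\<Sum>e\<in>A. f e) \<in> P i" if "i \<le> Suc m" "\<And>e. e \<in> A \<Longrightarrow> f e \<in> P i"
    for A :: "(nat \<Rightarrow> nat) set" and f i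
    using that(2) by (induction A rule: infinite_finite_induct) (auto intro: idE[OF that(1)])
  have minus: "f - g \<in> P i" if "i \<le> Suc m" "f \<in> P i" "g \<in> P i" for f g i
    using idE(2)[OF that(1,2), of "- 1 * g"] idE(3)[OF that(1), of "- 1" g] that(3) by simp
  have "\<forall>i\<le>m. \<exists>y. y \<in> P (Suc i) \<and> y \<notin> P i" using chain by blast
  \<comment> \<open>One element from each gap of the chain: m + 2 primes give m + 1 elements, just
    enough for an algebraic relation.\<close>
  then obtain x where x: "\<And>i. i \<le> m \<Longrightarrow> x i \<in> P (Suc i)" "\<And>i. i \<le> m \<Longrightarrow> x i \<notin> P i" by metis
  have xc: "x i \<in> carrier ?R" if "i \<le> m" for i using x(1)[OF that] idE(4)[of "Suc i"] that by auto
  obtain E0 c where E0: "finite E0" "E0 \<noteq> {}" "E0 \<subseteq> extensional {..m}" "\<forall>e \<in> E0. c e \<noteq> (0::'a)"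
    "(\<Sum>e\<in>E0. single 0 (c e) * (\<Prod>i\<le>m. x i ^ e i)) = 0"
    using algebraic_dependence[of m x] xc by blast
  \<comment> \<open>After j steps the exponents of x_0, ..., x_{j-1} are fixed at their successive
    minima and the powers have been cancelled, at the price of working modulo
    \<open>P j\<close>.\<close>
  have "\<exists>E \<subseteq> E0. E \<noteq> {} \<and> (\<forall>e \<in> E. \<forall>e' \<in> E. \<forall>i<j. e i = e' i) \<and>
    (\<Sum>e\<in>E. single 0 (c e) * (\<Prod>i\<in>{j..m}. x i ^ e i)) \<in> P j" if "j \<le> Suc m" for j
    using that
  proof (induction j)
    case 0
    then show ?case using E0 idE(1)[of 0] by (intro exI[of _ E0]) (auto simp: atMost_atLeast0)
  next
    case (Suc j)
    then obtain E where E: "E \<subseteq> E0" "E \<noteq> {}" "\<forall>e \<in> E. \<forall>e' \<in> E. \<forall>i<j. e i = e' i"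
      "(\<Sum>e\<in>E. single 0 (c e) * (\<Prod>i\<in>{j..m}. x i ^ e i)) \<in> P j" by auto
    have jm: "j \<le> m" using Suc.prems by simp
    have finE: "finite E" using E(1) E0(1) by (rule finite_subset)
    define k where "k = Min ((\<lambda>e. e j) ` E)"
    have k: "k \<le> e j" if "e \<in> E" for e unfolding k_def using finE that by (intro Min_le) auto
    have "k \<in> (\<lambda>e. e j) ` E" unfolding k_def using finE E(2) by (intro Min_in) auto
    then obtain e0 where e0: "e0 \<in> E" "e0 j = k" by auto
    define E' where "E' = {e \<in> E. e j = k}"
    define tm where "tm e = single 0 (c e) * (\<Prod>i\<in>{Suc j..m}. x i ^ e i)" for e
    have tmc: "tm e \<in> carrier ?R" for e unfolding tm_def using xc by (intro mpol_closed mpol_prod_closed) auto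
    have split: "(\<Prod>i\<in>{j..m}. x i ^ e i) = x j ^ e j * (\<Prod>i\<in>{Suc j..m}. x i ^ e i)" for e
      using jm by (simp add: prod.atLeast_Suc_atMost)
    have "(\<Sum>e\<in>E. single 0 (c e) * (\<Prod>i\<in>{j..m}. x i ^ e i)) = (\<Sum>e\<in>E. x j ^ k * (x j ^ (e j - k) * tm e))"
    proof (intro sum.cong refl)
      fix e assume "e \<in> E"
      then have "x j ^ e j = x j ^ k * x j ^ (e j - k)" using k by (simp flip: power_add)
      then show "single 0 (c e) * (\<Prod>i\<in>{j..m}. x i ^ e i) = x j ^ k * (x j ^ (e j - k) * tm e)"
        by (simp add: split tm_def mult_ac)
    qed
    also have "\<dots> = x j ^ k * (\<Sum>e\<in>E. x j ^ (e j - k) * tm e)" by (simp add: sum_distrib_left)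
    finally have mem: "x j ^ k * (\<Sum>e\<in>E. x j ^ (e j - k) * tm e) \<in> P j" using E(4) by simp
    interpret prj: primeideal "P j" ?R using prime Suc.prems by simp
    have inner_c: "(\<Sum>e\<in>E. x j ^ (e j - k) * tm e) \<in> carrier ?R" using xc[OF jm] tmc by auto
    \<comment> \<open>The common power of x_j can be cancelled because x_j lies outside the prime
      \<open>P j\<close>.\<close>
    have "x j ^ n * a \<in> P j \<Longrightarrow> a \<in> carrier ?R \<Longrightarrow> a \<in> P j" for n a
    proof (induction n)
      case (Suc n)
      then have "x j * (x j ^ n * a) \<in> P j" by (simp add: mult.assoc)
      then have "x j ^ n * a \<in> P j"
        using prj.I_prime[of "x j" "x j ^ n * a"] x(2)[OF jm] xc[OF jm] Suc.prems by auto
      then show ?case using Suc by simp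
    qed simp
    then have inner: "(\<Sum>e\<in>E. x j ^ (e j - k) * tm e) \<in> P (Suc j)"
      using mem inner_c chain[OF jm] by blast
    have eq: "(\<Sum>e\<in>E. x j ^ (e j - k) * tm e) = (\<Sum>e\<in>E'. tm e) + (\<Sum>e\<in>E - E'. x j ^ (e j - k) * tm e)"
    proof -
      have "(\<Sum>e\<in>E. x j ^ (e j - k) * tm e) =
        (\<Sum>e\<in>E - E'. x j ^ (e j - k) * tm e) + (\<Sum>e\<in>E'. x j ^ (e j - k) * tm e)"
        using finE by (intro sum.subset_diff) (auto simp: E'_def)
      also have "(\<Sum>e\<in>E'. x j ^ (e j - k) * tm e) = (\<Sum>e\<in>E'. tm e)"
        by (intro sum.cong) (auto simp: E'_def)
      finally show ?thesis by simp
    qed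
    \<comment> \<open>Terms with a larger exponent of x_j keep a factor x_j, which lies in the next
      prime.\<close>
    have "(\<Sum>e\<in>E - E'. x j ^ (e j - k) * tm e) \<in> P (Suc j)"
    proof (intro sum_closed)
      fix e assume e: "e \<in> E - E'"
      then have "0 < e j - k" using k[of e] by (auto simp: E'_def)
      then obtain n where n: "e j - k = Suc n" using gr0_implies_Suc by blast
      have "x j ^ (e j - k) * tm e = (x j ^ n * tm e) * x j" by (simp add: n mult_ac)
      moreover have "x j ^ n * tm e \<in> carrier ?R" using xc[OF jm] tmc by auto
      ultimately show "x j ^ (e j - k) * tm e \<in> P (Suc j)"
        using idE(3)[OF _ _ x(1)[OF jm], of "x j ^ n * tm e"] jm by (simp only: Suc_le_mono)
    qed (use jm in simp)
    with inner have "(\<Sum>e\<in>E. x j ^ (e j - k) * tm e) - (\<Sum>e\<in>E - E'. x j ^ (e j - k) * tm e) \<in> P (Suc j)"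
      by (rule minus[OF Suc.prems])
    then have E'P: "(\<Sum>e\<in>E'. tm e) \<in> P (Suc j)" unfolding eq add_diff_cancel_right' .
    have "E' \<subseteq> E0" "E' \<noteq> {}" using E(1) e0 by (auto simp: E'_def)
    moreover have "\<forall>e \<in> E'. \<forall>e' \<in> E'. \<forall>i<Suc j. e i = e' i" using E(3) by (auto simp: E'_def less_Suc_eq)
    ultimately show ?case using E'P unfolding tm_def by blast
  qed
  from this[of "Suc m"] obtain E where E: "E \<subseteq> E0" "E \<noteq> {}" "\<forall>e \<in> E. \<forall>e' \<in> E. \<forall>i<Suc m. e i = e' i"
    "(\<Sum>e\<in>E. single 0 (c e)) \<in> P (Suc m)" by auto
  obtain e where e: "e \<in> E" using E(2) by auto
  \<comment> \<open>Exponent vectors are extensional, so agreement at all m + 1 places leaves a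
    single one. Its coefficient would be a unit in the proper ideal
    \<open>P (Suc m)\<close>.\<close>
  have "e' = e" if "e' \<in> E" for e'
    using that e E(1,3) E0(3) by (intro extensionalityI[of e' "{..m}" e]) auto
  then have "E = {e}" using e by blast
  then have mem: "single 0 (c e) \<in> P (Suc m)" using E(4) by simp
  have "c e \<noteq> 0" using e E(1) E0(4) by auto
  then have "single 0 (1 / c e) * single 0 (c e) = (1 :: 'a mpol)" by (simp add: mult_single)
  then have "1 \<in> P (Suc m)" using idE(3)[OF _ _ mem, of "single 0 (1 / c e)"] by simp
  interpret last: primeideal "P (Suc m)" ?R using prime by simp
  show False using last.one_imp_carrier last.I_notcarr \<open>1 \<in> P (Suc m)\<close> by simp
qed

text \<open>This is the ideal of the first i variables, and \<open>\<rho>\<close> in the proof sets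
  them to 0. The product of two reduced polynomials contains none of these variables, so it lies in
  Q only if it is 0, and there are no zero divisors.\<close>

lemma primeideal_low_vars:
  fixes i m :: nat
  defines "Q \<equiv> {f \<in> carrier (mpol_ring m :: 'a::idom mpol ring).
    \<forall>t \<in> keys f. keys t \<inter> {..<i} \<noteq> {}}"
  shows "primeideal Q (mpol_ring m)" (is "primeideal _ ?R")
proof (rule primeidealI)
  interpret R: cring ?R by (rule cring_mpol_ring)
  show "cring ?R" by (rule cring_mpol_ring)
  have add: "f + g \<in> Q" if "f \<in> Q" "g \<in> Q" for f g
    using that keys_add[of f g] unfolding Q_def by auto
  have mult: "f * g \<in> Q" if "f \<in> carrier ?R" "g \<in> Q" for f g
  proof -
    have "keys t \<inter> {..<i} \<noteq> {}" if "t \<in> keys (f * g)" for t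
    proof -
      obtain u v where "t = u + v" "v \<in> keys g" using \<open>t \<in> _\<close> keys_mult[of f g] by auto
      then show ?thesis using \<open>g \<in> Q\<close> by (auto simp: keys_add_nat Q_def)
    qed
    then show ?thesis using that by (auto simp: Q_def)
  qed
  show "ideal Q ?R"
  proof (rule idealI)
    show "ring ?R" by (rule R.ring_axioms)
    have neg: "- f \<in> Q" if "f \<in> Q" for f using mult[of "- 1" f] that by simp
    have "Q \<subseteq> carrier ?R" "0 \<in> Q" by (auto simp: Q_def)
    then show "subgroup Q (add_monoid ?R)"
      using neg by (intro R.add.subgroupI) (auto simp: add subset_eq simp flip: a_inv_def)
    show "x \<otimes>\<^bsub>?R\<^esub> a \<in> Q" "a \<otimes>\<^bsub>?R\<^esub> x \<in> Q" if "a \<in> Q" "x \<in> carrier ?R" for a x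
      using mult[OF that(2,1)] by (simp_all add: mult.commute)
  qed
  have "1 \<notin> Q" by (simp add: Q_def)
  then show "carrier ?R \<noteq> Q" using mpol_closed(2) by blast
  define \<rho> where "\<rho> f = (\<Sum>t \<in> {t \<in> keys f. keys t \<inter> {..<i} = {}}.
    single t (lookup f t))" for f :: "'a mpol"
  have lookup_\<rho>: "lookup (\<rho> f) t = (if keys t \<inter> {..<i} = {} then lookup f t else 0)" for f t
  proof -
    have "lookup (\<rho> f) t = (\<Sum>s \<in> {t \<in> keys f. keys t \<inter> {..<i} = {}}.
      if s = t then lookup f s else 0)"
      by (simp add: \<rho>_def lookup_sum lookup_single when_def)
    also have "\<dots> = (if keys t \<inter> {..<i} = {} then lookup f t else 0)"
      by (subst sum.delta) (auto simp: in_keys_iff)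
    finally show ?thesis .
  qed
  fix f g assume f: "f \<in> carrier ?R" and g: "g \<in> carrier ?R" and "f \<otimes>\<^bsub>?R\<^esub> g \<in> Q"
  then have fg: "f * g \<in> Q" by simp
  have diff: "h - \<rho> h \<in> Q" if "h \<in> carrier ?R" for h
    using that unfolding Q_def
    by (auto simp: mpol_carrier_iff in_keys_iff lookup_minus lookup_\<rho> split: if_splits)
  have \<rho>c: "\<rho> h \<in> carrier ?R" if "h \<in> carrier ?R" for h
    using that by (auto simp: mpol_carrier_iff in_keys_iff lookup_\<rho> split: if_splits)
  have minus: "a - b \<in> Q" if "a \<in> Q" "b \<in> Q" for a b
    using add[OF that(1) mult[of "- 1" b]] that(2) by simp
  have "\<rho> f * \<rho> g = f * g - (f * (g - \<rho> g) + \<rho> g * (f - \<rho> f))" by (simp add: algebra_simps)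
  also have "\<dots> \<in> Q" by (intro minus fg add mult diff f g \<rho>c)
  finally have Q: "\<rho> f * \<rho> g \<in> Q" .
  have "\<rho> f * \<rho> g = 0"
  proof (rule ccontr)
    assume "\<rho> f * \<rho> g \<noteq> 0"
    then obtain t where t: "t \<in> keys (\<rho> f * \<rho> g)" by (metis ex_in_conv keys_eq_empty)
    then obtain u v where "t = u + v" "u \<in> keys (\<rho> f)" "v \<in> keys (\<rho> g)"
      using keys_mult[of "\<rho> f" "\<rho> g"] by auto
    then have "keys t \<inter> {..<i} = {}"
      by (auto simp: keys_add_nat in_keys_iff lookup_\<rho> split: if_splits)
    then show False using Q t by (auto simp: Q_def)
  qed
  then have "\<rho> f = 0 \<or> \<rho> g = 0" by simp
  then show "f \<in> Q \<or> g \<in> Q" using diff[OF f] diff[OF g] by auto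
qed

lemma krull_dim_mpol_ring: "krull_dim (mpol_ring m :: 'a::{finite,field} mpol ring) = enat m"
proof -
  let ?R = "mpol_ring m :: 'a mpol ring"
  define Q where "Q i = {f \<in> carrier ?R. \<forall>t \<in> keys f. keys t \<inter> {..<i} \<noteq> {}}" for i
  have prime: "primeideal (Q i) ?R" for i unfolding Q_def by (rule primeideal_low_vars)
  have "Q i \<subset> Q (Suc i)" if "i < m" for i
  proof
    have "A \<inter> {..<Suc i} \<noteq> {}" if "A \<inter> {..<i} \<noteq> {}" for A :: "nat set"
      using that by (auto simp: less_Suc_eq)
    then show "Q i \<subseteq> Q (Suc i)" unfolding Q_def by (intro Collect_mono impI conjI ballI) simp_all
    have "mpol_var i \<in> Q (Suc i)" "mpol_var i \<notin> Q i" using that by (auto simp: Q_def mpol_var_def)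
    then show "Q i \<noteq> Q (Suc i)" by blast
  qed
  then have "\<exists>Q. (\<forall>i\<le>m. primeideal (Q i) ?R) \<and> (\<forall>i<m. Q i \<subset> Q (Suc i))" using prime by blast
  then have "enat m \<le> krull_dim ?R" unfolding krull_dim_def by (intro Sup_upper) blast
  moreover have "n \<le> m" if P: "\<forall>i\<le>n. primeideal (P i) ?R" "\<forall>i<n. P i \<subset> P (Suc i)" for P n
  proof (rule ccontr)
    assume "\<not> n \<le> m"
    then show False using no_long_prime_chain[of m P] P by auto
  qed
  then have "krull_dim ?R \<le> enat m"
    unfolding krull_dim_def by (intro Sup_least) auto
  ultimately show ?thesis by simp
qed

section \<open>Length and saturation\<close>

text \<open>The k-th power of the irrelevant ideal, in a form where membership is read off the
  monomials.\<close>

definition order_ge :: "nat \<Rightarrow> nat \<Rightarrow> 'a::comm_ring_1 mpol set" where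
  "order_ge m k = {f \<in> carrier (mpol_ring m). \<forall>t \<in> keys f. k \<le> total_deg t}"

lemma order_ge_mono: "k \<le> l \<Longrightarrow> order_ge m l \<subseteq> order_ge m k"
  by (auto simp: order_ge_def)

lemma order_ge_add: "f \<in> order_ge m k \<Longrightarrow> g \<in> order_ge m k \<Longrightarrow> f + g \<in> order_ge m k"
  using keys_add[of f g] by (auto simp: order_ge_def)

lemma order_ge_mult:
  assumes "f \<in> order_ge m k" "g \<in> order_ge m l" shows "f * g \<in> order_ge m (k + l)"
proof -
  have "k + l \<le> total_deg t" if "t \<in> keys (f * g)" for t
  proof -
    obtain a b where "t = a + b" "a \<in> keys f" "b \<in> keys g"
      using \<open>t \<in> _\<close> keys_mult[of f g] by auto
    then show ?thesis using assms by (auto simp: order_ge_def intro: add_mono)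
  qed
  then show ?thesis using assms by (auto simp: order_ge_def)
qed

lemma ideal_order_ge: "ideal (order_ge m k) (mpol_ring m :: 'a::comm_ring_1 mpol ring)"
proof (rule idealI)
  interpret R: cring "mpol_ring m :: 'a mpol ring" by (rule cring_mpol_ring)
  show "ring (mpol_ring m :: 'a mpol ring)" by (rule R.ring_axioms)
  have "- f \<in> order_ge m k" if "f \<in> order_ge m k" for f :: "'a mpol"
    using that by (auto simp: order_ge_def in_keys_iff)
  moreover have "0 \<in> order_ge m k" by (simp add: order_ge_def)
  moreover have "order_ge m k \<subseteq> carrier (mpol_ring m :: 'a mpol ring)" by (auto simp: order_ge_def)
  ultimately show "subgroup (order_ge m k) (add_monoid (mpol_ring m :: 'a mpol ring))"
    by (intro R.add.subgroupI) (auto simp: order_ge_add subset_eq simp flip: a_inv_def)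
  fix a x :: "'a mpol" assume a: "a \<in> order_ge m k" and x: "x \<in> carrier (mpol_ring m)"
  have "x \<in> order_ge m 0" using x by (simp add: order_ge_def)
  then have "x * a \<in> order_ge m k" using order_ge_mult[of x m 0 a k] a by simp
  then show "x \<otimes>\<^bsub>mpol_ring m\<^esub> a \<in> order_ge m k" "a \<otimes>\<^bsub>mpol_ring m\<^esub> x \<in> order_ge m k"
    by (simp_all add: mult.commute)
qed

section \<open>Ideals of the polynomial ring and powers of the irrelevant ideal\<close>

lemma mpol_in_of_monomials:
  fixes S :: "'a::comm_ring_1 mpol set"
  assumes "0 \<in> S" "\<And>f g. f \<in> S \<Longrightarrow> g \<in> S \<Longrightarrow> f + g \<in> S"
    and "\<And>t. t \<in> keys f \<Longrightarrow> single t (lookup f t) \<in> S"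
  shows "f \<in> S"
proof -
  have "(\<Sum>t \<in> A. single t (lookup f t)) \<in> S"
    if "finite A" "A \<subseteq> keys f" for A
    using that by (induction A) (auto intro: assms)
  from this[of "keys f"] show ?thesis by (simp add: poly_mapping_sum_singles)
qed

lemma ideal_mpolE:
  fixes J :: "'a::comm_ring_1 mpol set"
  assumes "ideal J (mpol_ring m)"
  shows "0 \<in> J" "f \<in> J \<Longrightarrow> g \<in> J \<Longrightarrow> f + g \<in> J" "f \<in> J \<Longrightarrow> g \<in> J \<Longrightarrow> f - g \<in> J"
    "a \<in> carrier (mpol_ring m) \<Longrightarrow> f \<in> J \<Longrightarrow> a * f \<in> J" "J \<subseteq> carrier (mpol_ring m)"
proof -
  interpret ideal J "mpol_ring m" by fact
  show "0 \<in> J" using additive_subgroup.zero_closed[OF is_additive_subgroup] by simp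
  show add: "f \<in> J \<Longrightarrow> g \<in> J \<Longrightarrow> f + g \<in> J" for f g using additive_subgroup.a_closed[OF is_additive_subgroup, of f g] by simp
  show mult: "a \<in> carrier (mpol_ring m) \<Longrightarrow> f \<in> J \<Longrightarrow> a * f \<in> J" for a f using I_l_closed[of f a] by simp
  show "J \<subseteq> carrier (mpol_ring m)" by (rule a_subset)
  show "f - g \<in> J" if "f \<in> J" "g \<in> J"
    using add[OF that(1) mult[of "- 1" g]] that(2) by simp
qed

lemma irrelevant_ideal_eq: "irrelevant_ideal m = (order_ge m 1 :: 'a::comm_ring_1 mpol set)"
proof
  interpret R: cring "mpol_ring m :: 'a mpol ring" by (rule cring_mpol_ring)
  have vars: "mpol_var ` {..<m} \<subseteq> carrier (mpol_ring m :: 'a mpol ring)" by auto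
  show "irrelevant_ideal m \<subseteq> (order_ge m 1 :: 'a mpol set)"
    unfolding irrelevant_ideal_def
    by (intro R.genideal_minimal ideal_order_ge) (auto simp: order_ge_def mpol_var_def)
  have J: "ideal (irrelevant_ideal m) (mpol_ring m :: 'a mpol ring)"
    unfolding irrelevant_ideal_def by (rule R.genideal_ideal[OF vars])
  note JE = ideal_mpolE[OF J]
  show "(order_ge m 1 :: 'a mpol set) \<subseteq> irrelevant_ideal m"
  proof
    fix f :: "'a mpol" assume f: "f \<in> order_ge m 1"
    show "f \<in> irrelevant_ideal m"
    proof (rule mpol_in_of_monomials)
      fix t assume t: "t \<in> keys f"
      have "t \<noteq> 0" and tm: "keys t \<subseteq> {..<m}" using t f by (auto simp: order_ge_def mpol_carrier_iff)
      then obtain i where i: "i \<in> keys t" using keys_eq_empty_nat[of t] by blast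
      then obtain u where u: "t = single i 1 + u" by (rule monomial_split_var)
      have "mpol_var i \<in> (irrelevant_ideal m :: 'a mpol set)"
        unfolding irrelevant_ideal_def using R.genideal_self[OF vars] i tm by auto
      then have "single u (lookup f t) * mpol_var i \<in> irrelevant_ideal m"
        using tm u by (intro JE(4)) (auto simp: keys_add_nat)
      then show "single t (lookup f t) \<in> irrelevant_ideal m"
        by (simp add: mpol_var_def mult_single u add.commute)
    qed (auto simp: JE)
  qed
qed

lemma irrelevant_ideal_power:
  "irrelevant_ideal m [^]\<^bsub>ideals_set (mpol_ring m :: 'a::comm_ring_1 mpol ring)\<^esub> k = order_ge m (k::nat)"
proof (induction k)
  case 0
  show ?case by (auto simp: ideals_set_def order_ge_def)
next
  case (Suc k)
  let ?R = "mpol_ring m :: 'a mpol ring"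
  interpret R: cring ?R by (rule cring_mpol_ring)
  have "irrelevant_ideal m [^]\<^bsub>ideals_set ?R\<^esub> Suc k = order_ge m k \<cdot>\<^bsub>?R\<^esub> order_ge m 1"
    using Suc by (simp add: ideals_set_def irrelevant_ideal_eq)
  also have "\<dots> = order_ge m (Suc k)"
  proof
    show "order_ge m k \<cdot>\<^bsub>?R\<^esub> order_ge m 1 \<subseteq> order_ge m (Suc k)"
    proof
      fix f assume "f \<in> order_ge m k \<cdot>\<^bsub>?R\<^esub> order_ge m 1"
      then show "f \<in> order_ge m (Suc k)"
        using order_ge_mult[of _ m k _ 1] by induction (auto simp: order_ge_add)
    qed
    show "order_ge m (Suc k) \<subseteq> order_ge m k \<cdot>\<^bsub>?R\<^esub> order_ge m 1"
    proof
      fix f :: "'a mpol" assume f: "f \<in> order_ge m (Suc k)"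
      have "ideal (order_ge m k \<cdot>\<^bsub>?R\<^esub> order_ge m 1) ?R"
        by (intro R.ideal_prod_is_ideal ideal_order_ge)
      note JE = ideal_mpolE[OF this]
      show "f \<in> order_ge m k \<cdot>\<^bsub>?R\<^esub> order_ge m 1"
      proof (rule mpol_in_of_monomials[OF JE(1,2)])
        fix t assume t: "t \<in> keys f"
        have td: "Suc k \<le> total_deg t" and tm: "keys t \<subseteq> {..<m}"
          using t f by (auto simp: order_ge_def mpol_carrier_iff)
        then have "t \<noteq> 0" by auto
        then obtain i where i: "i \<in> keys t" using keys_eq_empty_nat[of t] by blast
        then obtain u where u: "t = single i 1 + u" by (rule monomial_split_var)
        have "single u (lookup f t) \<in> order_ge m k" "mpol_var i \<in> (order_ge m 1 :: 'a mpol set)"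
          using td tm u by (auto simp: order_ge_def keys_add_nat mpol_var_def)
        then have "single u (lookup f t) \<otimes>\<^bsub>?R\<^esub> mpol_var i \<in> order_ge m k \<cdot>\<^bsub>?R\<^esub> order_ge m 1"
          by (rule ideal_prod.prod)
        then show "single t (lookup f t) \<in> order_ge m k \<cdot>\<^bsub>?R\<^esub> order_ge m 1"
          by (simp add: mpol_var_def mult_single u add.commute)
      qed
    qed
  qed
  finally show ?case .
qed

text \<open>N' consists of the sums of elements of N and scalar multiples of x. It is a submodule
  because the variables send x into N. Distinct scalars give distinct cosets of N since a nonzero
  scalar is invertible, hence the factor p.\<close>

lemma add_scalar_submodule:
  fixes M :: "('p::prime_card mod_ring mpol, 'b) module"
  assumes M: "module (mpol_ring m) M" and fin: "finite (carrier M)"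
    and N: "submodule N (mpol_ring m) M" and x: "x \<in> carrier M" "x \<notin> N"
    and soc: "\<And>i. i < m \<Longrightarrow> mpol_var i \<odot>\<^bsub>M\<^esub> x \<in> N"
  shows "\<exists>N'. submodule N' (mpol_ring m) M \<and> N \<subset> N' \<and> card N' = CARD('p) * card N"
proof -
  let ?R = "mpol_ring m :: 'p mod_ring mpol ring"
  interpret module ?R M by (rule M)
  note NE = submoduleE[OF N] and N0 = submodule_zero[OF N]
  define g where "g = (\<lambda>(n, c). n \<oplus>\<^bsub>M\<^esub> const c \<odot>\<^bsub>M\<^esub> x)"
  define N' where "N' = g ` (N \<times> (UNIV :: 'p mod_ring set))"
  have cx: "const c \<odot>\<^bsub>M\<^esub> x \<in> carrier M" for c using x by simp
  have Nc: "n \<in> carrier M" if "n \<in> N" for n using that NE(1) by auto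
  have gI: "n \<oplus>\<^bsub>M\<^esub> const c \<odot>\<^bsub>M\<^esub> x \<in> N'" if "n \<in> N" for n c
    using that unfolding N'_def g_def by (intro image_eqI[of _ _ "(n, c)"]) auto
  have "submodule N' ?R M"
  proof (rule submodule_mpol_ringI[OF M])
    show "N' \<subseteq> carrier M" using Nc cx by (auto simp: N'_def g_def)
    show "\<zero>\<^bsub>M\<^esub> \<in> N'" using gI[OF N0, of 0] smult_l_null[OF x(1)] by simp
  next
    fix y assume "y \<in> N'"
    then obtain n c where y: "n \<in> N" "y = n \<oplus>\<^bsub>M\<^esub> const c \<odot>\<^bsub>M\<^esub> x" by (auto simp: N'_def g_def)
    have "\<ominus>\<^bsub>M\<^esub> y = \<ominus>\<^bsub>M\<^esub> n \<oplus>\<^bsub>M\<^esub> const (- c) \<odot>\<^bsub>M\<^esub> x"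
      using y Nc x smult_l_minus[of "const c" x] by (simp add: M.minus_add single_uminus)
    then show "\<ominus>\<^bsub>M\<^esub> y \<in> N'" using gI NE(3) y by simp
    fix i assume i: "i < m"
    have "mpol_var i \<odot>\<^bsub>M\<^esub> (const c \<odot>\<^bsub>M\<^esub> x) = const c \<odot>\<^bsub>M\<^esub> (mpol_var i \<odot>\<^bsub>M\<^esub> x)"
      using smult_assoc1[of "mpol_var i" "const c" x] smult_assoc1[of "const c" "mpol_var i" x] i x
      by (simp add: mult.commute)
    also have "\<dots> \<in> N" using soc[OF i] NE(4) by simp
    finally have "mpol_var i \<odot>\<^bsub>M\<^esub> n \<oplus>\<^bsub>M\<^esub> mpol_var i \<odot>\<^bsub>M\<^esub> (const c \<odot>\<^bsub>M\<^esub> x) \<in> N"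
      using NE(4)[of "mpol_var i" n] NE(5) y i by simp
    then have "mpol_var i \<odot>\<^bsub>M\<^esub> y \<in> N"
      using y Nc cx i by (simp add: smult_r_distr)
    moreover have "z \<in> N'" if "z \<in> N" for z using gI[OF that, of 0] smult_l_null[OF x(1)] Nc[OF that] by simp
    ultimately show "mpol_var i \<odot>\<^bsub>M\<^esub> y \<in> N'" by blast
  next
    fix y z assume "y \<in> N'" "z \<in> N'"
    then obtain n c n' c' where y: "n \<in> N" "y = n \<oplus>\<^bsub>M\<^esub> const c \<odot>\<^bsub>M\<^esub> x"
      and z: "n' \<in> N" "z = n' \<oplus>\<^bsub>M\<^esub> const c' \<odot>\<^bsub>M\<^esub> x" by (auto simp: N'_def g_def)
    have "const (c + c') \<odot>\<^bsub>M\<^esub> x = const c \<odot>\<^bsub>M\<^esub> x \<oplus>\<^bsub>M\<^esub> const c' \<odot>\<^bsub>M\<^esub> x"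
      using smult_l_distr[of "const c" "const c'" x] x by (simp add: single_add)
    then have "y \<oplus>\<^bsub>M\<^esub> z = (n \<oplus>\<^bsub>M\<^esub> n') \<oplus>\<^bsub>M\<^esub> const (c + c') \<odot>\<^bsub>M\<^esub> x"
      using y z Nc cx by (simp add: M.a_ac)
    then show "y \<oplus>\<^bsub>M\<^esub> z \<in> N'" using gI NE(5) y z by simp
  qed
  moreover have "inj_on g (N \<times> UNIV)"
  proof (rule inj_onI, clarify)
    fix n c n' c' assume n: "n \<in> N" "n' \<in> N" and eq: "g (n, c) = g (n', c')"
    have "const c \<odot>\<^bsub>M\<^esub> x \<oplus>\<^bsub>M\<^esub> n = const c' \<odot>\<^bsub>M\<^esub> x \<oplus>\<^bsub>M\<^esub> n'"
      using eq n Nc cx by (simp add: g_def M.a_comm)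
    then have "const c \<odot>\<^bsub>M\<^esub> x \<ominus>\<^bsub>M\<^esub> const c' \<odot>\<^bsub>M\<^esub> x = n' \<ominus>\<^bsub>M\<^esub> n"
      using n Nc cx by (intro M.add_eq_add_imp_minus_eq_minus) auto
    moreover have "const (c - c') \<odot>\<^bsub>M\<^esub> x = const c \<odot>\<^bsub>M\<^esub> x \<ominus>\<^bsub>M\<^esub> const c' \<odot>\<^bsub>M\<^esub> x"
      using smult_l_distr[of "const c" "const (- c')" x] smult_l_minus[of "const c'" x] x
      by (simp add: M.minus_eq single_diff single_uminus)
    ultimately have mem: "const (c - c') \<odot>\<^bsub>M\<^esub> x \<in> N" using submodule_minus[OF N n(2,1)] by simp
    have "c = c'"
    proof (rule ccontr)
      assume "c \<noteq> c'"
      then have "const (1 / (c - c')) * const (c - c') = (1 :: 'p mod_ring mpol)" by (simp add: mult_single)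
      moreover have "const (1 / (c - c')) \<odot>\<^bsub>M\<^esub> (const (c - c') \<odot>\<^bsub>M\<^esub> x) \<in> N" using mem NE(4) by simp
      ultimately have "x \<in> N"
        using smult_assoc1[of "const (1 / (c - c'))" "const (c - c')" x] smult_one[OF x(1)] x(1) by simp
      then show False using x(2) by simp
    qed
    moreover have "n = n'"
      using eq n Nc cx \<open>c = c'\<close> by (simp add: g_def)
    ultimately show "n = n' \<and> c = c'" by simp
  qed
  then have "card N' = card N * card (UNIV :: 'p mod_ring set)"
    unfolding N'_def by (simp add: card_image card_cartesian_product)
  moreover have "N \<subseteq> N'"
  proof
    fix z assume "z \<in> N"
    then show "z \<in> N'" using gI[of z 0] smult_l_null[OF x(1)] Nc by simp
  qed
  moreover have "x \<in> N'" using gI[OF N0, of 1] smult_one[OF x(1)] x(1) by simp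
  ultimately show ?thesis using x(2) by (intro exI[of _ N']) (auto simp: mult.commute)
qed

text \<open>Take the least k for which the k-th power of the irrelevant ideal sends y into N. It is
  positive, and some element of the previous power sends y to a socle element modulo N.\<close>

lemma exists_socle_element:
  fixes M :: "('a::comm_ring_1 mpol, 'b) module"
  assumes M: "module (mpol_ring m) M" and N: "submodule N (mpol_ring m) M"
    and nil: "\<And>x. x \<in> carrier M \<Longrightarrow> \<exists>k. \<forall>a \<in> order_ge m k. a \<odot>\<^bsub>M\<^esub> x = \<zero>\<^bsub>M\<^esub>"
    and y: "y \<in> carrier M" "y \<notin> N"
  shows "\<exists>x \<in> carrier M - N. \<forall>i<m. mpol_var i \<odot>\<^bsub>M\<^esub> x \<in> N"
proof -
  interpret module "mpol_ring m" M by (rule M)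
  define Q where "Q k \<longleftrightarrow> (\<forall>a \<in> order_ge m k. a \<odot>\<^bsub>M\<^esub> y \<in> N)" for k
  obtain k where "Q k" using nil[OF y(1)] submodule_zero[OF N] by (auto simp: Q_def) (metis)
  then have Q: "Q (LEAST k. Q k)" by (rule LeastI)
  have "\<not> Q 0"
    using y smult_one[OF y(1)] by (auto simp: Q_def order_ge_def intro!: bexI[of _ 1])
  then obtain k where k: "(LEAST k. Q k) = Suc k" using Q by (cases "LEAST k. Q k") auto
  then have "\<not> Q k" using not_less_Least[of k Q] by simp
  then obtain a where a: "a \<in> order_ge m k" "a \<odot>\<^bsub>M\<^esub> y \<notin> N" by (auto simp: Q_def)
  have ac: "a \<in> carrier (mpol_ring m)" using a by (simp add: order_ge_def)
  have "mpol_var i \<odot>\<^bsub>M\<^esub> (a \<odot>\<^bsub>M\<^esub> y) \<in> N" if "i < m" for i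
  proof -
    have "mpol_var i \<in> (order_ge m 1 :: 'a mpol set)" using that by (auto simp: order_ge_def mpol_var_def)
    then have "mpol_var i * a \<in> order_ge m (Suc k)" using order_ge_mult[of _ m 1 a k] a by simp
    then have "(mpol_var i * a) \<odot>\<^bsub>M\<^esub> y \<in> N" using Q k by (simp add: Q_def)
    then show ?thesis using smult_assoc1[of "mpol_var i" a y] that ac y by simp
  qed
  then show ?thesis using a ac y by (intro bexI[of _ "a \<odot>\<^bsub>M\<^esub> y"]) auto
qed

text \<open>Since the residue field is the finite field with \<open>p\<close> elements, length is the logarithm to
  base \<open>p\<close> of the cardinality.\<close>

lemma module_length_card:
  fixes M :: "('p::prime_card mod_ring mpol, 'b) module"
  assumes M: "module (mpol_ring m) M" and fin: "finite (carrier M)"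
    and nil: "\<And>x. x \<in> carrier M \<Longrightarrow> \<exists>k. \<forall>a \<in> order_ge m k. a \<odot>\<^bsub>M\<^esub> x = \<zero>\<^bsub>M\<^esub>"
  shows "\<exists>l. card (carrier M) = CARD('p) ^ l \<and> module_length (mpol_ring m) M = enat l"
proof -
  let ?R = "mpol_ring m :: 'p mod_ring mpol ring"
  interpret module ?R M by (rule M)
  have p: "Factorial_Ring.prime CARD('p)" by (rule prime_card)
  then have p2: "CARD('p) \<ge> 2" by (rule prime_ge_2_nat)
  define chain where "chain i N \<longleftrightarrow> (\<forall>j\<le>i. submodule (N j) ?R M) \<and> (\<forall>j<i. N j \<subset> N (Suc j))"
    for i :: nat and N :: "nat \<Rightarrow> 'b set"
  have sub_card: "N \<subseteq> carrier M" "finite N" "card N > 0" if "submodule N ?R M" for N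
    using submoduleE(1,2)[OF that] fin finite_subset by (auto simp: card_gt_0_iff)
  \<comment> \<open>Lengths i of chains whose last member has p^i elements. The longest such chain
    reaches M, since otherwise a socle element would extend it.\<close>
  define S where "S = {i. \<exists>N. chain i N \<and> card (N i) = CARD('p) ^ i}"
  have bound: "i \<le> card (carrier M)" if "i \<in> S" for i
  proof -
    obtain N where N: "chain i N" "card (N i) = CARD('p) ^ i" using \<open>i \<in> S\<close> by (auto simp: S_def)
    have "i < 2 ^ i" by (rule less_exp)
    also have "(2::nat) ^ i \<le> card (N i)" using p2 N(2) by (simp add: power_mono)
    also have "\<dots> \<le> card (carrier M)" using N(1) sub_card fin by (intro card_mono) (auto simp: chain_def)
    finally show ?thesis by simp
  qed
  have "{\<zero>\<^bsub>M\<^esub>} = seq_mult (\<lambda>_. \<zero>\<^bsub>?R\<^esub>) M 0 (carrier M)" by simp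
  then have zsub: "submodule {\<zero>\<^bsub>M\<^esub>} ?R M"
    using seq_mult_submodule[OF carrier_is_submodule, of 0] by auto
  then have "0 \<in> S"
    unfolding S_def chain_def by (auto intro!: exI[of _ "\<lambda>_. {\<zero>\<^bsub>M\<^esub>}"])
  moreover have "finite S" using bound by (intro finite_subset[of S "{..card (carrier M)}"]) auto
  ultimately have "Max S \<in> S" and max: "\<And>i. i \<in> S \<Longrightarrow> i \<le> Max S" by (auto intro: Max_in)
  then obtain N where N: "chain (Max S) N" "card (N (Max S)) = CARD('p) ^ Max S" by (auto simp: S_def)
  define l where "l = Max S"
  have Nl: "submodule (N l) ?R M" using N by (simp add: chain_def l_def)
  have top: "N l = carrier M"
  proof (rule ccontr)
    assume "N l \<noteq> carrier M"
    then obtain y where "y \<in> carrier M" "y \<notin> N l" using sub_card(1)[OF Nl] by blast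
    then obtain x where x: "x \<in> carrier M" "x \<notin> N l" "\<And>i. i < m \<Longrightarrow> mpol_var i \<odot>\<^bsub>M\<^esub> x \<in> N l"
      using exists_socle_element[OF M Nl nil] by blast
    obtain N' where N': "submodule N' ?R M" "N l \<subset> N'" "card N' = CARD('p) * card (N l)"
      using add_scalar_submodule[OF M fin Nl x] by blast
    have "chain (Suc l) (N(Suc l := N'))" using N(1) N' by (auto simp: chain_def l_def less_Suc_eq le_Suc_eq)
    moreover have "card ((N(Suc l := N')) (Suc l)) = CARD('p) ^ Suc l" using N(2) N' by (simp add: l_def)
    ultimately have "Suc l \<in> S" unfolding S_def by blast
    then show False using max[of "Suc l"] by (simp add: l_def)
  qed
  then have card: "card (carrier M) = CARD('p) ^ l" using N(2) by (simp add: l_def)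
  \<comment> \<open>By Lagrange's theorem the members of a chain have powers of p as cardinalities,
    so every strict inclusion costs at least a factor p.\<close>
  have upper: "n \<le> l" if "chain n N" for n N
  proof -
    have pow: "\<exists>a. card (N j) = CARD('p) ^ a" if "j \<le> n" for j
    proof -
      have "subgroup (N j) (add_monoid M)" using \<open>chain n N\<close> that by (simp add: chain_def submodule_def)
      then have "card (N j) dvd card (carrier M)"
        using group.lagrange[OF M.a_group, of "N j"] unfolding Coset.order_def
        by simp (metis dvd_triv_right)
      then show ?thesis using divides_primepow_nat[OF p] by (auto simp: card)
    qed
    have "CARD('p) ^ j \<le> card (N j)" if "j \<le> n" for j
      using that
    proof (induction j)
      case 0
      then show ?case using sub_card(3)[of "N 0"] \<open>chain n N\<close> by (simp add: chain_def Suc_le_eq)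
    next
      case (Suc j)
      obtain a b where a: "card (N j) = CARD('p) ^ a" and b: "card (N (Suc j)) = CARD('p) ^ b"
        using pow[of j] pow[of "Suc j"] Suc.prems by auto
      have "card (N j) < card (N (Suc j))"
        using \<open>chain n N\<close> Suc.prems sub_card(2)[of "N (Suc j)"] by (intro psubset_card_mono) (auto simp: chain_def)
      moreover have "CARD('p) ^ j \<le> card (N j)" using Suc by simp
      ultimately have "j \<le> a" "a < b" using p2 by (auto simp: a b)
      then show ?case using p2 by (simp add: b power_increasing_iff del: power_Suc)
    qed
    then have "CARD('p) ^ n \<le> card (N n)" by simp
    also have "\<dots> \<le> card (carrier M)" using that sub_card fin by (intro card_mono) (auto simp: chain_def)
    finally show ?thesis using p2 by (simp add: card)
  qed
  have "module_length ?R M = Sup {enat n | n. \<exists>N. chain n N}"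
    by (simp add: module_length_def chain_def)
  also have "\<dots> = enat l"
    using N(1) upper by (intro antisym Sup_least Sup_upper) (auto simp: l_def)
  finally show ?thesis using card by blast
qed

section \<open>Saturation of graded ideals\<close>

definition saturation :: "nat \<Rightarrow> 'a::comm_ring_1 mpol set \<Rightarrow> 'a mpol set" where
  "saturation m J = {r \<in> carrier (mpol_ring m). \<exists>k. \<forall>a \<in> order_ge m k. a * r \<in> J}"

lemma ideal_saturation:
  fixes J :: "'p::prime_card mod_ring mpol set"
  assumes "ideal J (mpol_ring m)"
  shows "ideal (saturation m J) (mpol_ring m)"
proof (rule idealI)
  note JE = ideal_mpolE[OF assms]
  interpret R: cring "mpol_ring m :: 'p mod_ring mpol ring" by (rule cring_mpol_ring)
  show "ring (mpol_ring m :: 'p mod_ring mpol ring)" by (rule R.ring_axioms)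
  have mult: "x * r \<in> saturation m J" if x: "x \<in> carrier (mpol_ring m)" and r: "r \<in> saturation m J" for x r
  proof -
    obtain k where k: "\<forall>a \<in> order_ge m k. a * r \<in> J" using r by (auto simp: saturation_def)
    have "a * (x * r) \<in> J" if a: "a \<in> order_ge m k" for a
      using JE(4)[OF x, of "a * r"] k a by (simp add: mult.left_commute)
    then show ?thesis using x r by (auto simp: saturation_def)
  qed
  have add: "r + s \<in> saturation m J" if r: "r \<in> saturation m J" and s: "s \<in> saturation m J" for r s
  proof -
    obtain k l where k: "\<forall>a \<in> order_ge m k. a * r \<in> J" and l: "\<forall>a \<in> order_ge m l. a * s \<in> J"
      using r s by (auto simp: saturation_def)
    have "a * (r + s) \<in> J" if "a \<in> order_ge m (max k l)" for a
      using that k l JE(2)[of "a * r" "a * s"] order_ge_mono[of k "max k l" m] order_ge_mono[of l "max k l" m]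
      by (auto simp: distrib_left)
    then show ?thesis using r s by (auto simp: saturation_def)
  qed
  have "0 \<in> saturation m J" using JE(1) by (auto simp: saturation_def)
  moreover have "- r \<in> saturation m J" if "r \<in> saturation m J" for r
    using mult[of "- 1" r] that by simp
  moreover have "saturation m J \<subseteq> carrier (mpol_ring m)" by (auto simp: saturation_def)
  ultimately show "subgroup (saturation m J) (add_monoid (mpol_ring m))"
    by (intro R.add.subgroupI) (auto simp: add subset_eq simp flip: a_inv_def)
  fix a x assume "a \<in> saturation m J" "x \<in> carrier (mpol_ring m :: 'p mod_ring mpol ring)"
  then show "x \<otimes>\<^bsub>mpol_ring m\<^esub> a \<in> saturation m J" "a \<otimes>\<^bsub>mpol_ring m\<^esub> x \<in> saturation m J"
    using mult[of x a] by (simp_all add: mult.commute)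
qed

lemma hom_component_single_mult:
  "hom_component (total_deg t + d) (single t c * f) = single t c * hom_component d f"
proof (rule poly_mapping_eqI)
  fix u
  show "lookup (hom_component (total_deg t + d) (single t c * f)) u =
    lookup (single t c * hom_component d f) u"
  proof (cases "\<exists>v. u = t + v")
    case False then show ?thesis by (simp add: lookup_single_mult_eq_0)
  qed auto
qed

text \<open>Multiplication by a single term only shifts degrees, so it carries components of f to
  components of the product. It suffices to test with such terms, since every multiplier is a sum of
  them.\<close>

lemma graded_ideal_saturation:
  fixes I :: "'p::prime_card mod_ring mpol set"
  assumes I: "graded_ideal m I"
  shows "graded_ideal m (saturation m I)"
  unfolding graded_ideal_def
proof (intro conjI ballI allI)
  have ideal: "ideal I (mpol_ring m)" using I by (simp add: graded_ideal_def)
  note IE = ideal_mpolE[OF ideal]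
  show "ideal (saturation m I) (mpol_ring m)" by (rule ideal_saturation[OF ideal])
  fix f d assume f: "f \<in> saturation m I"
  then obtain k where k: "\<And>a. a \<in> order_ge m k \<Longrightarrow> a * f \<in> I" by (auto simp: saturation_def)
  have "a * hom_component d f \<in> I" if a: "a \<in> order_ge m k" for a
  proof -
    have "a \<in> {a. a * hom_component d f \<in> I}"
    proof (rule mpol_in_of_monomials)
      fix t assume "t \<in> keys a"
      then have "single t (lookup a t) * f \<in> I"
        using a by (intro k) (auto simp: order_ge_def mpol_carrier_iff)
      then have "hom_component (total_deg t + d) (single t (lookup a t) * f) \<in> I"
        using I by (simp add: graded_ideal_def)
      then show "single t (lookup a t) \<in> {a. a * hom_component d f \<in> I}"
        by (simp add: hom_component_single_mult)
    qed (auto simp: IE distrib_right)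
    then show ?thesis by simp
  qed
  then show "hom_component d f \<in> saturation m I" using f by (auto simp: saturation_def)
qed

text \<open>Dickson's lemma for functions that vary only on V. An element not above a fixed s lies
  in one of finitely many slices, where some coordinate has a fixed value below that of s; each
  slice varies on fewer coordinates.\<close>

lemma dickson:
  fixes S :: "('i \<Rightarrow> nat) set"
  assumes "finite V" "\<And>s t i. s \<in> S \<Longrightarrow> t \<in> S \<Longrightarrow> i \<notin> V \<Longrightarrow> s i = t i"
  shows "\<exists>F \<subseteq> S. finite F \<and> (\<forall>t \<in> S. \<exists>u \<in> F. u \<le> t)"
  using assms
proof (induction V arbitrary: S rule: finite_psubset_induct)
  case (psubset V)
  show ?case
  proof (cases "S = {}")
    case False
    then obtain s where s: "s \<in> S" by auto
    define C where "C i c = {t \<in> S. t i = c}" for i c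
    have "\<exists>F \<subseteq> C i c. finite F \<and> (\<forall>t \<in> C i c. \<exists>u \<in> F. u \<le> t)" if "i \<in> V" for i c
      using that psubset.prems by (intro psubset.IH[of "V - {i}"]) (auto simp: C_def)
    then obtain F where F: "\<And>i c. i \<in> V \<Longrightarrow> F i c \<subseteq> C i c" "\<And>i c. i \<in> V \<Longrightarrow> finite (F i c)"
      "\<And>i c t. i \<in> V \<Longrightarrow> t \<in> C i c \<Longrightarrow> \<exists>u \<in> F i c. u \<le> t"
      by metis
    let ?F = "insert s (\<Union>i\<in>V. \<Union>c<s i. F i c)"
    have "\<exists>u \<in> ?F. u \<le> t" if t: "t \<in> S" for t
    proof (cases "s \<le> t")
      case False
      then obtain i where i: "t i < s i" by (auto simp: le_fun_def not_le)
      then have "i \<in> V" using psubset.prems[OF s t, of i] by auto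
      then show ?thesis using F(3)[of i t "t i"] i t by (fastforce simp: C_def)
    qed auto
    moreover have "?F \<subseteq> S" using s F(1) by (fastforce simp: C_def)
    moreover have "finite ?F" using F(2) psubset.hyps by auto
    ultimately show ?thesis by blast
  qed auto
qed

text \<open>The order on monomials is the lexicographic one from the library; being linear and compatible with
  addition, it admits leading monomials.\<close>

lemma graded_ideal_generated_in_low_degree:
  fixes T :: "'a::field mpol set"
  assumes T: "graded_ideal m T"
  shows "\<exists>D. \<forall>d\<ge>D. \<forall>f\<in>T. (\<forall>t \<in> keys f. total_deg t = Suc d) \<longrightarrow>
    (\<exists>g. (\<forall>i<m. g i \<in> T \<and> (\<forall>t \<in> keys (g i). total_deg t = d)) \<and> f = (\<Sum>i<m. mpol_var i * g i))"
proof -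
  have ideal: "ideal T (mpol_ring m)" using T by (simp add: graded_ideal_def)
  note TE = ideal_mpolE[OF ideal]
  define LM where "LM f = Max (keys f)" for f :: "'a mpol"
  have LM: "LM f \<in> keys f" "\<And>t. t \<in> keys f \<Longrightarrow> t \<le> LM f" if "f \<noteq> 0" for f
    using that Max_in[of "keys f"] by (auto simp: LM_def)
  \<comment> \<open>Leading exponents of homogeneous elements only, so that reducing a homogeneous
    element keeps it homogeneous.\<close>
  define L where "L = {lookup (LM f) | f. f \<in> T \<and> f \<noteq> 0 \<and> (\<exists>d. \<forall>t \<in> keys f. total_deg t = d)}"
  have keys_LM: "keys (LM f) \<subseteq> {..<m}" if "f \<in> T" "f \<noteq> 0" for f
    using LM(1)[OF that(2)] TE(5) that(1) unfolding subset_eq mpol_carrier_iff by blast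
  have L0: "s i = 0" if "s \<in> L" "i \<notin> {..<m}" for s i
    using that keys_LM by (auto simp: L_def) (metis in_keys_iff lessThan_iff subsetD)
  have "s i = t i" if "s \<in> L" "t \<in> L" "i \<notin> {..<m}" for s t i
    using L0[OF that(1,3)] L0[OF that(2,3)] by simp
  then obtain F where F: "F \<subseteq> L" "finite F" "\<And>t. t \<in> L \<Longrightarrow> \<exists>u \<in> F. u \<le> t"
    using dickson[of "{..<m}" L] by auto
  define D where "D = Max (insert 0 ((\<lambda>u. \<Sum>i<m. u i) ` F))"
  have D: "(\<Sum>i<m. u i) \<le> D" if "u \<in> F" for u unfolding D_def using F(2) that by (intro Max_ge) auto
  show ?thesis
  proof (intro exI[of _ D] allI impI ballI)
    fix d f assume d: "D \<le> d" and "f \<in> T" "\<forall>t \<in> keys f. total_deg t = Suc d"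
    then show "\<exists>g. (\<forall>i<m. g i \<in> T \<and> (\<forall>t \<in> keys (g i). total_deg t = d)) \<and> f = (\<Sum>i<m. mpol_var i * g i)"
    \<comment> \<open>Each reduction lowers the leading monomial, and only finitely many monomials
      of bounded degree lie below it.\<close>
    proof (induction "card {t. keys t \<subseteq> {..<m} \<and> total_deg t \<le> Suc d \<and> t < LM f}" arbitrary: f rule: less_induct)
      case less
      show ?case
      proof (cases "f = 0")
        case True
        then show ?thesis using TE(1) by (intro exI[of _ "\<lambda>_. 0"]) auto
      next
        case False
        define t where "t = LM f"
        have t: "t \<in> keys f" "total_deg t = Suc d" "keys t \<subseteq> {..<m}"
          using LM(1)[OF False] less.prems keys_LM[OF _ False] by (auto simp: t_def)
        have "lookup t \<in> L" using less.prems False by (auto simp: L_def t_def)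
        then obtain h e where h: "h \<in> T" "h \<noteq> 0" "\<forall>s \<in> keys h. total_deg s = e"
          and ht: "lookup (LM h) \<le> lookup t" and hF: "lookup (LM h) \<in> F"
          using F(3)[of "lookup t"] F(1) unfolding L_def by blast
        define u where "u = LM h"
        have u: "u \<in> keys h" using LM(1)[OF h(2)] by (simp add: u_def)
        have "total_deg u = (\<Sum>i<m. lookup u i)"
          using keys_LM[OF h(1,2)] by (intro total_deg_eq) (auto simp: u_def)
        \<comment> \<open>Above degree D the divisor u of t is proper, which leaves a variable i to
          split off from the quotient.\<close>
        then have "total_deg u < total_deg t" using D[OF hF] d t(2) by (simp add: u_def)
        then have "u \<noteq> t" by auto
        then obtain i where i: "lookup u i \<noteq> lookup t i" by (meson poly_mapping_eqI)
        then have ui: "lookup u i < lookup t i"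
          using ht by (simp add: u_def le_fun_def le_neq_implies_less)
        then have im: "i < m" using t(3) by (auto simp: in_keys_iff subset_eq)
        define v where "v = t - u - single i 1"
        have tv: "t = single i 1 + (v + u)"
          using ht ui by (intro poly_mapping_eqI)
            (auto simp: v_def lookup_add lookup_minus lookup_single when_def u_def le_fun_def)
        have deg: "total_deg v + e = d" using t(2) h(3) u unfolding tv by auto
        \<comment> \<open>With this coefficient the leading terms of f and of
          \<open>mpol_var i * k\<close> cancel.\<close>
        define c where "c = lookup f t / lookup h u"
        define k where "k = single v c * h"
        have kT: "k \<in> T" unfolding k_def using h(1) t(3) by (intro TE(4)) (auto simp: tv keys_add_nat)
        have "\<exists>s \<in> keys h. x = v + s" if "x \<in> keys k" for x
          using that keys_mult[of "single v c" h] by (auto simp: k_def split: if_splits)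
        then have keys_k: "total_deg x = d \<and> x \<le> v + u" if "x \<in> keys k" for x
          using that h(3) deg LM(2)[OF h(2)] by (fastforce simp: u_def)
        define f1 where "f1 = f - mpol_var i * k"
        have f1T: "f1 \<in> T" unfolding f1_def using less.prems kT im by (intro TE(3) TE(4)) auto
        have keys_Xk: "\<exists>s \<in> keys k. x = single i 1 + s"
          if "x \<in> keys (mpol_var i * k)" for x
          using that keys_mult[of "mpol_var i" k] by (auto simp: mpol_var_def)
        have keys_f1: "total_deg x = Suc d \<and> x \<le> t" if "x \<in> keys f1" for x
        proof (cases "x \<in> keys f")
          case True then show ?thesis using less.prems LM(2)[OF False] by (auto simp: t_def)
        next
          case x: False
          then have "x \<in> keys (mpol_var i * k)"
            using that by (auto simp: f1_def in_keys_iff lookup_minus)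
          then show ?thesis using keys_Xk[of x] keys_k by (auto simp: tv)
        qed
        have "lookup (mpol_var i * k) t = c * lookup h u"
          unfolding k_def mpol_var_def tv lookup_single_mult_add by simp
        then have f1t: "lookup f1 t = 0"
          using u by (simp add: f1_def lookup_minus c_def in_keys_iff)
        have "\<exists>g. (\<forall>i<m. g i \<in> T \<and> (\<forall>t \<in> keys (g i). total_deg t = d)) \<and> f1 = (\<Sum>i<m. mpol_var i * g i)"
        proof (cases "f1 = 0")
          case True
          then show ?thesis using TE(1) by (intro exI[of _ "\<lambda>_. 0"]) auto
        next
          case f1: False
          have "LM f1 < t" using LM(1)[OF f1] keys_f1[of "LM f1"] f1t by (auto simp: le_less in_keys_iff)
          show ?thesis
          proof (rule less.hyps)
            show "card {s. keys s \<subseteq> {..<m} \<and> total_deg s \<le> Suc d \<and> s < LM f1}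
              < card {s. keys s \<subseteq> {..<m} \<and> total_deg s \<le> Suc d \<and> s < LM f}"
            proof (rule psubset_card_mono)
              show "finite {s. keys s \<subseteq> {..<m} \<and> total_deg s \<le> Suc d \<and> s < LM f}"
                by (rule finite_subset[OF _ finite_monomials_deg_le[of m "Suc d"]]) auto
              have "LM f1 \<in> {s. keys s \<subseteq> {..<m} \<and> total_deg s \<le> Suc d \<and> s < LM f}"
                using \<open>LM f1 < t\<close> keys_LM[OF f1T f1] keys_f1[OF LM(1)[OF f1]] by (simp add: t_def)
              then show "{s. keys s \<subseteq> {..<m} \<and> total_deg s \<le> Suc d \<and> s < LM f1} \<subset>
                {s. keys s \<subseteq> {..<m} \<and> total_deg s \<le> Suc d \<and> s < LM f}"
                using \<open>LM f1 < t\<close> by (auto simp: t_def)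
            qed
          qed (use d f1T keys_f1 in auto)
        qed
        then obtain g where g: "\<forall>i<m. g i \<in> T \<and> (\<forall>t \<in> keys (g i). total_deg t = d)"
          "f1 = (\<Sum>i<m. mpol_var i * g i)" by blast
        have "f = f1 + mpol_var i * k" by (simp add: f1_def)
        also have "\<dots> = (\<Sum>j<m. mpol_var j * (g j + (if j = i then k else 0)))"
          using im by (simp add: g(2) distrib_left sum.distrib if_distrib[of "\<lambda>x. _ * x"] cong: if_cong)
        finally have "f = (\<Sum>j<m. mpol_var j * (g(i := g i + k)) j)"
          by (simp add: if_distrib[of "\<lambda>x. _ * x"] cong: if_cong) (auto intro!: sum.cong)
        moreover have "total_deg s = d" if "s \<in> keys (g i + k)" for s
          using that g(1) im keys_k keys_add[of "g i" k] by auto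
        ultimately show ?thesis
          using g(1) kT im TE(2) by (intro exI[of _ "g(i := g i + k)"]) auto
      qed
    qed
  qed
qed

text \<open>The piece of the saturation in degree D is finite, so a single power k0 of the
  irrelevant ideal multiplies all of it into I. Above D the saturation is generated by multiples of
  the variables, and each degree gained lowers the required power by one, until from D + k0 on the
  power is 0.\<close>

lemma saturation_eq_in_high_degree:
  fixes I :: "'p::prime_card mod_ring mpol set"
  assumes I: "graded_ideal m I"
  shows "\<exists>E. \<forall>d\<ge>E. \<forall>f \<in> saturation m I. hom_component d f \<in> I"
proof -
  let ?T = "saturation m I"
  have ideal: "ideal I (mpol_ring m)" using I by (simp add: graded_ideal_def)
  note IE = ideal_mpolE[OF ideal]
  have T: "graded_ideal m ?T" by (rule graded_ideal_saturation[OF I])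
  have Tc: "?T \<subseteq> carrier (mpol_ring m)" by (auto simp: saturation_def)
  obtain D where D: "\<And>d f. d \<ge> D \<Longrightarrow> f \<in> ?T \<Longrightarrow> (\<forall>t \<in> keys f. total_deg t = Suc d) \<Longrightarrow>
    \<exists>g. (\<forall>i<m. g i \<in> ?T \<and> (\<forall>t \<in> keys (g i). total_deg t = d)) \<and> f = (\<Sum>i<m. mpol_var i * g i)"
    using graded_ideal_generated_in_low_degree[OF T] by blast
  define TD where "TD = {f \<in> ?T. \<forall>t \<in> keys f. total_deg t = D}"
  have "TD \<subseteq> {f. keys f \<subseteq> {t. keys t \<subseteq> {..<m} \<and> total_deg t \<le> D}}"
    using Tc unfolding TD_def subset_eq mpol_carrier_iff by auto
  then have fin: "finite TD"
    using finite_poly_mappings_keys(1)[OF finite_monomials_deg_le] by (rule finite_subset)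
  have "\<exists>k. \<forall>a \<in> order_ge m k. a * f \<in> I" if "f \<in> TD" for f
    using that by (auto simp: TD_def saturation_def)
  then obtain k where k: "\<And>f a. f \<in> TD \<Longrightarrow> a \<in> order_ge m (k f) \<Longrightarrow> a * f \<in> I" by metis
  define k0 where "k0 = Max (insert 0 (k ` TD))"
  have k0: "k f \<le> k0" if "f \<in> TD" for f unfolding k0_def using fin that by (intro Max_ge) auto
  have step: "a * f \<in> I" if "f \<in> ?T" "\<forall>t \<in> keys f. total_deg t = D + j" "a \<in> order_ge m (k0 - j)" for f a j
    using that
  proof (induction j arbitrary: f a)
    case 0
    then have "f \<in> TD" by (simp add: TD_def)
    then show ?case using k k0 0 order_ge_mono[of "k f" k0 m] by auto
  next
    case (Suc j)
    have "\<exists>g. (\<forall>i<m. g i \<in> ?T \<and> (\<forall>t \<in> keys (g i). total_deg t = D + j)) \<and>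
        f = (\<Sum>i<m. mpol_var i * g i)"
      using Suc.prems by (intro D) auto
    then obtain g where g: "\<And>i. i < m \<Longrightarrow> g i \<in> ?T" "\<And>i. i < m \<Longrightarrow> \<forall>t \<in> keys (g i). total_deg t = D + j"
      "f = (\<Sum>i<m. mpol_var i * g i)" by blast
    have summand: "(a * mpol_var i) * g i \<in> I" if i: "i < m" for i
    proof (rule Suc.IH[OF g(1,2)[OF i]])
      have "mpol_var i \<in> (order_ge m 1 :: 'p mod_ring mpol set)" using i by (auto simp: order_ge_def mpol_var_def)
      then have "a * mpol_var i \<in> order_ge m (k0 - Suc j + 1)" using Suc.prems(3) by (intro order_ge_mult)
      \<comment> \<open>Truncated subtraction makes the inequality strict once j reaches k0.\<close>
      moreover have "k0 - j \<le> k0 - Suc j + 1" by arith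
      ultimately show "a * mpol_var i \<in> order_ge m (k0 - j)" using order_ge_mono by blast
    qed
    have "(\<Sum>i\<in>A. (a * mpol_var i) * g i) \<in> I" if "finite A" "A \<subseteq> {..<m}" for A
      using that by (induction A rule: finite_induct) (auto intro!: IE(1,2) summand)
    from this[of "{..<m}"] show ?case by (simp add: g(3) sum_distrib_left mult.assoc)
  qed
  show ?thesis
  proof (intro exI[of _ "D + k0"] allI impI ballI)
    fix d f assume d: "D + k0 \<le> d" and f: "f \<in> ?T"
    have "1 * hom_component d f \<in> I"
    proof (rule step)
      show "hom_component d f \<in> ?T" using T f by (simp add: graded_ideal_def)
      show "\<forall>t\<in>keys (hom_component d f). total_deg t = D + (d - D)"
        using d by (simp add: keys_hom_component)
      show "1 \<in> order_ge m (k0 - (d - D))" using d by (simp add: order_ge_def)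
    qed
    then show "hom_component d f \<in> I" by simp
  qed
qed

text \<open>Components of degree at least E lie in I, so every coset has a representative of bounded
  degree, and over a finite field there are finitely many of these.\<close>

lemma finite_saturation_cosets:
  fixes I :: "'p::prime_card mod_ring mpol set"
  assumes I: "graded_ideal m I"
  shows "finite ((\<lambda>r. I +>\<^bsub>mpol_ring m\<^esub> r) ` saturation m I)"
proof -
  have "ideal I (mpol_ring m)" using I by (simp add: graded_ideal_def)
  then interpret I: ideal I "mpol_ring m" .
  note IE = ideal_mpolE[OF I.ideal_axioms]
  obtain E where E: "\<And>d f. d \<ge> E \<Longrightarrow> f \<in> saturation m I \<Longrightarrow> hom_component d f \<in> I"
    using saturation_eq_in_high_degree[OF I] by blast
  let ?H = "{f :: 'p mod_ring mpol. keys f \<subseteq> {t. keys t \<subseteq> {..<m} \<and> total_deg t \<le> E}}"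
  have "(\<lambda>r. I +>\<^bsub>mpol_ring m\<^esub> r) ` saturation m I \<subseteq> (\<lambda>r. I +>\<^bsub>mpol_ring m\<^esub> r) ` ?H"
  proof
    fix x assume "x \<in> (\<lambda>r. I +>\<^bsub>mpol_ring m\<^esub> r) ` saturation m I"
    then obtain r where r: "r \<in> saturation m I" "x = I +>\<^bsub>mpol_ring m\<^esub> r" by auto
    have rc: "r \<in> carrier (mpol_ring m)" using r(1) by (simp add: saturation_def)
    obtain D where D: "\<forall>t \<in> keys r. total_deg t \<le> D" using ex_total_deg_bound by blast
    define low where "low = (\<Sum>d<E. hom_component d r)"
    have "r = (\<Sum>d\<le>max D E. hom_component d r)" using D by (intro sum_hom_components) auto
    also have "{..max D E} = {..<E} \<union> {E..max D E}" by auto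
    also have "(\<Sum>d\<in>{..<E} \<union> {E..max D E}. hom_component d r) = low + (\<Sum>d\<in>{E..max D E}. hom_component d r)"
      unfolding low_def by (intro sum.union_disjoint) auto
    finally have eq: "r = low + (\<Sum>d\<in>{E..max D E}. hom_component d r)" .
    have "(\<Sum>d\<in>A. hom_component d r) \<in> I" if "A \<subseteq> {E..}" "finite A" for A
      using that(2,1) by (induction A rule: finite_induct) (auto intro!: IE E r(1))
    then have high: "(\<Sum>d\<in>{E..max D E}. hom_component d r) \<in> I" by auto
    have lowc: "low \<in> carrier (mpol_ring m)" unfolding low_def using rc by auto
    have "r \<in> I +>\<^bsub>mpol_ring m\<^esub> low"
      unfolding a_r_coset_def' using high by (subst eq) (auto simp: add.commute)
    then have "I +>\<^bsub>mpol_ring m\<^esub> low = I +>\<^bsub>mpol_ring m\<^esub> r" by (rule I.a_repr_independence'[OF _ lowc])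
    moreover have "total_deg t \<le> E" if "t \<in> keys low" for t
    proof (rule ccontr)
      assume "\<not> total_deg t \<le> E"
      then have "lookup low t = 0" by (auto simp: low_def lookup_sum)
      then show False using that by (simp add: in_keys_iff)
    qed
    then have "low \<in> ?H" using lowc by (auto simp: mpol_carrier_iff)
    ultimately show "x \<in> (\<lambda>r. I +>\<^bsub>mpol_ring m\<^esub> r) ` ?H" using r(2) by auto
  qed
  moreover have "finite ?H" by (intro finite_poly_mappings_keys(1) finite_monomials_deg_le)
  ultimately show ?thesis by (rule finite_subset[OF _ finite_imageI])
qed

section \<open>Frobenius powers\<close>

definition scale_mon :: "nat \<Rightarrow> (nat \<Rightarrow>\<^sub>0 nat) \<Rightarrow> nat \<Rightarrow>\<^sub>0 nat" where
  "scale_mon q t = Poly_Mapping.map ((*) q) t"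

text \<open>For q a power of p, these monomials form a basis of R over its subring of q-th
  powers.\<close>

definition mon_box :: "nat \<Rightarrow> nat \<Rightarrow> (nat \<Rightarrow>\<^sub>0 nat) set" where
  "mon_box m q = {a. keys a \<subseteq> {..<m} \<and> (\<forall>i. lookup a i < q)}"

text \<open>\<open>frob_part q a f\<close> collects the terms of \<open>f\<close> with exponents congruent to \<open>a\<close> modulo \<open>q\<close>, so that
  \<open>f\<close> is the sum of the \<open>X\<^sup>a (frob_part q a f)\<^sup>q\<close> over the box.\<close>

definition frob_part :: "nat \<Rightarrow> (nat \<Rightarrow>\<^sub>0 nat) \<Rightarrow> 'a::comm_ring_1 mpol \<Rightarrow> 'a mpol" where
  "frob_part q a f = Poly_Mapping.map_key (\<lambda>t. scale_mon q t + a) f"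

lemma lookup_scale_mon [simp]: "lookup (scale_mon q t) i = q * lookup t i"
  by (simp add: scale_mon_def map.rep_eq when_def)

text \<open>Uniqueness of quotient and remainder modulo q, applied to each exponent.\<close>

lemma scale_mon_box_eq:
  assumes "a \<in> mon_box m q" "b \<in> mon_box m q" "scale_mon q s + a = scale_mon q t + b"
  shows "a = b" "s = t"
proof -
  have eq: "q * lookup s i + lookup a i = q * lookup t i + lookup b i" for i
    using arg_cong[OF assms(3), of "\<lambda>u. lookup u i"] by (simp add: lookup_add)
  have lt: "lookup a i < q" "lookup b i < q" for i
    using assms by (auto simp: mon_box_def)
  have "lookup a i = lookup b i" for i
    using arg_cong[OF eq[of i], of "\<lambda>n. n mod q"] lt[of i] by simp
  then show "a = b" by (rule poly_mapping_eqI)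
  then have "q * lookup s i = q * lookup t i" for i using eq[of i] by simp
  then show "s = t" using lt[of 0] by (intro poly_mapping_eqI) auto
qed

lemma monomial_box_decomp:
  assumes "q > 0" "keys u \<subseteq> {..<m}"
  obtains t a where "a \<in> mon_box m q" "keys t \<subseteq> {..<m}" "u = scale_mon q t + a"
proof
  let ?a = "Poly_Mapping.map (\<lambda>n. n mod q) u" and ?t = "Poly_Mapping.map (\<lambda>n. n div q) u"
  have la: "lookup ?a i = lookup u i mod q"
    and lt: "lookup ?t i = lookup u i div q" for i
    by (simp_all add: map.rep_eq when_def)
  have "keys ?a \<subseteq> keys u" "keys ?t \<subseteq> keys u"
    by (auto simp: in_keys_iff la lt intro!: gr0I)
  then show "?a \<in> mon_box m q" "keys ?t \<subseteq> {..<m}"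
    using assms by (auto simp: mon_box_def la)
  show "u = scale_mon q ?t + ?a" by (rule poly_mapping_eqI) (simp add: lookup_add la lt)
qed

lemma finite_mon_box: "finite (mon_box m q)"
  by (rule finite_subset[OF _ finite_monomials_bounded[of m q]]) (auto simp: mon_box_def less_imp_le)

lemma card_mon_box:
  assumes "q > 0" shows "card (mon_box m q) = q ^ m"
proof -
  have "bij_betw (\<lambda>a. restrict (lookup a) {..<m}) (mon_box m q) ({..<m} \<rightarrow>\<^sub>E {..<q})"
  proof (rule bij_betwI')
    fix a b assume ab: "a \<in> mon_box m q" "b \<in> mon_box m q"
    show "(restrict (lookup a) {..<m} = restrict (lookup b) {..<m}) = (a = b)"
    proof
      assume eq: "restrict (lookup a) {..<m} = restrict (lookup b) {..<m}"
      show "a = b"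
      proof (rule poly_mapping_eqI)
        fix k show "lookup a k = lookup b k"
        proof (cases "k < m")
          case True then show ?thesis using fun_cong[OF eq, of k] by simp
        next
          case False
          then have "k \<notin> keys a" "k \<notin> keys b" using ab by (auto simp: mon_box_def)
          then show ?thesis by (simp add: in_keys_iff)
        qed
      qed
    qed simp
    show "restrict (lookup a) {..<m} \<in> {..<m} \<rightarrow>\<^sub>E {..<q}" using ab by (auto simp: mon_box_def)
  next
    fix h assume h: "h \<in> {..<m} \<rightarrow>\<^sub>E {..<q}"
    have fin: "finite {k. (if k < m then h k else 0) \<noteq> 0}" by (rule finite_subset[of _ "{..<m}"]) auto
    let ?a = "Abs_poly_mapping (\<lambda>k. if k < m then h k else 0)"
    have la: "lookup ?a k = (if k < m then h k else 0)" for k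
      using fin by (simp add: lookup_Abs_poly_mapping)
    have "?a \<in> mon_box m q" using h assms by (auto simp: mon_box_def in_keys_iff la PiE_iff split: if_splits)
    moreover have "h = restrict (lookup ?a) {..<m}"
      using h by (intro ext) (auto simp: la PiE_iff extensional_def)
    ultimately show "\<exists>a \<in> mon_box m q. h = restrict (lookup a) {..<m}" by blast
  qed
  then have "card (mon_box m q) = card ({..<m} \<rightarrow>\<^sub>E {..<q})" by (rule bij_betw_same_card)
  then show ?thesis by (simp add: card_PiE)
qed

lemma lookup_frob_part:
  assumes "q > 0"
  shows "lookup (frob_part q a f) t = lookup f (scale_mon q t + a)"
proof -
  have "s = t" if "scale_mon q s + a = scale_mon q t + a" for s t
  proof (rule poly_mapping_eqI)
    fix i
    have "q * lookup s i = q * lookup t i"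
      using arg_cong[OF that, of "\<lambda>u. lookup u i"] by (simp add: lookup_add)
    then show "lookup s i = lookup t i" using assms by simp
  qed
  then show ?thesis by (simp add: frob_part_def map_key.rep_eq inj_def)
qed

lemma frob_part_closed:
  assumes "q > 0" "f \<in> carrier (mpol_ring m)" shows "frob_part q a f \<in> carrier (mpol_ring m)"
  unfolding mpol_carrier_iff
proof
  fix t assume "t \<in> keys (frob_part q a f)"
  then have "scale_mon q t + a \<in> keys f" by (simp add: in_keys_iff lookup_frob_part[OF assms(1)])
  then have "keys (scale_mon q t + a) \<subseteq> {..<m}" using assms by (auto simp: mpol_carrier_iff)
  moreover have "keys t \<subseteq> keys (scale_mon q t + a)"
    using assms(1) by (auto simp: in_keys_iff lookup_add)
  ultimately show "keys t \<subseteq> {..<m}" by blast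
qed

section \<open>The Frobenius map and coordinates over the monomial box\<close>

lemma CHAR_mpol: "CHAR('p::prime_card mod_ring mpol) = CARD('p)"
proof (rule CHAR_eqI)
  have "const c = (0 :: 'p mod_ring mpol) \<longleftrightarrow> c = 0" for c
    by (metis lookup_single_eq lookup_zero single_zero)
  then have eq: "(of_nat n :: 'p mod_ring mpol) = 0 \<longleftrightarrow> (of_nat n :: 'p mod_ring) = 0" for n
    by (metis single_of_nat)
  then show "(of_nat CARD('p) :: 'p mod_ring mpol) = 0" by simp
  fix n assume "(of_nat n :: 'p mod_ring mpol) = 0"
  then have "(of_nat n :: 'p mod_ring) = 0" using eq by simp
  then have "CHAR('p mod_ring) dvd n" by (simp only: of_nat_eq_0_iff_char_dvd)
  then show "CARD('p) dvd n" by simp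
qed

text \<open>Fermat's little theorem iterated, obtained from additivity of the Frobenius map along c
  = 1 + ... + 1. It is why \<open>frob_part\<close> can copy coefficients unchanged.\<close>

lemma mod_ring_power_card: "(c :: 'p::prime_card mod_ring) ^ (CARD('p) ^ n) = c"
proof -
  have p: "Factorial_Ring.prime CHAR('p mod_ring)" using prime_card[where 'a = 'p] by simp
  obtain k where k: "c = of_nat k" using mod_ring_of_nat by blast
  have "(of_nat k :: 'p mod_ring) ^ (CARD('p) ^ n) = of_nat k"
  proof (induction k)
    case 0
    then show ?case by (simp add: power_0_left)
  next
    case (Suc k)
    have "(1 + of_nat k :: 'p mod_ring) ^ (CARD('p) ^ n) = 1 ^ (CARD('p) ^ n) + of_nat k ^ (CARD('p) ^ n)"
      using p by (intro freshmans_dream'[where n = n]) auto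
    then show ?case using Suc by simp
  qed
  then show ?thesis using k by simp
qed

lemma single_power: "single t (c::'a::comm_ring_1) ^ n = single (scale_mon n t) (c ^ n)"
proof (induction n)
  case 0
  have "scale_mon 0 t = 0" by (rule poly_mapping_eqI) simp
  then show ?case by simp
next
  case (Suc n)
  have "t + scale_mon n t = scale_mon (Suc n) t" by (rule poly_mapping_eqI) (simp add: lookup_add)
  then show ?case using Suc by (simp add: mult_single)
qed

lemma frobenius_expand:
  fixes f :: "'p::prime_card mod_ring mpol"
  assumes q: "q = CARD('p) ^ n"
  shows "f ^ q = (\<Sum>t \<in> keys f. single (scale_mon q t) (lookup f t))"
proof -
  have "f ^ q = (\<Sum>t \<in> keys f. single t (lookup f t)) ^ q"
    by (simp add: poly_mapping_sum_singles)
  also have "\<dots> = (\<Sum>t \<in> keys f. single t (lookup f t) ^ q)"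
    using prime_card[where 'a = 'p] q by (intro freshmans_dream_sum'[where n = n]) (simp_all add: CHAR_mpol)
  finally show ?thesis by (simp add: single_power q mod_ring_power_card)
qed

text \<open>Distinct basis monomials do not interfere: exponents congruent to a modulo q arise only
  from b = a.\<close>

lemma lookup_single_mult_frobenius:
  fixes f :: "'p::prime_card mod_ring mpol"
  assumes q: "q = CARD('p) ^ n" and a: "a \<in> mon_box m q" and b: "b \<in> mon_box m q"
  shows "lookup (single b 1 * f ^ q) (scale_mon q t + a) =
    (if a = b then lookup f t else 0)"
proof -
  have iff: "b + scale_mon q s = scale_mon q t + a \<longleftrightarrow> s = t \<and> a = b" for s
    using scale_mon_box_eq[OF b a, of s t] by (auto simp: add.commute)
  have "lookup (single b 1 * f ^ q) (scale_mon q t + a) =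
    (\<Sum>s \<in> keys f. if b + scale_mon q s = scale_mon q t + a then lookup f s else 0)"
    by (simp add: frobenius_expand[OF q] sum_distrib_left mult_single lookup_sum lookup_single when_def)
  also have "\<dots> = (\<Sum>s \<in> keys f. if s = t then (if a = b then lookup f s else 0) else 0)"
    by (intro sum.cong) (auto simp: iff)
  also have "\<dots> = (if a = b then lookup f t else 0)" by (simp add: in_keys_iff)
  finally show ?thesis .
qed

text \<open>Uniqueness of the coordinates with respect to the box; their existence is
  \<open>frob_part_decomp\<close>.\<close>

lemma frob_part_sum:
  fixes r :: "(nat \<Rightarrow>\<^sub>0 nat) \<Rightarrow> 'p::prime_card mod_ring mpol"
  assumes q: "q = CARD('p) ^ n" and a: "a \<in> mon_box m q"
  shows "frob_part q a (\<Sum>b \<in> mon_box m q. single b 1 * r b ^ q) = r a"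
proof (rule poly_mapping_eqI)
  fix t
  have "q > 0" by (simp add: q)
  then show "lookup (frob_part q a (\<Sum>b \<in> mon_box m q. single b 1 * r b ^ q)) t
    = lookup (r a) t"
    using a finite_mon_box[of m q]
    by (simp add: lookup_frob_part lookup_sum lookup_single_mult_frobenius[OF q a] cong: sum.cong)
qed

lemma frob_part_decomp:
  fixes f :: "'p::prime_card mod_ring mpol"
  assumes q: "q = CARD('p) ^ n" and f: "f \<in> carrier (mpol_ring m)"
  shows "f = (\<Sum>a \<in> mon_box m q. single a 1 * frob_part q a f ^ q)" (is "f = ?g")
proof (rule poly_mapping_eqI)
  have q0: "q > 0" by (simp add: q)
  have "frob_part q a f ^ q \<in> carrier (mpol_ring m)" for a using f q0 by (intro mpol_power_closed frob_part_closed)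
  then have g: "?g \<in> carrier (mpol_ring m)"
    by (intro mpol_sum_closed mpol_closed(4)) (auto simp: mon_box_def)
  fix u show "lookup f u = lookup ?g u"
  proof (cases "keys u \<subseteq> {..<m}")
    case True
    then obtain t a where a: "a \<in> mon_box m q" "u = scale_mon q t + a" using monomial_box_decomp[OF q0] by metis
    then show ?thesis
      using frob_part_sum[OF q a(1), of "\<lambda>a. frob_part q a f"] lookup_frob_part[OF q0, of a f t]
        lookup_frob_part[OF q0, of a ?g t] by simp
  next
    case False
    then have "u \<notin> keys f" "u \<notin> keys ?g" using f g by (auto simp: mpol_carrier_iff)
    then show ?thesis by (simp add: in_keys_iff)
  qed
qed

lemma frob_part_add: "q > 0 \<Longrightarrow> frob_part q a (f + g) = frob_part q a f + frob_part q a g"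
  and frob_part_diff: "q > 0 \<Longrightarrow> frob_part q a (f - g) = frob_part q a f - frob_part q a g"
  by (rule poly_mapping_eqI, simp add: lookup_frob_part lookup_add lookup_minus)+

lemma frob_part_frobenius_mult:
  fixes f g :: "'p::prime_card mod_ring mpol"
  assumes q: "q = CARD('p) ^ n" and f: "f \<in> carrier (mpol_ring m)" and a: "a \<in> mon_box m q"
  shows "frob_part q a (g ^ q * f) = g * frob_part q a f"
proof -
  have "g ^ q * f = (\<Sum>b \<in> mon_box m q. single b 1 * (g * frob_part q b f) ^ q)"
    by (subst frob_part_decomp[OF q f]) (simp add: sum_distrib_left power_mult_distrib mult_ac)
  then show ?thesis using frob_part_sum[OF q a, of "\<lambda>b. g * frob_part q b f"] by simp
qed

text \<open>If X_i divides the monomial a, the coordinate comes from the quotient. Otherwise there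
  is a carry: terms with exponent q - 1 at i wrap around to 0 and gain a factor X_i^q, whose q-th
  root is X_i.\<close>

lemma frob_part_var_mult:
  assumes q: "q > 0" and i: "i < m" and a: "a \<in> mon_box m q"
  shows "\<exists>b \<in> mon_box m q. \<forall>f :: 'a::comm_ring_1 mpol.
    frob_part q a (mpol_var i * f) = frob_part q b f \<or> frob_part q a (mpol_var i * f) = mpol_var i * frob_part q b f"
proof (cases "i \<in> keys a")
  case True
  then obtain b where b: "a = single i 1 + b" by (rule monomial_split_var)
  have "b \<in> mon_box m q" using a by (auto simp: mon_box_def b keys_add_nat lookup_add) (metis add_lessD1 add.commute)
  moreover have "frob_part q a (mpol_var i * f) = frob_part q b f" for f :: "'a mpol"
  proof (rule poly_mapping_eqI)
    fix t
    have "lookup (mpol_var i * f) (single i 1 + (scale_mon q t + b)) =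
      lookup f (scale_mon q t + b)" unfolding mpol_var_def by simp
    then show "lookup (frob_part q a (mpol_var i * f)) t = lookup (frob_part q b f) t"
      using q by (simp add: lookup_frob_part b add_ac)
  qed
  ultimately show ?thesis by blast
next
  case False
  define b where "b = a + single i (q - 1)"
  have ai: "lookup a i = 0" using False by (simp add: in_keys_iff)
  have "b \<in> mon_box m q"
    using a i q ai by (auto simp: mon_box_def b_def keys_add_nat lookup_add lookup_single when_def split: if_splits)
  moreover have "frob_part q a (mpol_var i * f) = mpol_var i * frob_part q b f" for f :: "'a mpol"
  proof (rule poly_mapping_eqI)
    fix t
    show "lookup (frob_part q a (mpol_var i * f)) t = lookup (mpol_var i * frob_part q b f) t"
    proof (cases "i \<in> keys t")
      case True
      then obtain s where s: "t = single i 1 + s" by (rule monomial_split_var)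
      have "scale_mon q t + a = single i 1 + (scale_mon q s + b)"
        using q by (intro poly_mapping_eqI)
          (auto simp: s b_def lookup_add lookup_single when_def algebra_simps)
      then show ?thesis
        unfolding s mpol_var_def using q by (simp add: lookup_frob_part s)
    next
      case no: False
      then have "i \<notin> keys (scale_mon q t + a)" using ai by (simp add: in_keys_iff lookup_add)
      then show ?thesis using no q by (simp add: lookup_frob_part lookup_var_mult)
    qed
  qed
  ultimately show ?thesis by blast
qed

section \<open>Frobenius powers and their saturations\<close>

lemma ideal_mpol_ringI:
  fixes J :: "'p::prime_card mod_ring mpol set"
  assumes "J \<subseteq> carrier (mpol_ring m)" "0 \<in> J" and add: "\<And>f g. f \<in> J \<Longrightarrow> g \<in> J \<Longrightarrow> f + g \<in> J"
    and var: "\<And>i f. i < m \<Longrightarrow> f \<in> J \<Longrightarrow> mpol_var i * f \<in> J"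
  shows "ideal J (mpol_ring m)"
proof (rule idealI)
  interpret R: cring "mpol_ring m :: 'p mod_ring mpol ring" by (rule cring_mpol_ring)
  have mult: "x * f \<in> J" if x: "x \<in> carrier (mpol_ring m)" and f: "f \<in> J" for x f
  proof -
    have "x \<in> {x. x * f \<in> J}"
      using x by (rule mpol_ring_generated) (auto simp: assms(2) f distrib_right add mult.assoc var)
    then show ?thesis by simp
  qed
  show "ring (mpol_ring m :: 'p mod_ring mpol ring)" by (rule R.ring_axioms)
  have "- f \<in> J" if "f \<in> J" for f using mult[of "- 1" f] that by simp
  then show "subgroup J (add_monoid (mpol_ring m))"
    using assms(1,2) by (intro R.add.subgroupI) (auto simp: add subset_eq simp flip: a_inv_def)
  fix a x assume "a \<in> J" "x \<in> carrier (mpol_ring m :: 'p mod_ring mpol ring)"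
  then show "x \<otimes>\<^bsub>mpol_ring m\<^esub> a \<in> J" "a \<otimes>\<^bsub>mpol_ring m\<^esub> x \<in> J"
    using mult[of x a] by (simp_all add: mult.commute)
qed

lemma ideal_mpol_sum:
  fixes J :: "'a::comm_ring_1 mpol set"
  assumes "ideal J (mpol_ring m)" "\<And>a. a \<in> A \<Longrightarrow> f a \<in> J"
  shows "(\<Sum>a\<in>A. f a) \<in> J"
  using assms(2) ideal_mpolE(1,2)[OF assms(1)] by (induction A rule: infinite_finite_induct) auto

lemma ideal_frobenius_power:
  fixes I :: "'a::comm_ring_1 mpol set"
  assumes "ideal I (mpol_ring m)"
  shows "ideal (frobenius_power (mpol_ring m) I q) (mpol_ring m)"
    and "x \<in> I \<Longrightarrow> x ^ q \<in> frobenius_power (mpol_ring m) I q"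
proof -
  interpret R: cring "mpol_ring m :: 'a mpol ring" by (rule cring_mpol_ring)
  have "(\<lambda>x. x [^]\<^bsub>mpol_ring m\<^esub> q) ` I \<subseteq> carrier (mpol_ring m)" using ideal_mpolE(5)[OF assms] by auto
  from R.genideal_ideal[OF this] R.genideal_self[OF this]
  show "ideal (frobenius_power (mpol_ring m) I q) (mpol_ring m)"
    "x \<in> I \<Longrightarrow> x ^ q \<in> frobenius_power (mpol_ring m) I q" by (auto simp: frobenius_power_def)
qed

text \<open>The condition on coordinates defines an ideal, by the carry rule for variables, and this
  ideal contains the q-th powers of elements of I. The converse is the decomposition of f over the
  box.\<close>

lemma frobenius_power_iff:
  fixes I :: "'p::prime_card mod_ring mpol set"
  assumes I: "ideal I (mpol_ring m)" and q: "q = CARD('p) ^ n"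
  shows "f \<in> frobenius_power (mpol_ring m) I q \<longleftrightarrow>
    f \<in> carrier (mpol_ring m) \<and> (\<forall>a \<in> mon_box m q. frob_part q a f \<in> I)"
proof
  interpret R: cring "mpol_ring m :: 'p mod_ring mpol ring" by (rule cring_mpol_ring)
  note IE = ideal_mpolE[OF I] and J = ideal_frobenius_power[OF I, where q = q]
  note JE = ideal_mpolE[OF J(1)]
  have q0: "q > 0" by (simp add: q)
  define L where "L = {f \<in> carrier (mpol_ring m). \<forall>a \<in> mon_box m q. frob_part q a f \<in> I}"
  have fp0: "frob_part q a 0 = 0" for a by (rule poly_mapping_eqI) (simp add: lookup_frob_part[OF q0])
  have "ideal L (mpol_ring m)"
  proof (rule ideal_mpol_ringI)
    fix i f assume i: "i < m" and f: "f \<in> L"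
    have "frob_part q a (mpol_var i * f) \<in> I" if a: "a \<in> mon_box m q" for a
    proof -
      obtain b where "b \<in> mon_box m q" "frob_part q a (mpol_var i * f) = frob_part q b f \<or>
        frob_part q a (mpol_var i * f) = mpol_var i * frob_part q b f"
        using frob_part_var_mult[OF q0 i a] by blast
      then show ?thesis using f i IE(4)[of "mpol_var i" "frob_part q b f"] by (auto simp: L_def)
    qed
    then show "mpol_var i * f \<in> L" using f i by (auto simp: L_def)
  qed (auto simp: L_def fp0 IE(1,2) frob_part_add[OF q0])
  moreover have "x ^ q \<in> L" if x: "x \<in> I" for x
  proof -
    have xc: "x \<in> carrier (mpol_ring m)" using x IE(5) by auto
    have "(0 :: nat \<Rightarrow>\<^sub>0 nat) \<in> mon_box m q" using q0 by (simp add: mon_box_def)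
    then have "frob_part q a (x ^ q) = (if a = 0 then x else 0)" if "a \<in> mon_box m q" for a
      using lookup_single_mult_frobenius[OF q that, of 0 x]
      by (intro poly_mapping_eqI) (simp add: lookup_frob_part[OF q0])
    then show ?thesis using x xc IE(1) by (auto simp: L_def)
  qed
  ultimately have sub: "frobenius_power (mpol_ring m) I q \<subseteq> L"
    unfolding frobenius_power_def by (intro R.genideal_minimal) auto
  show "f \<in> carrier (mpol_ring m) \<and> (\<forall>a \<in> mon_box m q. frob_part q a f \<in> I)"
    if "f \<in> frobenius_power (mpol_ring m) I q" using sub that by (auto simp: L_def)
  assume f: "f \<in> carrier (mpol_ring m) \<and> (\<forall>a \<in> mon_box m q. frob_part q a f \<in> I)"
  have "single a 1 * frob_part q a f ^ q \<in> frobenius_power (mpol_ring m) I q" if "a \<in> mon_box m q" for a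
    using that f by (intro JE(4) J(2)) (auto simp: mon_box_def)
  then have "(\<Sum>a \<in> mon_box m q. single a 1 * frob_part q a f ^ q) \<in> frobenius_power (mpol_ring m) I q"
    by (rule ideal_mpol_sum[OF J(1)])
  then show "f \<in> frobenius_power (mpol_ring m) I q"
    using frob_part_decomp[OF q, of f m] f by simp
qed

text \<open>Testing f with q-th powers g^q puts g times each coordinate into I. Conversely, a
  monomial of large degree is the q-th power of a monomial of degree at least k0 times a remainder
  of bounded degree from the box.\<close>

lemma saturation_frobenius_power_iff:
  fixes I :: "'p::prime_card mod_ring mpol set"
  assumes I: "ideal I (mpol_ring m)" and q: "q = CARD('p) ^ n"
  shows "f \<in> saturation m (frobenius_power (mpol_ring m) I q) \<longleftrightarrow>
    f \<in> carrier (mpol_ring m) \<and> (\<forall>a \<in> mon_box m q. frob_part q a f \<in> saturation m I)"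
proof
  note IE = ideal_mpolE[OF I] and J = ideal_frobenius_power[OF I, where q = q]
  note JE = ideal_mpolE[OF J(1)]
  have q0: "q > 0" by (simp add: q)
  show "f \<in> carrier (mpol_ring m) \<and> (\<forall>a \<in> mon_box m q. frob_part q a f \<in> saturation m I)"
    if f: "f \<in> saturation m (frobenius_power (mpol_ring m) I q)"
  proof (intro conjI ballI)
    show fc: "f \<in> carrier (mpol_ring m)" using f by (simp add: saturation_def)
    fix a assume a: "a \<in> mon_box m q"
    obtain k where k: "\<And>g. g \<in> order_ge m k \<Longrightarrow> g * f \<in> frobenius_power (mpol_ring m) I q"
      using f by (auto simp: saturation_def)
    have "g * frob_part q a f \<in> I" if g: "g \<in> order_ge m k" for g
    proof -
      have "g ^ q = g ^ (q - 1) * g" using q0 by (cases q) (simp_all add: mult.commute)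
      moreover have "g ^ (q - 1) \<in> order_ge m 0" using g by (simp add: order_ge_def mpol_power_closed)
      ultimately have "g ^ q \<in> order_ge m k" using order_ge_mult[of "g ^ (q - 1)" m 0 g k] g by simp
      then have "frob_part q a (g ^ q * f) \<in> I" using k[of "g ^ q"] frobenius_power_iff[OF I q] a by blast
      then show ?thesis using frob_part_frobenius_mult[OF q fc a] by simp
    qed
    then show "frob_part q a f \<in> saturation m I" using frob_part_closed[OF q0 fc] by (auto simp: saturation_def)
  qed
  assume f: "f \<in> carrier (mpol_ring m) \<and> (\<forall>a \<in> mon_box m q. frob_part q a f \<in> saturation m I)"
  then have "\<forall>a \<in> mon_box m q. \<exists>k. \<forall>g \<in> order_ge m k. g * frob_part q a f \<in> I"
    by (auto simp: saturation_def)
  then obtain k where k: "\<And>a g. a \<in> mon_box m q \<Longrightarrow> g \<in> order_ge m (k a) \<Longrightarrow> g * frob_part q a f \<in> I"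
    by metis
  define k0 where "k0 = Max (insert 0 (k ` mon_box m q))"
  have k0: "g * frob_part q a f \<in> I" if "a \<in> mon_box m q" "g \<in> order_ge m k0" for a g
  proof -
    have "k a \<le> k0" unfolding k0_def using finite_mon_box that by (intro Max_ge) auto
    then show ?thesis using k[OF that(1)] that(2) order_ge_mono by blast
  qed
  \<comment> \<open>A bound on the degrees of remainders in the box: total degree at least q k0 + c
    leaves degree at least q k0 for the part that is a q-th power.\<close>
  define c where "c = Max (insert 0 (total_deg ` mon_box m q))"
  have c: "total_deg a \<le> c" if "a \<in> mon_box m q" for a
    unfolding c_def using finite_mon_box that by (intro Max_ge) auto
  have "g * f \<in> frobenius_power (mpol_ring m) I q" if g: "g \<in> order_ge m (q * k0 + c)" for g
  proof -
    have "g \<in> {g. g * f \<in> frobenius_power (mpol_ring m) I q}"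
    proof (rule mpol_in_of_monomials)
      fix u assume u: "u \<in> keys g"
      then have uk: "keys u \<subseteq> {..<m}" "q * k0 + c \<le> total_deg u"
        using g by (auto simp: order_ge_def mpol_carrier_iff)
      obtain b t where b: "b \<in> mon_box m q" "keys t \<subseteq> {..<m}" "u = scale_mon q t + b"
        using monomial_box_decomp[OF q0 uk(1)] by metis
      have "total_deg (scale_mon q t) = (\<Sum>i<m. lookup (scale_mon q t) i)"
        using b(2) by (intro total_deg_eq) (auto simp: in_keys_iff subset_eq)
      also have "\<dots> = q * total_deg t" using total_deg_eq[of "{..<m}" t] b(2) by (simp add: sum_distrib_left)
      finally have deg: "total_deg (scale_mon q t) = q * total_deg t" .
      have "q * k0 + c \<le> total_deg (scale_mon q t) + total_deg b" using uk(2) b(3) by simp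
      then have "q * k0 \<le> q * total_deg t" using c[OF b(1)] deg by linarith
      then have tk: "single t 1 \<in> (order_ge m k0 :: 'p mod_ring mpol set)"
        using q0 b(2) by (auto simp: order_ge_def)
      let ?v = "lookup g u"
      have "single u ?v = single b ?v * single t 1 ^ q"
        by (simp add: b(3) single_power mult_single add.commute)
      then have "single u ?v * f =
        (\<Sum>a \<in> mon_box m q. (single b ?v * single a 1) * (single t 1 * frob_part q a f) ^ q)"
        by (subst frob_part_decomp[OF q, of f m]) (use f in \<open>simp_all add: sum_distrib_left power_mult_distrib mult_ac\<close>)
      moreover have "(single b ?v * single a 1) * (single t 1 * frob_part q a f) ^ q
        \<in> frobenius_power (mpol_ring m) I q" if "a \<in> mon_box m q" for a
        using k0[OF that tk] that b(1) by (intro JE(4) J(2)) (auto simp: mon_box_def)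
      then have "(\<Sum>a \<in> mon_box m q. (single b ?v * single a 1) *
        (single t 1 * frob_part q a f) ^ q) \<in> frobenius_power (mpol_ring m) I q"
        by (rule ideal_mpol_sum[OF J(1)])
      ultimately show "single u ?v \<in> {g. g * f \<in> frobenius_power (mpol_ring m) I q}" by simp
    qed (auto simp: JE(1,2) distrib_right)
    then show ?thesis by simp
  qed
  then show "f \<in> saturation m (frobenius_power (mpol_ring m) I q)" using f by (auto simp: saturation_def)
qed

section \<open>Local cohomology as cosets of the saturation\<close>

lemma coset_eq_iff:
  fixes J :: "'a::comm_ring_1 mpol set"
  assumes J: "ideal J (mpol_ring m)" and f: "f \<in> carrier (mpol_ring m)" and g: "g \<in> carrier (mpol_ring m)"
  shows "J +>\<^bsub>mpol_ring m\<^esub> f = J +>\<^bsub>mpol_ring m\<^esub> g \<longleftrightarrow> f - g \<in> J"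
proof -
  interpret ideal J "mpol_ring m" by fact
  note JE = ideal_mpolE[OF J]
  have mem: "x \<in> J +>\<^bsub>mpol_ring m\<^esub> g \<longleftrightarrow> x - g \<in> J" for x
    unfolding a_r_coset_def' by (auto intro: bexI[of _ "x - g"])
  show ?thesis
    using a_rcos_self[OF f] mem[of f] a_repr_independence'[OF _ g, of f] by auto
qed

lemma local_cohomology0_carrier:
  fixes J :: "'a::comm_ring_1 mpol set"
  assumes J: "ideal J (mpol_ring m)"
  shows "carrier (local_cohomology0 (mpol_ring m) (irrelevant_ideal m) (quot_module (mpol_ring m) J)) =
    (\<lambda>r. J +>\<^bsub>mpol_ring m\<^esub> r) ` saturation m J"
proof -
  interpret ideal J "mpol_ring m" by fact
  have *: "a \<odot>\<^bsub>quot_module (mpol_ring m) J\<^esub> (J +>\<^bsub>mpol_ring m\<^esub> r) = \<zero>\<^bsub>quot_module (mpol_ring m) J\<^esub> \<longleftrightarrow> a * r \<in> J"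
    if "a \<in> order_ge m k" "r \<in> carrier (mpol_ring m)" for a r k
  proof -
    have "a \<in> carrier (mpol_ring m)" using that by (simp add: order_ge_def)
    then show ?thesis
      using that quot_module_smult[of a r] coset_eq_zero_iff[of "a * r"] by (simp add: quot_module_simps(3))
  qed
  show ?thesis
  proof (intro subset_antisym subsetI)
    fix x assume "x \<in> carrier (local_cohomology0 (mpol_ring m) (irrelevant_ideal m) (quot_module (mpol_ring m) J))"
    then obtain k where x: "x \<in> carrier (quot_module (mpol_ring m) J)"
      "\<forall>a \<in> order_ge m k. a \<odot>\<^bsub>quot_module (mpol_ring m) J\<^esub> x = \<zero>\<^bsub>quot_module (mpol_ring m) J\<^esub>"
      by (auto simp: local_cohomology0_def irrelevant_ideal_power)
    then obtain r where r: "r \<in> carrier (mpol_ring m)" "x = J +>\<^bsub>mpol_ring m\<^esub> r" by (auto elim: quot_module_cosetE)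
    then have "\<forall>a \<in> order_ge m k. a * r \<in> J" using x(2) *[OF _ r(1)] by blast
    then show "x \<in> (\<lambda>r. J +>\<^bsub>mpol_ring m\<^esub> r) ` saturation m J" using r by (auto simp: saturation_def)
  next
    fix x assume "x \<in> (\<lambda>r. J +>\<^bsub>mpol_ring m\<^esub> r) ` saturation m J"
    then obtain r k where r: "r \<in> carrier (mpol_ring m)" "x = J +>\<^bsub>mpol_ring m\<^esub> r" "\<forall>a \<in> order_ge m k. a * r \<in> J"
      by (auto simp: saturation_def)
    then have "\<forall>a \<in> order_ge m k. a \<odot>\<^bsub>quot_module (mpol_ring m) J\<^esub> x = \<zero>\<^bsub>quot_module (mpol_ring m) J\<^esub>"
      using *[OF _ r(1)] by blast
    then show "x \<in> carrier (local_cohomology0 (mpol_ring m) (irrelevant_ideal m) (quot_module (mpol_ring m) J))"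
      using r(1,2) quot_module_coset[OF r(1)] by (auto simp: local_cohomology0_def irrelevant_ideal_power)
  qed
qed

lemma module_local_cohomology0:
  fixes J :: "'p::prime_card mod_ring mpol set"
  assumes J: "ideal J (mpol_ring m)"
  shows "module (mpol_ring m) (local_cohomology0 (mpol_ring m) (irrelevant_ideal m) (quot_module (mpol_ring m) J))"
proof -
  let ?R = "mpol_ring m :: 'p mod_ring mpol ring"
  let ?H = "(\<lambda>r. J +>\<^bsub>?R\<^esub> r) ` saturation m J"
  interpret ideal J ?R by fact
  note SE = ideal_mpolE[OF ideal_saturation[OF J]]
  have M: "module ?R (quot_module ?R J)" by (rule module_quot_module[OF cring_mpol_ring])
  interpret M: module ?R "quot_module ?R J" by (rule M)
  have S: "r \<in> carrier ?R" if "r \<in> saturation m J" for r using that by (simp add: saturation_def)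
  have "submodule ?H ?R (quot_module ?R J)"
  proof (rule submodule_mpol_ringI[OF M])
    show "?H \<subseteq> carrier (quot_module ?R J)" using S by (auto intro: quot_module_coset)
    show "\<zero>\<^bsub>quot_module ?R J\<^esub> \<in> ?H" using SE(1) by (simp add: quot_module_zero)
  next
    fix x y assume "x \<in> ?H" "y \<in> ?H"
    then obtain r s where r: "r \<in> saturation m J" "x = J +>\<^bsub>?R\<^esub> r" "s \<in> saturation m J" "y = J +>\<^bsub>?R\<^esub> s" by auto
    show "x \<oplus>\<^bsub>quot_module ?R J\<^esub> y \<in> ?H"
      using r SE(2)[OF r(1,3)] quot_module_add[OF S[OF r(1)] S[OF r(3)]] by simp
  next
    fix x assume "x \<in> ?H"
    then obtain r where r: "r \<in> saturation m J" "x = J +>\<^bsub>?R\<^esub> r" by auto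
    have neg: "- r \<in> saturation m J" using SE(3)[OF SE(1) r(1)] by simp
    have "\<ominus>\<^bsub>quot_module ?R J\<^esub> x = J +>\<^bsub>?R\<^esub> (- r)"
      using quot_module_add[OF S[OF neg] S[OF r(1)]] quot_module_coset[OF S[OF r(1)]] quot_module_coset[OF S[OF neg]]
      by (intro M.M.minus_equality) (simp_all add: r(2) quot_module_zero)
    then show "\<ominus>\<^bsub>quot_module ?R J\<^esub> x \<in> ?H" using neg by simp
    fix i assume i: "i < m"
    show "mpol_var i \<odot>\<^bsub>quot_module ?R J\<^esub> x \<in> ?H"
      using r SE(4)[OF mpol_var_closed[OF i] r(1)] quot_module_smult[OF mpol_var_closed[OF i] S[OF r(1)]] by simp
  qed
  then have "module ?R (quot_module ?R J\<lparr>carrier := ?H\<rparr>)" by (rule submodule.submodule_is_module[OF _ M])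
  then show ?thesis using local_cohomology0_carrier[OF J] by (simp add: local_cohomology0_def)
qed

lemma local_cohomology0_nilpotent:
  assumes "x \<in> carrier (local_cohomology0 (mpol_ring m) (irrelevant_ideal m) M)"
  shows "\<exists>k. \<forall>a \<in> order_ge m k. a \<odot>\<^bsub>local_cohomology0 (mpol_ring m) (irrelevant_ideal m) M\<^esub> x =
    \<zero>\<^bsub>local_cohomology0 (mpol_ring m) (irrelevant_ideal m) M\<^esub>"
  using assms by (auto simp: local_cohomology0_def irrelevant_ideal_power)

text \<open>Both images are copies of the set of common fibres. This compares cosets with tuples of
  cosets without an explicit map between them.\<close>

lemma image_same_kernel:
  assumes "\<And>x y. x \<in> T \<Longrightarrow> y \<in> T \<Longrightarrow> \<phi> x = \<phi> y \<longleftrightarrow> \<psi> x = \<psi> y"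
  shows "card (\<phi> ` T) = card (\<psi> ` T)" "finite (\<phi> ` T) \<longleftrightarrow> finite (\<psi> ` T)"
proof -
  have inv: "inv_into T \<phi> (\<phi> x) \<in> T" "\<psi> (inv_into T \<phi> (\<phi> x)) = \<psi> x" if "x \<in> T" for x
    using that assms[of "inv_into T \<phi> (\<phi> x)" x] by (auto simp: inv_into_into f_inv_into_f)
  have "bij_betw (\<lambda>z. \<psi> (inv_into T \<phi> z)) (\<phi> ` T) (\<psi> ` T)"
    by (rule bij_betwI') (auto simp: inv assms)
  then show "card (\<phi> ` T) = card (\<psi> ` T)" "finite (\<phi> ` T) \<longleftrightarrow> finite (\<psi> ` T)"
    by (rule bij_betw_same_card, rule bij_betw_finite)
qed

text \<open>Coordinates identify the cosets of the saturation of I^[q] with families of cosets of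
  the saturation of I, indexed by the q^m monomials of the box.\<close>

lemma card_saturation_frobenius_power:
  fixes I :: "'p::prime_card mod_ring mpol set"
  assumes I: "graded_ideal m I" and q: "q = CARD('p) ^ n"
  defines "J \<equiv> frobenius_power (mpol_ring m) I q"
  shows "finite ((\<lambda>r. J +>\<^bsub>mpol_ring m\<^esub> r) ` saturation m J)"
    and "card ((\<lambda>r. J +>\<^bsub>mpol_ring m\<^esub> r) ` saturation m J) =
      card ((\<lambda>r. I +>\<^bsub>mpol_ring m\<^esub> r) ` saturation m I) ^ (q ^ m)"
proof -
  let ?R = "mpol_ring m :: 'p mod_ring mpol ring"
  have ideal: "ideal I ?R" using I by (simp add: graded_ideal_def)
  have J: "ideal J ?R" unfolding J_def by (rule ideal_frobenius_power(1)[OF ideal])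
  have q0: "q > 0" by (simp add: q)
  define C where "C = (\<lambda>r. I +>\<^bsub>?R\<^esub> r) ` saturation m I"
  have C: "finite C" unfolding C_def by (rule finite_saturation_cosets[OF I])
  define \<psi> where "\<psi> f = restrict (\<lambda>a. I +>\<^bsub>?R\<^esub> frob_part q a f) (mon_box m q)" for f :: "'p mod_ring mpol"
  have same: "J +>\<^bsub>?R\<^esub> f = J +>\<^bsub>?R\<^esub> g \<longleftrightarrow> \<psi> f = \<psi> g" if "f \<in> saturation m J" "g \<in> saturation m J" for f g
  proof -
    have fg: "f \<in> carrier ?R" "g \<in> carrier ?R" using that by (auto simp: saturation_def)
    then have fgd: "f - g \<in> carrier ?R" by auto
    have "J +>\<^bsub>?R\<^esub> f = J +>\<^bsub>?R\<^esub> g \<longleftrightarrow> (\<forall>a \<in> mon_box m q. frob_part q a (f - g) \<in> I)"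
      using coset_eq_iff[OF J fg] frobenius_power_iff[OF ideal q, of "f - g"] fgd by (simp add: J_def)
    also have "\<dots> \<longleftrightarrow> (\<forall>a \<in> mon_box m q. I +>\<^bsub>?R\<^esub> frob_part q a f = I +>\<^bsub>?R\<^esub> frob_part q a g)"
      using coset_eq_iff[OF ideal frob_part_closed[OF q0 fg(1)] frob_part_closed[OF q0 fg(2)]]
      by (simp add: frob_part_diff[OF q0])
    also have "\<dots> \<longleftrightarrow> \<psi> f = \<psi> g" by (auto simp: \<psi>_def fun_eq_iff restrict_def)
    finally show ?thesis .
  qed
  have im: "\<psi> ` saturation m J = mon_box m q \<rightarrow>\<^sub>E C"
  proof (intro subset_antisym subsetI)
    fix x assume "x \<in> \<psi> ` saturation m J"
    then show "x \<in> mon_box m q \<rightarrow>\<^sub>E C"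
      using saturation_frobenius_power_iff[OF ideal q] by (auto simp: \<psi>_def C_def J_def)
  next
    fix h assume h: "h \<in> mon_box m q \<rightarrow>\<^sub>E C"
    then have "\<forall>a \<in> mon_box m q. \<exists>r. r \<in> saturation m I \<and> h a = I +>\<^bsub>?R\<^esub> r" by (auto simp: C_def PiE_iff)
    then obtain r where r: "\<And>a. a \<in> mon_box m q \<Longrightarrow> r a \<in> saturation m I"
      "\<And>a. a \<in> mon_box m q \<Longrightarrow> h a = I +>\<^bsub>?R\<^esub> r a" by metis
    define f where "f = (\<Sum>b \<in> mon_box m q. single b 1 * r b ^ q)"
    have fp: "frob_part q a f = r a" if "a \<in> mon_box m q" for a
      unfolding f_def by (rule frob_part_sum[OF q that])
    have "f \<in> carrier ?R"
      unfolding f_def using r(1)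
      by (intro mpol_sum_closed mpol_closed(4) mpol_power_closed) (auto simp: mon_box_def saturation_def)
    then have "f \<in> saturation m J"
      unfolding J_def using saturation_frobenius_power_iff[OF ideal q, of f] fp r(1) by simp
    moreover have "\<psi> f = h"
      using h r(2) fp by (intro ext) (auto simp: \<psi>_def PiE_iff extensional_def)
    ultimately show "h \<in> \<psi> ` saturation m J" by blast
  qed
  have eq: "card ((\<lambda>r. J +>\<^bsub>?R\<^esub> r) ` saturation m J) = card (\<psi> ` saturation m J)"
    "finite ((\<lambda>r. J +>\<^bsub>?R\<^esub> r) ` saturation m J) \<longleftrightarrow> finite (\<psi> ` saturation m J)"
    by (rule image_same_kernel, rule same, assumption+)+
  show "finite ((\<lambda>r. J +>\<^bsub>mpol_ring m\<^esub> r) ` saturation m J)"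
    unfolding eq(2) im using C finite_mon_box by (intro finite_PiE) auto
  show "card ((\<lambda>r. J +>\<^bsub>mpol_ring m\<^esub> r) ` saturation m J) =
      card ((\<lambda>r. I +>\<^bsub>mpol_ring m\<^esub> r) ` saturation m I) ^ (q ^ m)"
    unfolding eq(1) im C_def[symmetric] by (simp add: card_PiE finite_mon_box card_mon_box[OF q0])
qed

text \<open>With t = 0 the socle condition concerns M itself. A socle element is annihilated by the
  irrelevant ideal and so lies in H. Conversely each element of H is annihilated by a power of that
  ideal, so H contains a socle element if it is nonzero.\<close>

lemma local_cohomology0_trivial_iff:
  fixes I :: "'p::prime_card mod_ring mpol set"
  assumes I: "ideal I (mpol_ring m)"
  defines "M \<equiv> quot_module (mpol_ring m) I"
  defines "H \<equiv> local_cohomology0 (mpol_ring m) (irrelevant_ideal m) M"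
  shows "carrier H = {\<zero>\<^bsub>M\<^esub>} \<longleftrightarrow> socle_free mpol_var m M 0 (carrier M)"
proof -
  let ?R = "mpol_ring m :: 'p mod_ring mpol ring"
  interpret ideal I ?R by fact
  note IE = ideal_mpolE[OF I]
  have H: "module ?R H" unfolding H_def M_def by (rule module_local_cohomology0[OF I])
  interpret H: module ?R H by (rule H)
  have Hs: "\<zero>\<^bsub>H\<^esub> = \<zero>\<^bsub>M\<^esub>" "carrier H \<subseteq> carrier M" "a \<odot>\<^bsub>H\<^esub> x = a \<odot>\<^bsub>M\<^esub> x" for a x
    by (auto simp: H_def local_cohomology0_def)
  show ?thesis
  proof
    assume triv: "carrier H = {\<zero>\<^bsub>M\<^esub>}"
    show "socle_free mpol_var m M 0 (carrier M)"
      unfolding socle_free_def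
    proof (intro ballI impI)
      fix z assume z: "z \<in> carrier M" "\<forall>i. 0 \<le> i \<and> i < m \<longrightarrow> mpol_var i \<odot>\<^bsub>M\<^esub> z \<in> seq_mult mpol_var M 0 (carrier M)"
      obtain r where r: "r \<in> carrier ?R" "z = I +>\<^bsub>?R\<^esub> r" using z(1) unfolding M_def by (rule quot_module_cosetE)
      have var: "mpol_var i * r \<in> I" if "i < m" for i
        using z(2) that r quot_module_smult[of "mpol_var i" r] coset_eq_zero_iff[of "mpol_var i * r"]
        by (simp add: M_def quot_module_simps(3))
      define A where "A = {a \<in> carrier ?R. a * r \<in> I}"
      have "ideal A ?R"
        by (rule ideal_mpol_ringI) (auto simp: A_def IE(1,2) distrib_right mult.assoc intro: IE(4))
      then have "irrelevant_ideal m \<subseteq> A"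
        unfolding irrelevant_ideal_def using var by (intro genideal_minimal) (auto simp: A_def)
      then have "\<forall>a \<in> order_ge m 1. a * r \<in> I" by (auto simp: irrelevant_ideal_eq A_def)
      then have "r \<in> saturation m I" using r(1) by (auto simp: saturation_def)
      then have "z \<in> carrier H" unfolding H_def M_def local_cohomology0_carrier[OF I] using r(2) by blast
      then show "z \<in> seq_mult mpol_var M 0 (carrier M)" using triv by simp
    qed
  next
    assume free: "socle_free mpol_var m M 0 (carrier M)"
    show "carrier H = {\<zero>\<^bsub>M\<^esub>}"
    proof (rule ccontr)
      assume "carrier H \<noteq> {\<zero>\<^bsub>M\<^esub>}"
      then obtain y where y: "y \<in> carrier H" "y \<notin> {\<zero>\<^bsub>H\<^esub>}" using H.M.zero_closed Hs(1) by auto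
      have "{\<zero>\<^bsub>H\<^esub>} = seq_mult mpol_var H 0 (carrier H)" by simp
      then have "submodule {\<zero>\<^bsub>H\<^esub>} ?R H"
        using H.seq_mult_submodule[OF H.carrier_is_submodule, of 0 mpol_var] by simp
      moreover have "\<exists>k. \<forall>a \<in> order_ge m k. a \<odot>\<^bsub>H\<^esub> x = \<zero>\<^bsub>H\<^esub>" if "x \<in> carrier H" for x
        using that unfolding H_def by (rule local_cohomology0_nilpotent)
      ultimately obtain x where x: "x \<in> carrier H - {\<zero>\<^bsub>H\<^esub>}" "\<forall>i<m. mpol_var i \<odot>\<^bsub>H\<^esub> x \<in> {\<zero>\<^bsub>H\<^esub>}"
        using exists_socle_element[OF H _ _ y] by metis
      then have "x \<in> carrier M" "\<forall>i<m. mpol_var i \<odot>\<^bsub>M\<^esub> x = \<zero>\<^bsub>M\<^esub>" "x \<noteq> \<zero>\<^bsub>M\<^esub>" using Hs by auto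
      then show False using free by (auto simp: socle_free_def)
    qed
  qed
qed

text \<open>Raising p^l to the power q^m multiplies the exponent by q^m, and the length is that
  exponent.\<close>

lemma f_gHK_eq:
  fixes I :: "'p::prime_card mod_ring mpol set" and m :: nat
  defines "H \<equiv> local_cohomology0 (mpol_ring m) (irrelevant_ideal m) (quot_module (mpol_ring m) I)"
  assumes I: "graded_ideal m I"
  shows "\<exists>l. card (carrier H) = CARD('p) ^ l \<and> module_length (mpol_ring m) H = enat l \<and>
    (\<forall>n. f_gHK (mpol_ring m) (irrelevant_ideal m) CARD('p) I n = enat (l * (CARD('p) ^ n) ^ m))"
proof -
  let ?R = "mpol_ring m :: 'p mod_ring mpol ring"
  have ideal: "ideal I ?R" using I by (simp add: graded_ideal_def)
  have p: "CARD('p) \<ge> 2" using prime_card[where 'a = 'p] by (rule prime_ge_2_nat)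
  have len: "\<exists>l. card (carrier N) = CARD('p) ^ l \<and> module_length ?R N = enat l"
    if J: "ideal J ?R" and fin: "finite (carrier N)"
      and N: "N = local_cohomology0 ?R (irrelevant_ideal m) (quot_module ?R J)" for J N
    unfolding N
    by (rule module_length_card[OF module_local_cohomology0[OF J] fin[unfolded N] local_cohomology0_nilpotent])
  have cosets: "carrier H = (\<lambda>r. I +>\<^bsub>?R\<^esub> r) ` saturation m I"
    unfolding H_def by (rule local_cohomology0_carrier[OF ideal])
  then have "finite (carrier H)" using finite_saturation_cosets[OF I] by simp
  then obtain l where l: "card (carrier H) = CARD('p) ^ l" "module_length ?R H = enat l"
    using len[OF ideal _ H_def[THEN meta_eq_to_obj_eq]] by blast
  have "f_gHK ?R (irrelevant_ideal m) CARD('p) I n = enat (l * (CARD('p) ^ n) ^ m)" for n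
  proof -
    define J where "J = frobenius_power ?R I (CARD('p) ^ n)"
    define N where "N = local_cohomology0 ?R (irrelevant_ideal m) (quot_module ?R J)"
    have J: "ideal J ?R" unfolding J_def by (rule ideal_frobenius_power(1)[OF ideal])
    have N: "carrier N = (\<lambda>r. J +>\<^bsub>?R\<^esub> r) ` saturation m J"
      unfolding N_def by (rule local_cohomology0_carrier[OF J])
    have fin: "finite (carrier N)" and cardN: "card (carrier N) = card (carrier H) ^ ((CARD('p) ^ n) ^ m)"
      using card_saturation_frobenius_power[OF I refl, of n] by (simp_all add: N cosets J_def)
    then obtain k where k: "card (carrier N) = CARD('p) ^ k" "module_length ?R N = enat k"
      using len[OF J fin N_def] by blast
    have "CARD('p) ^ k = CARD('p) ^ (l * (CARD('p) ^ n) ^ m)"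
      using k(1) cardN by (simp add: l(1) power_mult)
    then have "k = l * (CARD('p) ^ n) ^ m" using p by (simp add: power_inject_exp)
    then show ?thesis using k(2) by (simp add: f_gHK_def N_def J_def)
  qed
  then show ?thesis using l by blast
qed

theorem proposition10p4:
  fixes p m :: nat
    and R :: "('p::prime_card) mod_ring mpol ring"
    and \<mm> I :: "'p mod_ring mpol set"
  assumes "p = CARD('p)"
    and "R = mpol_ring m"
    and "\<mm> = irrelevant_ideal m"
    and "graded_ideal m I"
  shows "(\<forall>n. ereal_of_enat (f_gHK R \<mm> p I n) = e_gHK R \<mm> p I * ereal (real ((p ^ n) ^ m))) \<and>
    ((\<exists>M :: ('p mod_ring mpol, 'p mod_ring mpol set) module.
        module R M \<and> module_length R M < \<infinity> \<and> e_gHK R \<mm> p I = ereal_of_enat (module_length R M)) \<and>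
     (\<exists>k :: nat. e_gHK R \<mm> p I = ereal (real k))) \<and>
    (e_gHK R \<mm> p I > 0 \<longleftrightarrow> proj_dim R (quot_module R I) = ereal_of_enat (krull_dim R))"
proof -
  let ?H = "local_cohomology0 R \<mm> (quot_module R I)"
  have ideal: "ideal I (mpol_ring m)" using assms(4) by (simp add: graded_ideal_def)
  interpret I: ideal I "mpol_ring m" by (rule ideal)
  have p: "p \<ge> 2" unfolding assms(1) using prime_card[where 'a = 'p] by (rule prime_ge_2_nat)
  obtain l where card: "card (carrier ?H) = p ^ l" and len: "module_length R ?H = enat l"
    and f: "\<And>n. f_gHK R \<mm> p I n = enat (l * (p ^ n) ^ m)"
    using f_gHK_eq[OF assms(4)] unfolding assms(1-3) by blast
  have dim: "krull_dim R = enat m" unfolding assms(2) by (rule krull_dim_mpol_ring)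
  \<comment> \<open>The normalised sequence is constant, so it converges and its limit is attained
    for every n.\<close>
  have "ereal_of_enat (f_gHK R \<mm> p I n) / ereal (real p ^ (n * the_enat (krull_dim R))) = ereal (real l)" for n
    using p by (simp add: f dim power_mult)
  then have e: "e_gHK R \<mm> p I = ereal (real l)"
    by (simp add: e_gHK_def convergent_const lim_const)
  have "module R ?H" unfolding assms(2,3) by (rule module_local_cohomology0[OF ideal])
  moreover have "l > 0 \<longleftrightarrow> proj_dim R (quot_module R I) = ereal_of_enat (krull_dim R)"
  proof -
    have "module R (quot_module R I)" unfolding assms(2) by (rule I.module_quot_module[OF cring_mpol_ring])
    have zero: "\<zero>\<^bsub>quot_module R I\<^esub> \<in> carrier ?H"
      using abelian_monoid.zero_closed[of ?H] \<open>module R ?H\<close>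
      by (simp add: module_def abelian_group_def local_cohomology0_def)
    have "l = 0 \<longleftrightarrow> card (carrier ?H) = 1" using p card by simp
    also have "\<dots> \<longleftrightarrow> carrier ?H = {\<zero>\<^bsub>quot_module R I\<^esub>}" using zero by (auto simp: card_1_singleton_iff)
    also have "\<dots> \<longleftrightarrow> socle_free mpol_var m (quot_module R I) 0 (carrier (quot_module R I))"
      unfolding assms(2,3) by (rule local_cohomology0_trivial_iff[OF ideal])
    finally show ?thesis
      using proj_dim_quot_module_eq_iff[OF assms(4)] by (auto simp: assms(2) dim[unfolded assms(2)])
  qed
  ultimately show ?thesis
    using len by (auto simp: f e intro!: exI[of _ ?H])
qed

end
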